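(* Let $\theta_0\in(0,\pi/2)$ and $$X=\{(\rho\cos\theta,\rho\sin\theta):\rho\ge0,\ \theta\in[\theta_0,2\pi-\theta_0]\}\subseteq\mathbb{R}^2,$$ let $\alpha>1$, and consider the pursuit-evasion game on $X$ with capture radius $0$, initial time $t_0$ and initial state $\mathbf{x}_0=(x_{p0},x_{e0})\in X\times X$, $x_{p0}\neq x_{e0}$. If the vertex of the obstacle (the origin) lies outside the closure of the evader's initial dominance region, i.e. $\|x_{p0}\|<\alpha\|x_{e0}\|$, then the pursuer has a non-anticipative strategy that prevents the evader from leaving its initial dominance region before being captured; that is, there exists $\delta\in\Delta^{t_0}(\mathbf{x}_0)$ such that for every $u_e\in\mathcal{U}^e_{t_0}(x_{e0})$ and every $t\in[t_0,t_f(\delta[u_e],u_e))$ one has $x_e(t;u_e)\in\mathcal{D}(x_{p0},x_{e0})$.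
   Context: Game. The pursuer and evader move in $X$ with $\dot x_p(t)=\alpha u_p(t)$, $\dot x_e(t)=u_e(t)$, $x_p(t_0)=x_{p0}$, $x_e(t_0)=x_{e0}$, $\alpha>1$, and may not leave $X$ (the complement $\mathbb{R}^2\setminus X$ is a single corner obstacle with vertex at the origin). $\mathcal{U}_{t_0}$ is the set of piecewise continuous functions $u:[t_0,+\infty)\to\{v\in\mathbb{R}^2:\|v\|=1\}$; $\mathcal{U}^p_{t_0}(x_{p0}),\mathcal{U}^e_{t_0}(x_{e0})\subseteq\mathcal{U}_{t_0}$ are the sets of admissible controls, i.e. those whose trajectory stays in $X$. Trajectories are denoted $x_p(t;u_p)$, $x_e(t;u_e)$. The terminal time is $t_f(u_p,u_e)=\inf\{t\ge t_0:x_p(t;u_p)=x_e(t;u_e)\}$ ($\inf\emptyset=+\infty$). Non-anticipative strategies. $\Delta^{t_0}(\mathbf{x}_0)$ is the set of maps $\delta:\mathcal{U}^e_{t_0}(x_{e0})\to\mathcal{U}^p_{t_0}(x_{p0})$ such that for all $t'>t_0$: if $u_e=u_e'$ a.e. on $[t_0,t']$, then $\delta[u_e]=\delta[u_e']$ a.e. on $[t_0,t']$. Distance and dominance region. $d_L(x_1,x_2)$ is the infimum of lengths of continuous piecewise smooth curves in $X$ joining $x_1,x_2\in X$. Concretely, if $x_i$ has polar angle $\theta_i\in[\theta_0,2\pi-\theta_0]$, then $d_L(x_1,x_2)=\|x_1-x_2\|$ if $|\theta_1-\theta_2|\le\pi$ and $d_L(x_1,x_2)=\|x_1\|+\|x_2\|$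 if $|\theta_1-\theta_2|>\pi$. The evader's dominance region is $\mathcal{D}(x_1,x_2)=\{x\in X:d_L(x,x_1)-\alpha d_L(x,x_2)>0\}$ (pursuer at $x_1$, evader at $x_2$). *)

theory Defs
  imports "HOL-Analysis.Analysis"
begin

type_synonym plane = "real \<times> real"

definition corner_domain :: "real \<Rightarrow> plane set" where
  "corner_domain \<theta>0 =
     {(\<rho> * cos \<theta>, \<rho> * sin \<theta>) | \<rho> \<theta>. 0 \<le> \<rho> \<and> \<theta> \<in> {\<theta>0..2 * pi - \<theta>0}}"

(* has_integral rather than integral: a valid_path may have unbounded speed at its
   finitely many break points, and a curve of infinite length must not be assigned length 0. *)
definition curve_lengths :: "plane set \<Rightarrow> plane \<Rightarrow> plane \<Rightarrow> real set" where
  "curve_lengths X x y =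
     {L. \<exists>\<gamma>. valid_path \<gamma> \<and> path_image \<gamma> \<subseteq> X \<and> pathstart \<gamma> = x \<and> pathfinish \<gamma> = y \<and>
          ((\<lambda>s. norm (vector_derivative \<gamma> (at s))) has_integral L) {0..1}}"

definition path_dist :: "plane set \<Rightarrow> plane \<Rightarrow> plane \<Rightarrow> real" where
  "path_dist X x y = Inf (curve_lengths X x y)"

definition dominance_region :: "plane set \<Rightarrow> real \<Rightarrow> plane \<Rightarrow> plane \<Rightarrow> plane set" where
  "dominance_region X \<alpha> x1 x2 = {x \<in> X. path_dist X x x1 - \<alpha> * path_dist X x x2 > 0}"

(* Locally finitely many discontinuities, each with finite one-sided limits. *)
definition piecewise_continuous_from :: "real \<Rightarrow> (real \<Rightarrow> plane) \<Rightarrow> bool" where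
  "piecewise_continuous_from t0 u \<longleftrightarrow>
     (\<exists>S. (\<forall>b. finite (S \<inter> {t0..b})) \<and> continuous_on ({t0..} - S) u) \<and>
     (\<forall>t\<ge>t0. \<exists>l. (u \<longlongrightarrow> l) (at_right t)) \<and>
     (\<forall>t>t0. \<exists>l. (u \<longlongrightarrow> l) (at_left t))"

(* Controls are total functions; their values before t0 are never used. *)
definition controls :: "real \<Rightarrow> (real \<Rightarrow> plane) set" where
  "controls t0 = {u. piecewise_continuous_from t0 u \<and> (\<forall>t\<ge>t0. norm (u t) = 1)}"

(* The solution of x' = c u, x(t0) = x0; the pursuer has c = \<alpha>, the evader c = 1. *)
definition trajectory :: "real \<Rightarrow> real \<Rightarrow> plane \<Rightarrow> (real \<Rightarrow> plane) \<Rightarrow> real \<Rightarrow> plane" where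
  "trajectory c t0 x0 u t = x0 + c *\<^sub>R integral {t0..t} u"

definition admissible_controls :: "plane set \<Rightarrow> real \<Rightarrow> real \<Rightarrow> plane \<Rightarrow> (real \<Rightarrow> plane) set" where
  "admissible_controls X c t0 x0 = {u \<in> controls t0. \<forall>t\<ge>t0. trajectory c t0 x0 u t \<in> X}"

definition terminal_time ::
  "real \<Rightarrow> real \<Rightarrow> plane \<Rightarrow> plane \<Rightarrow> (real \<Rightarrow> plane) \<Rightarrow> (real \<Rightarrow> plane) \<Rightarrow> ereal" where
  "terminal_time \<alpha> t0 xp0 xe0 up ue =
     Inf (ereal ` {t. t0 \<le> t \<and> trajectory \<alpha> t0 xp0 up t = trajectory 1 t0 xe0 ue t})"

definition nonanticipative_strategies ::
  "plane set \<Rightarrow> real \<Rightarrow> real \<Rightarrow> plane \<Rightarrow> plane \<Rightarrow> ((real \<Rightarrow> plane) \<Rightarrow> real \<Rightarrow> plane) set" where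
  "nonanticipative_strategies X \<alpha> t0 xp0 xe0 =
     {\<delta> \<in> admissible_controls X 1 t0 xe0 \<rightarrow> admissible_controls X \<alpha> t0 xp0.
        \<forall>t'>t0. \<forall>ue \<in> admissible_controls X 1 t0 xe0. \<forall>ue' \<in> admissible_controls X 1 t0 xe0.
          (AE t in lebesgue_on {t0..t'}. ue t = ue' t) \<longrightarrow>
          (AE t in lebesgue_on {t0..t'}. \<delta> ue t = \<delta> ue' t)}"

end

theory Submission
  imports Defs
begin

text \<open>
  At a fixed state (a, b) the pursuer can answer the evader's direction by a continuous function of it
  (parallel pursuit, folded or truncated where the obstacle interferes) in such a way that for a short time
  no boundary point of the dominance region is lost, and a boundary point stays tight only if the evader
  heads straight for it. By a continuous induction this gives a one-point Kirszbraun property: whenever the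
  evader moves from b to a point of its region, the pursuer has a move, of length at most \<open>\<alpha>\<close> times the
  displacement, after which the new dominance region is contained in the old one.

  Such moves are not nonanticipative, so the pursuer makes them one time step late. The lag is paid for by
  a margin: once the closed dominance region lies inside the initial one, part of the speed advantage can be
  given away. When the players are close, the pursuer finishes by following the evader's own path. To obtain
  the margin, the short-time answer is applied once. It fails only against an evader that starts straight
  towards a boundary point x; against that evader the pursuer runs along its own geodesic to x until the
  evader deviates, is captured, or the pursuer reaches the vertex, from where every point is visible.
\<close>

subsection \<open>Geometry of the corner\<close>

text \<open>Everything rests on one estimate. For unit directions of the evader the reply of
  parallel pursuit is a \<open>1/\<alpha>\<close>-Lipschitz map. If the evader deviates from the
  line to a boundary point x, the advantage gained by the pursuer is therefore linear in the
  deviation, with a factor bounded below, while the opposing terms carry the elapsed time as an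
  extra factor. Near the obstacle the reply is altered in ways that keep this inequality, with the
  vertex as a substitute for points hidden behind it. A frozen law is valid for a time that depends
  on the state, and no lower bound over the visited states is available, so laws cannot simply be
  chained. The induction passes to limits of positions by compactness. This forgets the controls: a
  move is known only from the end point of the evader's move. The claim concerns the region itself,
  so initially there is no room between the region and the set to be guarded. An evader that runs
  straight at a boundary point keeps it so, but its behaviour leaves the pursuer no choice: the
  reply along the geodesic is forced.\<close>

text \<open>The walls make the angle \<open>\<theta>0\<close> with the positive axis, and c, s are its cosine and sine; T and B are the
  signed distances from the lines that carry the top and the bottom wall.\<close>
locale corner =
  fixes c s :: real
  assumes c_pos: "0 < c" and s_pos: "0 < s" and cs1: "c\<^sup>2 + s\<^sup>2 = 1"
begin

definition T :: "plane \<Rightarrow> real" where "T z = c * snd z - s * fst z"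
definition B :: "plane \<Rightarrow> real" where "B z = - c * snd z - s * fst z"
definition X :: "plane set" where "X = {z. 0 \<le> T z \<or> 0 \<le> B z}"

text \<open>Polar angles that differ by more than \<pi>, expressed without angles. For points of
  \<open>X\<close>, \<open>B x < 0\<close> and \<open>T z < 0\<close> place x on the side of the top
  wall and z on that of the bottom wall; the last inequality is the sign of their cross product
  (\<open>cross_prod\<close> below). All inequalities are strict, so a segment through the vertex is
  not blocked.\<close>

definition blocked :: "plane \<Rightarrow> plane \<Rightarrow> bool" where
  "blocked x z \<longleftrightarrow> (B x < 0 \<and> T z < 0 \<and> T x * B z < T z * B x) \<or>
                   (B z < 0 \<and> T x < 0 \<and> T z * B x < T x * B z)"

definition dl :: "plane \<Rightarrow> plane \<Rightarrow> real" where
  "dl x z = (if blocked x z then norm x + norm z else dist x z)"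

lemma T_simps [simp]: "T 0 = 0" "T (x + y) = T x + T y" "T (x - y) = T x - T y" "T (- x) = - T x"
  "T (k *\<^sub>R x) = k * T x"
  by (auto simp: T_def algebra_simps)
lemma B_simps [simp]: "B 0 = 0" "B (x + y) = B x + B y" "B (x - y) = B x - B y" "B (- x) = - B x"
  "B (k *\<^sub>R x) = k * B x"
  by (auto simp: B_def algebra_simps)

lemma T_inner: "T z = (- s, c) \<bullet> z" and B_inner: "B z = (- s, - c) \<bullet> z"
  by (auto simp: T_def B_def inner_prod_def)

lemma norm_nT: "norm (- s, c) = 1" and norm_nB: "norm (- s, - c) = 1"
  using cs1 by (auto simp: norm_prod_def add.commute)

lemma abs_T_le: "\<bar>T z\<bar> \<le> norm z" and abs_B_le: "\<bar>B z\<bar> \<le> norm z"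
  using Cauchy_Schwarz_ineq2[of "(- s, c)" z] Cauchy_Schwarz_ineq2[of "(- s, - c)" z] norm_nT norm_nB
  by (auto simp: T_inner B_inner)

lemma cont_T [continuous_intros]: "continuous_on S f \<Longrightarrow> continuous_on S (\<lambda>x. T (f x))"
  and cont_B [continuous_intros]: "continuous_on S f \<Longrightarrow> continuous_on S (\<lambda>x. B (f x))"
  unfolding T_def B_def by (auto intro!: continuous_intros)

lemma tendsto_T [tendsto_intros]: "(f \<longlongrightarrow> l) F \<Longrightarrow> ((\<lambda>x. T (f x)) \<longlongrightarrow> T l) F"
  and tendsto_B [tendsto_intros]: "(f \<longlongrightarrow> l) F \<Longrightarrow> ((\<lambda>x. B (f x)) \<longlongrightarrow> B l) F"
  unfolding T_def B_def by (auto intro!: tendsto_intros)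

lemma TB_eq_0_iff: "T z = 0 \<and> B z = 0 \<longleftrightarrow> z = 0"
proof
  assume a: "T z = 0 \<and> B z = 0"
  have "T z + B z = - 2 * s * fst z" "T z - B z = 2 * c * snd z" by (auto simp: T_def B_def)
  then show "z = 0" using a c_pos s_pos by (auto simp: prod_eq_iff)
qed auto

lemma TB_eqI: "T x = T y \<Longrightarrow> B x = B y \<Longrightarrow> x = y"
  using TB_eq_0_iff[of "x - y"] by auto

lemma zero_in_X [simp]: "0 \<in> X" by (simp add: X_def)

lemma X_D: "z \<in> X \<Longrightarrow> T z < 0 \<Longrightarrow> 0 \<le> B z" "z \<in> X \<Longrightarrow> B z < 0 \<Longrightarrow> 0 \<le> T z"
  by (auto simp: X_def)

lemma closed_X: "closed X"
proof -
  have "X = {z. 0 \<le> T z} \<union> {z. 0 \<le> B z}" by (auto simp: X_def)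
  moreover have "closed {z. 0 \<le> T z}" "closed {z. 0 \<le> B z}"
    by (auto intro!: closed_Collect_le continuous_intros)
  ultimately show ?thesis by auto
qed

lemma scale_X: "z \<in> X \<Longrightarrow> 0 \<le> k \<Longrightarrow> k *\<^sub>R z \<in> X"
  by (auto simp: X_def)

lemma left_X:
  assumes "z \<in> X" "0 \<le> k" shows "z + k *\<^sub>R (- 1, 0) \<in> X"
proof -
  have "T (z + k *\<^sub>R (- 1, 0)) = T z + k * s" "B (z + k *\<^sub>R (- 1, 0)) = B z + k * s"
    by (auto simp: T_def B_def algebra_simps)
  moreover have "0 \<le> k * s" using assms s_pos by simp
  ultimately show ?thesis using assms unfolding X_def by auto
qed

lemma blocked_sym: "blocked x z \<longleftrightarrow> blocked z x"
  by (auto simp: blocked_def)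

lemma not_blocked_0 [simp]: "\<not> blocked x 0" "\<not> blocked 0 x"
  by (auto simp: blocked_def)

lemma not_blocked_self [simp]: "\<not> blocked x x"
  by (auto simp: blocked_def)

lemma not_blocked_segment:
  assumes "x \<in> X" "z \<in> X" "\<not> blocked x z"
  shows "closed_segment x z \<subseteq> X"
proof -
  \<comment> \<open>At a point of the segment inside the obstacle both linear functions are
    negative. Multiplying the two inequalities eliminates u and leaves the sign of the cross
    product.\<close>
  have key: "\<lbrakk>0 \<le> T x; B x < 0; T z < 0; 0 \<le> B z; 0 \<le> u; u \<le> 1; (1 - u) * T x + u * T z < 0;
     (1 - u) * B x + u * B z < 0\<rbrakk> \<Longrightarrow> T x * B z < T z * B x" for x z :: plane and u
  proof -
    assume a: "0 \<le> T x" "B x < 0" "T z < 0" "0 \<le> B z" "0 \<le> u" "u \<le> 1" "(1 - u) * T x + u * T z < 0"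
      "(1 - u) * B x + u * B z < 0"
    have u: "0 < u" "u < 1"
      using a by (cases "u = 0"; cases "u = 1"; simp)+
    have 1: "(1 - u) * T x < - u * T z" "u * B z < - (1 - u) * B x" using a(7,8) by (simp_all add: algebra_simps)
    have 2: "0 \<le> (1 - u) * T x" "0 \<le> u * B z" using a u by auto
    have "((1 - u) * T x) * (u * B z) < (- u * T z) * (- (1 - u) * B x)"
      by (rule mult_strict_mono'[OF 1 2])
    then have "(u * (1 - u)) * (T x * B z) < (u * (1 - u)) * (T z * B x)" by (simp add: algebra_simps)
    then show ?thesis using u by (simp add: mult_less_cancel_left_pos)
  qed
  show ?thesis
  proof
    fix w assume "w \<in> closed_segment x z"
    then obtain u where u: "0 \<le> u" "u \<le> 1" and w: "w = (1 - u) *\<^sub>R x + u *\<^sub>R z"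
      by (auto simp: in_segment)
    show "w \<in> X"
    proof (rule ccontr)
      assume "w \<notin> X"
      then have n: "(1 - u) * T x + u * T z < 0" "(1 - u) * B x + u * B z < 0"
        by (auto simp: X_def w)
      have n': "(1 - (1 - u)) * T z + (1 - u) * T x < 0" "(1 - (1 - u)) * B z + (1 - u) * B x < 0"
        using n by (simp_all add: add.commute)
      have f1: False if "0 \<le> T x" "0 \<le> T z"
        using n(1) u that mult_nonneg_nonneg[of "1 - u" "T x"] mult_nonneg_nonneg[of u "T z"] by linarith
      have f2: False if "0 \<le> B x" "0 \<le> B z"
        using n(2) u that mult_nonneg_nonneg[of "1 - u" "B x"] mult_nonneg_nonneg[of u "B z"] by linarith
      have "(0 \<le> T x \<or> 0 \<le> B x) \<and> (0 \<le> T z \<or> 0 \<le> B z)" using assms by (simp add: X_def)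
      then consider "0 \<le> T x" "B x < 0" "T z < 0" "0 \<le> B z" | "0 \<le> T z" "B z < 0" "T x < 0" "0 \<le> B x"
        using f1 f2 by (meson not_le)
      then show False
      proof cases
        case 1
        then have "blocked x z" using key[OF 1 u n] by (simp add: blocked_def)
        then show False using assms by simp
      next
        case 2
        then have "blocked x z" using key[OF 2 _ _ n'] u by (simp add: blocked_def)
        then show False using assms by simp
      qed
    qed
  qed
qed

lemma blocked_leaves:
  assumes "x \<in> X" "z \<in> X" "blocked x z"
  shows "\<not> closed_segment x z \<subseteq> X"
proof -
  have key: "\<exists>w\<in>closed_segment x z. w \<notin> X" if "x \<in> X" "z \<in> X" "B x < 0" "T z < 0" "T x * B z < T z * B x" for x z
  proof -
    have a: "0 \<le> T x" "0 \<le> B z" using that by (auto simp: X_def)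
    \<comment> \<open>\<open>T\<close> vanishes at the parameter p and \<open>B\<close> at q.
      Blockedness says p < q, and strictly between them both functions are negative.\<close>
    define p where "p = T x / (T x - T z)"
    define q where "q = B x / (B x - B z)"
    have d: "0 < T x - T z" "0 < B z - B x" using a that by auto
    have q: "q = (- B x) / (B z - B x)" unfolding q_def by (metis minus_diff_eq minus_divide_divide minus_minus)
    have "T x * (B z - B x) < (- B x) * (T x - T z)" using that by (simp add: algebra_simps)
    then have "(T x * (B z - B x)) / ((T x - T z) * (B z - B x)) < ((- B x) * (T x - T z)) / ((T x - T z) * (B z - B x))"
      using d by (intro divide_strict_right_mono) auto
    moreover have "(T x * (B z - B x)) / ((T x - T z) * (B z - B x)) = p"
      unfolding p_def using d by (intro nonzero_mult_divide_mult_cancel_right) auto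
    moreover have "((- B x) * (T x - T z)) / ((T x - T z) * (B z - B x)) = q"
      unfolding q mult.commute[of "T x - T z"] using d by (intro nonzero_mult_divide_mult_cancel_right) auto
    ultimately have "p < q" by simp
    define u where "u = (p + q) / 2"
    have u: "p < u" "u < q" using \<open>p < q\<close> by (auto simp: u_def)
    have "0 \<le> p" "q \<le> 1" using a d that by (auto simp: p_def q_def divide_simps)
    have "T x < u * (T x - T z)" using u(1) d by (simp add: p_def pos_divide_less_eq)
    have "u * (B z - B x) < - B x"
      using u(2) d unfolding q by (simp only: pos_less_divide_eq)
    then have "u * B z - u * B x < - B x" by (simp only: right_diff_distrib)
    moreover from \<open>T x < u * (T x - T z)\<close> have "T x < u * T x - u * T z" by (simp only: right_diff_distrib)
    ultimately have "(1 - u) *\<^sub>R x + u *\<^sub>R z \<notin> X" by (auto simp: X_def algebra_simps)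
    moreover have "(1 - u) *\<^sub>R x + u *\<^sub>R z \<in> closed_segment x z"
      unfolding in_segment using u \<open>0 \<le> p\<close> \<open>q \<le> 1\<close> by (intro exI[of _ u]) auto
    ultimately show ?thesis by blast
  qed
  from assms(3)[unfolded blocked_def] show ?thesis
  proof
    assume "B x < 0 \<and> T z < 0 \<and> T x * B z < T z * B x"
    then show ?thesis using key[of x z] assms by blast
  next
    assume "B z < 0 \<and> T x < 0 \<and> T z * B x < T x * B z"
    then show ?thesis using key[of z x] assms by (auto simp: closed_segment_commute[of x z])
  qed
qed

lemma segment_iff: "x \<in> X \<Longrightarrow> z \<in> X \<Longrightarrow> closed_segment x z \<subseteq> X \<longleftrightarrow> \<not> blocked x z"
  using blocked_leaves not_blocked_segment by blast

lemma not_blocked_convex: "convex S \<Longrightarrow> S \<subseteq> X \<Longrightarrow> x \<in> S \<Longrightarrow> z \<in> S \<Longrightarrow> \<not> blocked x z"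
  using segment_iff[of x z] closed_segment_subset[of x S z] by (meson subsetD subset_trans)

lemma dl_sym: "dl x z = dl z x"
  by (auto simp: dl_def blocked_sym dist_commute)

lemma dl_ge_dist: "dist x z \<le> dl x z"
  by (simp add: dl_def dist_norm norm_triangle_ineq4)

lemma dl_le_norms: "dl x z \<le> norm x + norm z"
  by (simp add: dl_def dist_norm norm_triangle_ineq4)

lemma dl_nonneg [simp]: "0 \<le> dl x z" by (simp add: dl_def)

lemma dl_refl [simp]: "dl x x = 0" by (simp add: dl_def)

lemma dl_eq_0_iff [simp]: "dl x z = 0 \<longleftrightarrow> x = z"
  using dl_ge_dist[of x z] by fastforce

lemma dl_0 [simp]: "dl x 0 = norm x" "dl 0 x = norm x"
  by (auto simp: dl_def)

lemma dl_unblocked: "\<not> blocked x z \<Longrightarrow> dl x z = dist x z"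
  by (simp add: dl_def)

text \<open>Up to a positive factor, the cross product of x and w.\<close>
definition cross_prod :: "plane \<Rightarrow> plane \<Rightarrow> real" where "cross_prod x w = T x * B w - T w * B x"

lemma cross_prod_simps [simp]: "cross_prod x (u + v) = cross_prod x u + cross_prod x v" "cross_prod x (u - v) = cross_prod x u - cross_prod x v"
  "cross_prod x (k *\<^sub>R u) = k * cross_prod x u" "cross_prod x x = 0" "cross_prod x 0 = 0" "cross_prod 0 x = 0" "cross_prod x (- u) = - cross_prod x u"
  by (auto simp: cross_prod_def algebra_simps)

lemma cross_prod_cross: "cross_prod x w = 2 * c * s * (fst x * snd w - snd x * fst w)"
  by (simp add: cross_prod_def T_def B_def algebra_simps)

lemma cross_prod_eq_0:
  assumes "cross_prod x w = 0" "x \<noteq> 0" shows "\<exists>l. w = l *\<^sub>R x"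
proof (cases "B x = 0")
  case True
  with assms have "T x \<noteq> 0" using TB_eq_0_iff[of x] by blast
  then have "w = (T w / T x) *\<^sub>R x" using assms True by (intro TB_eqI) (auto simp: cross_prod_def)
  then show ?thesis by blast
next
  case False
  then have "w = (B w / B x) *\<^sub>R x" using assms by (intro TB_eqI) (auto simp: cross_prod_def field_simps)
  then show ?thesis by blast
qed

lemma blocked1: "B x < 0 \<Longrightarrow> T z < 0 \<Longrightarrow> cross_prod x z < 0 \<Longrightarrow> blocked x z"
  by (auto simp: blocked_def cross_prod_def)

text \<open>A point on the far side of x (smaller polar angle) blocks even more.\<close>
lemma blocked_far:
  assumes "T x \<ge> 0" "B x \<le> 0" "x \<noteq> 0" "z \<in> X" "T z < 0" "cross_prod x z \<le> 0"
    and "T y \<ge> 0" "cross_prod x y < 0"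
  shows "B y < 0" "blocked y z"
proof -
  have Bz: "0 \<le> B z" using assms X_D by auto
  show By: "B y < 0"
  proof (rule ccontr)
    assume "\<not> B y < 0"
    then have "0 \<le> T x * B y" "T y * B x \<le> 0" using assms by (auto intro: mult_nonneg_nonneg mult_nonneg_nonpos)
    then show False using assms(8) by (simp add: cross_prod_def)
  qed
  have "T y * B z < T z * B y"
  proof (cases "B x = 0")
    case True
    then have "T x > 0" using assms TB_eq_0_iff[of x] by auto
    then have "B z = 0" using assms True Bz by (auto simp: cross_prod_def mult_le_0_iff)
    then show ?thesis using By assms by (simp add: mult_neg_neg)
  next
    case False
    then have Bx: "B x < 0" using assms by auto
    have 1: "T x * B y < T y * B x" "T x * B z \<le> T z * B x" using assms by (auto simp: cross_prod_def)
    have pos: "0 < B y / B x" using By Bx by (simp add: divide_neg_neg)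
    have 2: "T y < T x * (B y / B x)" using 1(1) Bx by (simp add: field_simps)
    show ?thesis
    proof (cases "B z = 0")
      case True then show ?thesis using By assms by (simp add: mult_neg_neg)
    next
      case False
      then have "T y * B z < T x * (B y / B x) * B z" using 2 Bz by (intro mult_strict_right_mono) auto
      also have "\<dots> = (B y / B x) * (T x * B z)" by simp
      also have "\<dots> \<le> (B y / B x) * (T z * B x)" using 1 pos by (intro mult_left_mono) auto
      also have "\<dots> = T z * B y" using Bx by simp
      finally show ?thesis .
    qed
  qed
  then show "blocked y z" using By assms by (auto simp: blocked_def)
qed

lemma cross_prod_zero_on_segment:
  assumes "cross_prod x y \<ge> 0" "cross_prod x z \<le> 0" "x \<noteq> 0"
  shows "\<exists>l. l *\<^sub>R x \<in> closed_segment y z"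
proof -
  define u where "u = (if cross_prod x y = cross_prod x z then 0 else cross_prod x y / (cross_prod x y - cross_prod x z))"
  have u: "0 \<le> u" "u \<le> 1" using assms by (auto simp: u_def divide_simps)
  have "(1 - u) * cross_prod x y + u * cross_prod x z = 0"
  proof (cases "cross_prod x y = cross_prod x z")
    case True then show ?thesis using assms by (auto simp: u_def)
  next
    case False
    then have "u * (cross_prod x y - cross_prod x z) = cross_prod x y" by (simp add: u_def)
    then show ?thesis by (simp add: algebra_simps)
  qed
  then have "cross_prod x ((1 - u) *\<^sub>R y + u *\<^sub>R z) = 0" by simp
  then obtain l where "(1 - u) *\<^sub>R y + u *\<^sub>R z = l *\<^sub>R x" using cross_prod_eq_0 assms by blast
  then show ?thesis using u by (metis in_segment(1))
qed

text \<open>A straight line from y to the shadow of x meets the ray opposite to x.\<close>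
lemma opposite_ray_on_segment:
  assumes "T x \<ge> 0" "B x \<le> 0" "x \<noteq> 0" "z \<in> X" "T z < 0" "cross_prod x z \<le> 0" "y \<in> X" "\<not> blocked y z"
    "cross_prod x y \<ge> 0"
  shows "\<exists>l\<le>0. l *\<^sub>R x \<in> closed_segment y z"
proof -
  obtain l where l: "l *\<^sub>R x \<in> closed_segment y z"
    using cross_prod_zero_on_segment assms by blast
  show ?thesis
  proof (cases "l \<le> 0")
    case True then show ?thesis using l by blast
  next
    case False
    have sub: "closed_segment (l *\<^sub>R x) z \<subseteq> X"
      using l assms by (meson ends_in_segment(2) not_blocked_segment subset_closed_segment subset_trans)
    then have lx: "l *\<^sub>R x \<in> X" by auto
    show ?thesis
    \<comment> \<open>A hit on the ray through x itself would be blocked from z just as x is,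
      although it lies on a free segment that ends in z. Only the degenerate position of z on the
      opposite ray remains, and then z is the required point.\<close>
    proof (cases "B x < 0 \<and> cross_prod x z < 0")
      case True
      have "cross_prod (l *\<^sub>R x) z = l * cross_prod x z" by (simp add: cross_prod_def algebra_simps)
      then have "blocked (l *\<^sub>R x) z" using True False assms by (intro blocked1) (auto simp: mult_pos_neg)
      then show ?thesis using sub lx assms segment_iff by blast
    next
      case F: False
      have "\<exists>m. z = m *\<^sub>R x"
      proof -
        have "cross_prod x z = 0"
        proof (cases "B x < 0")
          case True then show ?thesis using F assms by auto
        next
          case f2: False
          then have "B x = 0" using assms by auto
          moreover have "0 \<le> T x * B z" using assms(1,5) X_D(1)[OF assms(4)] by simp
          ultimately show ?thesis using assms(6) by (simp add: cross_prod_def)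
        qed
        then show ?thesis using cross_prod_eq_0 assms by blast
      qed
      then obtain m where m: "z = m *\<^sub>R x" by auto
      then have "m < 0" using assms by (auto simp: mult_less_0_iff)
      then show ?thesis using m by (intro exI[of _ m]) auto
    qed
  qed
qed

lemma norm_opposite: "l \<le> 0 \<Longrightarrow> dist x (l *\<^sub>R x) = norm x + norm (l *\<^sub>R x)"
proof -
  assume "l \<le> 0"
  have "x - l *\<^sub>R x = (1 - l) *\<^sub>R x" by (simp add: algebra_simps)
  then have "dist x (l *\<^sub>R x) = (1 - l) * norm x" using \<open>l \<le> 0\<close> by (simp add: dist_norm)
  then show ?thesis using \<open>l \<le> 0\<close> by (simp add: algebra_simps)
qed

text \<open>Only a blocked pair x, z with a point y visible from both needs geometry. The two
  segments together must cross the ray opposite to x, and reaching a point w of that ray costs at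
  least \<open>norm x + norm w\<close>, as much as the way through the vertex.\<close>

lemma dl_triangle:
  assumes "x \<in> X" "y \<in> X" "z \<in> X"
  shows "dl x z \<le> dl x y + dl y z"
proof -
  have key: "norm x + norm z \<le> dist x y + dist y z"
    if h: "x \<in> X" "y \<in> X" "z \<in> X" "\<not> blocked x y" "\<not> blocked y z" "B x < 0" "T z < 0" "cross_prod x z < 0" for x y z
  proof -
    have x: "T x \<ge> 0" "B x \<le> 0" "x \<noteq> 0" using that X_D by auto
    have "cross_prod x y \<ge> 0"
    proof (rule ccontr)
      assume n: "\<not> cross_prod x y \<ge> 0"
      show False
      proof (cases "T y \<ge> 0")
        case True
        then show False using blocked_far(2)[OF x, of z y] that n by auto
      next
        case False
        then show False using blocked1[of x y] that n by auto
      qed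
    qed
    then obtain l where l: "l \<le> 0" "l *\<^sub>R x \<in> closed_segment y z"
      using opposite_ray_on_segment[OF x h(3) h(7) less_imp_le[OF h(8)] h(2) h(5)] by blast
    have "dist y z = dist y (l *\<^sub>R x) + dist (l *\<^sub>R x) z"
      using l(2) by (metis between between_mem_segment)
    moreover have "norm x + norm (l *\<^sub>R x) \<le> dist x y + dist y (l *\<^sub>R x)"
      using norm_opposite[OF l(1), of x] dist_triangle[of x "l *\<^sub>R x" y] by linarith
    moreover have "norm z \<le> norm (l *\<^sub>R x) + dist (l *\<^sub>R x) z"
      by (metis dist_commute dist_norm norm_triangle_sub)
    ultimately show ?thesis by linarith
  qed
  consider "\<not> blocked x z" | "blocked x y" | "blocked y z" | "\<not> blocked x y" "\<not> blocked y z" "blocked x z" by blast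
  then show ?thesis
  proof cases
    case 1
    then show ?thesis using dl_ge_dist[of x y] dl_ge_dist[of y z] dist_triangle[of x z y] by (simp add: dl_def)
  next
    case 2
    have "dl x z \<le> norm x + norm z" by (rule dl_le_norms)
    moreover have "norm z \<le> norm y + dist y z" by (metis dist_commute dist_norm norm_triangle_sub)
    ultimately show ?thesis using 2 dl_ge_dist[of y z] by (simp add: dl_def)
  next
    case 3
    have "dl x z \<le> norm x + norm z" by (rule dl_le_norms)
    moreover have "norm x \<le> norm y + dist x y" by (metis dist_norm norm_triangle_sub)
    ultimately show ?thesis using 3 dl_ge_dist[of x y] by (simp add: dl_def)
  next
    case 4
    then have "(B x < 0 \<and> T z < 0 \<and> cross_prod x z < 0) \<or> (B z < 0 \<and> T x < 0 \<and> cross_prod z x < 0)"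
      by (auto simp: blocked_def cross_prod_def)
    then show ?thesis
      using key[of x y z] key[of z y x] 4 assms by (auto simp: dl_def dist_commute blocked_sym)
  qed
qed

text \<open>If the path missed the ray opposite to its start, the times spent in the shadow of the
  start would form a subset of the interval that is open and closed, contains q and omits p.\<close>

lemma path_crosses_opposite_ray:
  fixes g :: "real \<Rightarrow> plane"
  assumes cont: "continuous_on {p..q} g" and X: "\<And>t. t \<in> {p..q} \<Longrightarrow> g t \<in> X" and pq: "p \<le> q"
    and bl: "blocked (g p) (g q)"
  shows "\<exists>t\<in>{p..q}. \<exists>l\<le>0. g t = l *\<^sub>R g p"
proof -
  \<comment> \<open>Stated for abstract functions \<open>T'\<close> and \<open>B'\<close> so that
    the walls can be exchanged: the second case of blockedness applies it with \<open>B\<close> in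
    the place of \<open>T\<close>.\<close>
  have key: "\<exists>t\<in>{p..q}. \<exists>l\<le>0. g t = l *\<^sub>R g p"
    if cont: "continuous_on {p..q} T'" "continuous_on {p..q} B'"
      and X: "\<And>t. t \<in> {p..q} \<Longrightarrow> T' t \<ge> 0 \<or> B' t \<ge> 0"
      and bl: "B' p < 0" "T' q < 0" "T' p * B' q - T' q * B' p < 0"
      and eq: "\<And>t. t \<in> {p..q} \<Longrightarrow> T' p * B' t - T' t * B' p = 0 \<Longrightarrow> \<exists>l. T' t = l * T' p \<and> B' t = l * B' p \<and> g t = l *\<^sub>R g p"
    for T' B' :: "real \<Rightarrow> real"
  proof (rule ccontr)
    assume none: "\<not> ?thesis"
    let ?k = "\<lambda>t. T' p * B' t - T' t * B' p"
    have Tp: "T' p \<ge> 0" using X[of p] pq bl by auto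
    let ?S = "{t\<in>{p..q}. T' t < 0 \<and> ?k t < 0}"
    \<comment> \<open>Off the opposite ray the strict inequalities may be weakened, which makes the
      set closed: a vanishing cross product would put the path on that ray, and a vanishing
      \<open>T'\<close> would make the cross product nonnegative.\<close>
    have S2: "?S = {t\<in>{p..q}. T' t \<le> 0 \<and> ?k t \<le> 0 \<and> 0 \<le> B' t}"
    proof (intro set_eqI iffI)
      fix t assume "t \<in> ?S" then show "t \<in> {t\<in>{p..q}. T' t \<le> 0 \<and> ?k t \<le> 0 \<and> 0 \<le> B' t}" using X[of t] by auto
    next
      fix t assume t: "t \<in> {t\<in>{p..q}. T' t \<le> 0 \<and> ?k t \<le> 0 \<and> 0 \<le> B' t}"
      have "?k t \<noteq> 0"
      proof
        assume k0: "?k t = 0"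
        then obtain l where l: "T' t = l * T' p" "B' t = l * B' p" "g t = l *\<^sub>R g p" using eq t by blast
        then have "l \<le> 0" using t bl by (auto simp: zero_le_mult_iff)
        then show False using none l t by blast
      qed
      moreover have "T' t \<noteq> 0"
      proof
        assume "T' t = 0"
        then have "?k t \<ge> 0" using t Tp by simp
        then show False using calculation t by auto
      qed
      ultimately show "t \<in> ?S" using t by auto
    qed
    have ck: "continuous_on {p..q} ?k" using cont by (intro continuous_intros)
    have "?S = {p..q} \<inter> T' -` {..<0} \<inter> ({p..q} \<inter> ?k -` {..<0})" by auto
    then have op: "openin (top_of_set {p..q}) ?S"
      using openin_Int[OF continuous_openin_preimage_gen[OF cont(1) open_lessThan]
          continuous_openin_preimage_gen[OF ck open_lessThan], of 0 0] by simp
    have "?S = {p..q} \<inter> T' -` {..0} \<inter> ({p..q} \<inter> ?k -` {..0}) \<inter> ({p..q} \<inter> B' -` {0..})" unfolding S2 by auto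
    then have cl: "closedin (top_of_set {p..q}) ?S"
      using closedin_Int[OF closedin_Int[OF continuous_closedin_preimage[OF cont(1) closed_atMost]
          continuous_closedin_preimage[OF ck closed_atMost]]
          continuous_closedin_preimage[OF cont(2) closed_atLeast], of 0 0 0] by simp
    have d: "?S = {} \<or> ?S = {p..q}"
      by (rule connected_clopen[THEN iffD1, OF connected_Icc, rule_format, OF conjI[OF op cl]])
    have q: "q \<in> ?S" using bl pq by simp
    have p: "p \<notin> ?S" by simp
    from d show False
    proof
      assume "?S = {}" then show False using q by (rule_tac emptyE) (simp only:)
    next
      assume "?S = {p..q}"
      moreover have "p \<in> {p..q}" using pq by simp
      ultimately have "p \<in> ?S" by (simp only:)
      then show False using p by (rule_tac notE)
    qed
  qed
  have nz: "g p \<noteq> 0" using bl by auto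
  have TX: "0 \<le> T (g t) \<or> 0 \<le> B (g t)" if "t \<in> {p..q}" for t using X[OF that] by (simp add: X_def)
  have c: "continuous_on {p..q} (\<lambda>t. T (g t))" "continuous_on {p..q} (\<lambda>t. B (g t))"
    using cont_T[OF cont] cont_B[OF cont] by simp_all
  have col: "\<exists>l. T (g t) = l * T (g p) \<and> B (g t) = l * B (g p) \<and> g t = l *\<^sub>R g p" if h: "cross_prod (g p) (g t) = 0" for t
  proof -
    obtain l where "g t = l *\<^sub>R g p" using cross_prod_eq_0[OF h nz] by blast
    then show ?thesis by (intro exI[of _ l]) simp
  qed
  from bl[unfolded blocked_def] show ?thesis
  proof
    assume h: "B (g p) < 0 \<and> T (g q) < 0 \<and> T (g p) * B (g q) < T (g q) * B (g p)"
    show ?thesis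
    proof (rule key[OF c])
      fix t assume "t \<in> {p..q}" "T (g p) * B (g t) - T (g t) * B (g p) = 0"
      then show "\<exists>l. T (g t) = l * T (g p) \<and> B (g t) = l * B (g p) \<and> g t = l *\<^sub>R g p"
        by (intro col) (simp add: cross_prod_def)
    qed (use h TX in auto)
  next
    assume h: "B (g q) < 0 \<and> T (g p) < 0 \<and> T (g q) * B (g p) < T (g p) * B (g q)"
    show ?thesis
    proof (rule key[OF c(2) c(1)])
      fix t assume "t \<in> {p..q}" "B (g p) * T (g t) - B (g t) * T (g p) = 0"
      then show "\<exists>l. B (g t) = l * B (g p) \<and> T (g t) = l * T (g p) \<and> g t = l *\<^sub>R g p"
        using col[of t] by (auto simp add: cross_prod_def algebra_simps)
    qed (use h TX in \<open>auto simp: algebra_simps\<close>)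
  qed
qed

lemma dl_le_via_ray:
  assumes "l \<le> 0" "w = l *\<^sub>R x"
  shows "norm x + norm z \<le> dist x w + dist w z"
  using norm_opposite[OF assms(1), of x] assms(2) norm_triangle_sub[of z w]
  by (simp add: dist_norm norm_minus_commute)

text \<open>Meant for the evader's trajectories, which come as Lipschitz curves. Splitting a curve
  at the opposite ray bounds the intrinsic distance of its ends by speed times elapsed time.\<close>

lemma dl_Lipschitz_path:
  assumes "\<And>t t'. t \<in> {p..q} \<Longrightarrow> t' \<in> {p..q} \<Longrightarrow> dist (g t) (g t') \<le> k * \<bar>t - t'\<bar>"
    and X: "\<And>t. t \<in> {p..q} \<Longrightarrow> g t \<in> X" and pq: "p \<le> q"
  shows "dl (g p) (g q) \<le> k * (q - p)"
proof (cases "blocked (g p) (g q)")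
  case False
  then show ?thesis using assms(1)[of p q] pq by (simp add: dl_def)
next
  case True
  have "continuous_on {p..q} g"
  proof (cases "p = q")
    case F: False
    have "0 \<le> k * \<bar>p - q\<bar>" using assms(1)[of p q] pq by (meson atLeastAtMost_iff dual_order.trans order_refl zero_le_dist)
    then have "0 \<le> k" using F by (simp add: zero_le_mult_iff)
    then have "k-lipschitz_on {p..q} g" using assms(1) by (auto intro!: lipschitz_onI simp: dist_real_def)
    then show ?thesis by (rule lipschitz_on_continuous_on)
  qed auto
  then obtain t l where t: "t \<in> {p..q}" "l \<le> 0" "g t = l *\<^sub>R g p"
    using path_crosses_opposite_ray[OF _ X pq True] by blast
  have "dl (g p) (g q) \<le> dist (g p) (g t) + dist (g t) (g q)"
    using dl_le_via_ray[OF t(2,3), of "g q"] True by (simp add: dl_def)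
  also have "\<dots> \<le> k * \<bar>p - t\<bar> + k * \<bar>t - q\<bar>" using t(1) pq by (intro add_mono assms(1)) auto
  also have "\<dots> = k * (q - p)" using t by (auto simp: algebra_simps)
  finally show ?thesis .
qed

text \<open>\<open>blocked\<close> jumps, \<open>dl\<close> does not. Points of \<open>X\<close>
  close to a limit other than the vertex are not blocked from it, at the vertex \<open>dl\<close> is
  the norm, and the triangle inequality turns these one-variable limits into joint
  continuity.\<close>

lemma tendsto_dl:
  assumes "(f \<longlongrightarrow> l) F" "(g \<longlongrightarrow> m) F" "l \<in> X" "m \<in> X" "\<forall>\<^sub>F t in F. f t \<in> X" "\<forall>\<^sub>F t in F. g t \<in> X"
  shows "((\<lambda>t. dl (f t) (g t)) \<longlongrightarrow> dl l m) F"
proof -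
  have one: "((\<lambda>t. dl (f t) l) \<longlongrightarrow> 0) F" if f: "(f \<longlongrightarrow> l) F" "l \<in> X" "\<forall>\<^sub>F t in F. f t \<in> X" for f l
  proof (cases "l = 0")
    case True
    then show ?thesis using f tendsto_norm_zero by auto
  next
    case False
    have "\<forall>\<^sub>F t in F. \<not> (B l < 0 \<and> 0 \<le> B (f t))"
    proof (cases "B l < 0")
      case True
      then show ?thesis using order_tendstoD(2)[OF tendsto_B[OF f(1)], of 0]
        by (auto elim: eventually_mono)
    qed auto
    moreover have "\<forall>\<^sub>F t in F. \<not> (T l < 0 \<and> 0 \<le> T (f t))"
    proof (cases "T l < 0")
      case True
      then show ?thesis using order_tendstoD(2)[OF tendsto_T[OF f(1)], of 0]
        by (auto elim: eventually_mono)
    qed auto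
    ultimately have "\<forall>\<^sub>F t in F. dl (f t) l = dist (f t) l"
      using f(3)
    proof eventually_elim
      case (elim t)
      then have "\<not> blocked (f t) l" using f(2) X_D[of "f t"] unfolding blocked_def by linarith
      then show ?case by (simp add: dl_def)
    qed
    moreover have "((\<lambda>t. dist (f t) l) \<longlongrightarrow> 0) F" using f(1) tendsto_dist_iff by blast
    ultimately show ?thesis by (simp add: tendsto_cong)
  qed
  have "((\<lambda>t. dl (f t) l + dl (g t) m) \<longlongrightarrow> 0 + 0) F" using one assms by (intro tendsto_add) auto
  then have 0: "((\<lambda>t. dl (f t) l + dl (g t) m) \<longlongrightarrow> 0) F" by simp
  have "\<forall>\<^sub>F t in F. dist (dl (f t) (g t)) (dl l m) \<le> dl (f t) l + dl (g t) m"
    using assms(5,6)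
  proof eventually_elim
    case (elim t)
    have "dl (f t) (g t) \<le> dl (f t) l + dl l (g t)" "dl l (g t) \<le> dl l m + dl m (g t)"
      "dl l m \<le> dl l (f t) + dl (f t) m" "dl (f t) m \<le> dl (f t) (g t) + dl (g t) m"
      using elim assms by (auto intro!: dl_triangle)
    then show ?case using dl_sym[of l "f t"] dl_sym[of m "g t"] by (simp add: dist_real_def)
  qed
  then have "((\<lambda>t. dist (dl (f t) (g t)) (dl l m)) \<longlongrightarrow> 0) F"
    by (intro tendsto_sandwich[OF _ _ tendsto_const 0]) auto
  then show ?thesis by (simp add: tendsto_dist_iff[symmetric])
qed

lemma continuous_on_dl:
  "S \<subseteq> X \<Longrightarrow> a \<in> X \<Longrightarrow> continuous_on S (\<lambda>z. dl z a)"
  unfolding continuous_on_def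
proof
  fix z assume "S \<subseteq> X" "a \<in> X" "z \<in> S"
  moreover have "\<forall>\<^sub>F t in at z within S. t \<in> S" by (simp add: eventually_at_filter)
  ultimately show "((\<lambda>z. dl z a) \<longlongrightarrow> dl z a) (at z within S)"
    by (intro tendsto_dl tendsto_ident_at tendsto_const) (auto elim: eventually_mono simp del: split_paired_All)
qed


section \<open>The explicit distance as an infimum of curve lengths\<close>

lemma dl_le_curve_length:
  assumes "x \<in> X" "y \<in> X" "L \<in> curve_lengths X x y"
  shows "dl x y \<le> L"
proof -
  obtain g where g: "valid_path g" "path_image g \<subseteq> X" "pathstart g = x" "pathfinish g = y"
    and L: "((\<lambda>s. norm (vector_derivative g (at s))) has_integral L) {0..1}"
    using assms(3) unfolding curve_lengths_def by blast
  obtain S where S: "finite S" "g C1_differentiable_on {0..1} - S" and cont: "continuous_on {0..1} g"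
    using g(1) unfolding valid_path_def piecewise_C1_differentiable_on_def by blast
  let ?n = "\<lambda>s. norm (vector_derivative g (at s))"
  have n: "?n integrable_on {p..q}" if "0 \<le> p" "q \<le> 1" for p q
    using L that by (meson atLeastatMost_subset_iff has_integral_integrable integrable_on_subinterval)
  \<comment> \<open>Each chord is bounded by the length of its arc, through the fundamental theorem
    of calculus off finitely many break points. In the blocked case two such arcs meet on the
    opposite ray.\<close>
  have bound: "dist (g p) (g q) \<le> integral {p..q} ?n" if pq: "0 \<le> p" "p \<le> q" "q \<le> 1" for p q
  proof -
    have "((\<lambda>s. vector_derivative g (at s)) has_integral (g q - g p)) {p..q}"
    proof (rule fundamental_theorem_of_calculus_interior_strong[OF S(1) pq(2)])
      fix t assume "t \<in> {p<..<q} - S"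
      then have "g differentiable at t" using S(2) pq unfolding C1_differentiable_on_eq by auto
      then show "(g has_vector_derivative vector_derivative g (at t)) (at t)"
        by (simp add: vector_derivative_works)
    qed (use cont pq in \<open>auto elim: continuous_on_subset\<close>)
    then have i: "(\<lambda>s. vector_derivative g (at s)) integrable_on {p..q}"
      and e: "integral {p..q} (\<lambda>s. vector_derivative g (at s)) = g q - g p"
      by (auto simp: has_integral_integrable_integral)
    have "norm (integral {p..q} (\<lambda>s. vector_derivative g (at s))) \<le> integral {p..q} ?n"
      using i n[OF pq(1,3)] by (rule integral_norm_bound_integral) simp
    then show ?thesis unfolding e by (simp add: dist_norm norm_minus_commute)
  qed
  have gX: "g t \<in> X" if "t \<in> {0..1}" for t using that g(2) unfolding path_image_def by blast
  have ends: "g 0 = x" "g 1 = y" using g by (auto simp: pathstart_def pathfinish_def)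
  have Li: "integral {0..1} ?n = L" using L by (rule integral_unique)
  show ?thesis
  proof (cases "blocked x y")
    case False
    then show ?thesis using bound[of 0 1] ends Li by (simp add: dl_def)
  next
    case True
    then have "blocked (g 0) (g 1)" using ends by simp
    then obtain t l where t: "t \<in> {0..1}" "l \<le> 0" "g t = l *\<^sub>R g 0"
      using path_crosses_opposite_ray[OF cont gX] by auto
    have "dl x y \<le> dist (g 0) (g t) + dist (g t) (g 1)"
      using dl_le_via_ray[OF t(2,3), of y] True ends by (simp add: dl_def)
    also have "\<dots> \<le> integral {0..t} ?n + integral {t..1} ?n" using t by (intro add_mono bound) auto
    also have "\<dots> = L" using t Li Henstock_Kurzweil_Integration.integral_combine[OF _ _ n[of 0 1], of t] by auto
    finally show ?thesis .
  qed
qed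

lemma segment_curve_length:
  assumes "closed_segment x y \<subseteq> X" shows "dist x y \<in> curve_lengths X x y"
proof -
  have "((\<lambda>s. norm (vector_derivative (linepath x y) (at s))) has_integral dist x y) {0..1::real}"
    using has_integral_const_real[of "dist x y" 0 1] by (simp add: dist_norm norm_minus_commute)
  then show ?thesis unfolding curve_lengths_def using assms
    by (intro CollectI exI[of _ "linepath x y"]) auto
qed

lemma via_vertex_curve_length:
  assumes "x \<in> X" "y \<in> X" shows "norm x + norm y \<in> curve_lengths X x y"
proof -
  let ?g = "linepath x 0 +++ linepath 0 y"
  have d1: "vector_derivative ?g (at t) = - 2 *\<^sub>R x" if "t < 1/2" for t
  proof (rule vector_derivative_at)
    have "((\<lambda>t. (1 - 2 * t) *\<^sub>R x) has_vector_derivative (- 2 *\<^sub>R x)) (at t)"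
      by (auto intro!: derivative_eq_intros)
    then show "(?g has_vector_derivative (- 2 *\<^sub>R x)) (at t)"
    proof (rule has_vector_derivative_transform_within_open[of _ _ _ "{..<1/2}"])
    qed (use that in \<open>auto simp: joinpaths_def linepath_def\<close>)
  qed
  have d2: "vector_derivative ?g (at t) = 2 *\<^sub>R y" if "t > 1/2" for t
  proof (rule vector_derivative_at)
    have "((\<lambda>t. (2 * t - 1) *\<^sub>R y) has_vector_derivative (2 *\<^sub>R y)) (at t)"
      by (auto intro!: derivative_eq_intros)
    then show "(?g has_vector_derivative (2 *\<^sub>R y)) (at t)"
    proof (rule has_vector_derivative_transform_within_open[of _ _ _ "{1/2<..}"])
    qed (use that in \<open>auto simp: joinpaths_def linepath_def\<close>)
  qed
  let ?n = "\<lambda>s. norm (vector_derivative ?g (at s))"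
  have "(?n has_integral norm x) {0..1/2::real}"
  proof (rule has_integral_spike_finite[of "{1/2}"])
    show "((\<lambda>_. 2 * norm x) has_integral norm x) {0..1/2::real}"
      using has_integral_const_real[of "2 * norm x" 0 "1/2"] by simp
  qed (use d1 in auto)
  moreover have "(?n has_integral norm y) {1/2..1::real}"
  proof (rule has_integral_spike_finite[of "{1/2}"])
    show "((\<lambda>_. 2 * norm y) has_integral norm y) {1/2..1::real}"
      using has_integral_const_real[of "2 * norm y" "1/2" 1] by simp
  qed (use d2 in auto)
  ultimately have "(?n has_integral norm x + norm y) {0..1}"
    by (intro has_integral_combine[of 0 "1/2" 1]) auto
  moreover have "closed_segment x 0 \<subseteq> X" "closed_segment 0 y \<subseteq> X"
    using not_blocked_segment[of x 0] not_blocked_segment[of 0 y] assms by simp_all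
  then have "path_image ?g \<subseteq> X" by (simp add: path_image_join)
  moreover have "valid_path ?g" by (intro valid_path_join) auto
  ultimately show ?thesis unfolding curve_lengths_def by (intro CollectI exI[of _ ?g]) auto
qed

lemma path_dist_eq:
  assumes "x \<in> X" "y \<in> X" shows "path_dist X x y = dl x y"
proof -
  have "dl x y \<in> curve_lengths X x y"
    using segment_curve_length not_blocked_segment[OF assms] via_vertex_curve_length[OF assms] by (simp add: dl_def)
  then show ?thesis unfolding path_dist_def
    by (intro cInf_eq_minimum dl_le_curve_length assms)
qed

end

section \<open>Polar description versus half planes\<close>

lemma corner_domain_eq:
  assumes "0 < t" "t < pi / 2"
  shows "corner_domain t = corner.X (cos t) (sin t)"
proof -
  have c: "0 < cos t" "0 < sin t" using assms by (auto intro: cos_gt_zero sin_gt_zero)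
  interpret corner "cos t" "sin t" by unfold_locales (use c in auto)
  show ?thesis
  proof
    show "corner_domain t \<subseteq> X"
    proof
      fix z assume "z \<in> corner_domain t"
      then obtain r a where z: "z = (r * cos a, r * sin a)" "0 \<le> r" "t \<le> a" "a \<le> 2 * pi - t"
        unfolding corner_domain_def by auto
      have TB: "T z = r * sin (a - t)" "B z = - r * sin (a + t)"
        by (auto simp: T_def B_def z sin_diff sin_add algebra_simps)
      show "z \<in> X"
      proof (cases "a - t \<le> pi")
        case True
        then have "0 \<le> sin (a - t)" using z by (intro sin_ge_zero) auto
        then show ?thesis using TB z by (simp add: X_def)
      next
        case False
        then have "0 \<le> sin (a + t - pi)" using z assms by (intro sin_ge_zero) auto
        then have "sin (a + t) \<le> 0" by (simp add: sin_diff)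
        then show ?thesis using TB z by (simp add: X_def mult_nonneg_nonpos)
      qed
    qed
    show "X \<subseteq> corner_domain t"
    proof
      fix z assume z: "z \<in> X"
      show "z \<in> corner_domain t"
      proof (cases "z = 0")
        case True
        then show ?thesis using assms unfolding corner_domain_def
          by (intro CollectI exI[of _ 0] exI[of _ pi]) (auto simp: zero_prod_def)
      next
        case False
        define r where "r = norm z"
        have r: "r > 0" using False by (simp add: r_def)
        have "(fst z / r)\<^sup>2 + (snd z / r)\<^sup>2 = 1"
        proof -
          have "r\<^sup>2 = (fst z)\<^sup>2 + (snd z)\<^sup>2" unfolding r_def norm_prod_def by simp
          then have "((fst z)\<^sup>2 + (snd z)\<^sup>2) / r\<^sup>2 = 1" using r by (metis divide_self less_irrefl zero_less_power)
          then show ?thesis by (simp add: power_divide add_divide_distrib)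
        qed
        then obtain a where a: "0 \<le> a" "a < 2 * pi" "fst z / r = cos a" "snd z / r = sin a"
          using sincos_total_2pi by metis
        have zz: "z = (r * cos a, r * sin a)" using a r by (auto simp: prod_eq_iff field_simps)
        have TB: "T z = r * sin (a - t)" "B z = - r * sin (a + t)"
          by (auto simp: T_def B_def zz sin_diff sin_add algebra_simps)
        have or: "0 \<le> sin (a - t) \<or> sin (a + t) \<le> 0"
          using z r TB by (auto simp: X_def zero_le_mult_iff mult_le_0_iff)
        have "t \<le> a"
        proof (rule ccontr)
          assume "\<not> t \<le> a"
          then have "sin (t - a) > 0" "sin (a + t) > 0" using a assms by (intro sin_gt_zero; linarith)+
          then show False using or sin_minus[of "t - a"] by simp
        qed
        moreover have "a \<le> 2 * pi - t"
        proof (rule ccontr)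
          assume n: "\<not> a \<le> 2 * pi - t"
          then have "sin (a + t - 2 * pi) > 0" "sin (a - t - pi) > 0" using a assms by (intro sin_gt_zero; linarith)+
          moreover have "sin (a + t - 2 * pi) = sin (a + t)" "sin (a - t - pi) = - sin (a - t)"
            by (simp_all add: sin_diff)
          ultimately show False using or by linarith
        qed
        ultimately show ?thesis unfolding corner_domain_def using zz r by (intro CollectI exI[of _ r] exI[of _ a]) auto
      qed
    qed
  qed
qed

lemma norm_sq_combination:
  fixes u U :: "'a::real_inner"
  shows "(norm (p *\<^sub>R u + q *\<^sub>R U))\<^sup>2 = p\<^sup>2 * (norm u)\<^sup>2 + q\<^sup>2 * (norm U)\<^sup>2 + 2 * p * q * (u \<bullet> U)"
  unfolding power2_norm_eq_inner
  by (simp only: inner_add_left inner_add_right inner_scaleR_left inner_scaleR_right inner_commute[of U u])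
    (simp only: power2_eq_square algebra_simps)

lemma norm_sq_difference:
  fixes u U :: "'a::real_inner"
  shows "(norm (p *\<^sub>R u - q *\<^sub>R U))\<^sup>2 = p\<^sup>2 * (norm u)\<^sup>2 + q\<^sup>2 * (norm U)\<^sup>2 - 2 * p * q * (u \<bullet> U)"
  using norm_sq_combination[of p u "- q" U] by simp

subsection \<open>Parallel pursuit\<close>

text \<open>The relative velocity \<open>\<alpha> *\<^sub>R U - v\<close> is a negative multiple of
  the line of sight \<open>sgn (a - b)\<close>, so the line of sight keeps its direction while the
  players approach. The square root is the choice that makes the reply a unit vector when v is
  one.\<close>

definition parallel_dir :: "real \<Rightarrow> plane \<Rightarrow> plane \<Rightarrow> plane \<Rightarrow> plane" where
  "parallel_dir \<alpha> a b v = (1 / \<alpha>) *\<^sub>R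
     (v - (v \<bullet> sgn (a - b) + sqrt ((v \<bullet> sgn (a - b))\<^sup>2 + (\<alpha>\<^sup>2 - 1))) *\<^sub>R sgn (a - b))"

lemma parallel_dir_inner:
  assumes "1 < \<alpha>" "a \<noteq> b"
  defines "h \<equiv> sgn (a - b)"
  shows "parallel_dir \<alpha> a b v \<bullet> parallel_dir \<alpha> a b v' = (v \<bullet> v' - (v \<bullet> h) * (v' \<bullet> h)
    + sqrt ((v \<bullet> h)\<^sup>2 + (\<alpha>\<^sup>2 - 1)) * sqrt ((v' \<bullet> h)\<^sup>2 + (\<alpha>\<^sup>2 - 1))) / \<alpha>\<^sup>2"
proof -
  have hh: "h \<bullet> h = 1" using assms by (simp add: h_def dot_square_norm norm_sgn)
  have gen: "(v - (k + R) *\<^sub>R h) \<bullet> (v' - (k' + R') *\<^sub>R h) = v \<bullet> v' - k * k' + R * R'"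
    if "k = v \<bullet> h" "k' = v' \<bullet> h" for k k' R R'
  proof -
    have "(v - (k + R) *\<^sub>R h) \<bullet> (v' - (k' + R') *\<^sub>R h)
      = v \<bullet> v' - (k' + R') * (v \<bullet> h) - (k + R) * (v' \<bullet> h) + (k + R) * (k' + R') * (h \<bullet> h)"
      by (simp only: inner_diff_left inner_diff_right inner_scaleR_left inner_scaleR_right inner_commute[of h v'])
        (simp add: algebra_simps)
    then show ?thesis unfolding hh that by (simp add: algebra_simps)
  qed
  show ?thesis unfolding parallel_dir_def h_def[symmetric] inner_scaleR_left inner_scaleR_right gen[OF refl refl]
    by (simp add: power2_eq_square)
qed

lemma parallel_dir_norm: assumes "1 < \<alpha>" "a \<noteq> b" "norm v = 1" shows "norm (parallel_dir \<alpha> a b v) = 1"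
proof -
  have "1 \<le> \<alpha>\<^sup>2" using assms by simp
  then have "(v \<bullet> sgn (a - b))\<^sup>2 + (\<alpha>\<^sup>2 - 1) \<ge> 0" by (smt (verit) zero_le_power2)
  then have "parallel_dir \<alpha> a b v \<bullet> parallel_dir \<alpha> a b v = 1"
    unfolding parallel_dir_inner[OF assms(1,2)] using assms
    by (simp add: dot_square_norm power2_eq_square field_simps)
  then show ?thesis by (simp add: norm_eq_sqrt_inner)
qed

text \<open>For unit vectors \<open>1 - u \<bullet> w\<close> is half the squared distance, so this
  is the Lipschitz constant \<open>1/\<alpha>\<close>. It reduces to Cauchy-Schwarz for the vectors
  (k, sqrt e) and (k', sqrt e) with e = \<open>\<alpha>\<^sup>2 - 1\<close>, where k and k' are the
  components along the line of sight.\<close>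

lemma parallel_dir_contraction:
  assumes "1 < \<alpha>" "a \<noteq> b"
  shows "1 - parallel_dir \<alpha> a b v \<bullet> parallel_dir \<alpha> a b v' \<le> (1 - v \<bullet> v') / \<alpha>\<^sup>2"
proof -
  have 1: "1 \<le> \<alpha>\<^sup>2" using assms by simp
  have key: "k * k' + e \<le> sqrt (k\<^sup>2 + e) * sqrt (k'\<^sup>2 + e)" if "0 \<le> e" for k k' e :: real
  proof -
    have "0 \<le> e * (k - k')\<^sup>2" using that by simp
    then have "(k * k' + e)\<^sup>2 \<le> (k\<^sup>2 + e) * (k'\<^sup>2 + e)"
      by (simp add: power2_eq_square algebra_simps)
    then have "k * k' + e \<le> sqrt ((k\<^sup>2 + e) * (k'\<^sup>2 + e))" by (rule real_le_rsqrt)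
    then show ?thesis by (simp add: real_sqrt_mult)
  qed
  have "\<alpha>\<^sup>2 * (parallel_dir \<alpha> a b v \<bullet> parallel_dir \<alpha> a b v') = v \<bullet> v' - (v \<bullet> sgn (a - b)) * (v' \<bullet> sgn (a - b))
    + sqrt ((v \<bullet> sgn (a - b))\<^sup>2 + (\<alpha>\<^sup>2 - 1)) * sqrt ((v' \<bullet> sgn (a - b))\<^sup>2 + (\<alpha>\<^sup>2 - 1))"
    unfolding parallel_dir_inner[OF assms] using assms(1) by simp
  then have "\<alpha>\<^sup>2 * (1 - parallel_dir \<alpha> a b v \<bullet> parallel_dir \<alpha> a b v') \<le> 1 - v \<bullet> v'"
    using key[of "\<alpha>\<^sup>2 - 1" "v \<bullet> sgn (a - b)" "v' \<bullet> sgn (a - b)"] 1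
    unfolding right_diff_distrib by linarith
  moreover have "0 < \<alpha>\<^sup>2" using assms(1) by simp
  ultimately show ?thesis by (simp only: pos_le_divide_eq mult.commute)
qed

text \<open>A fixed part of the pursuer's speed is directed at the evader, whatever v is. In
  \<open>local_law_vertex\<close> this confines all replies to a convex cone; the qualitative form
  below orders directions in \<open>local_law_clamp\<close>.\<close>

lemma parallel_dir_forward:
  assumes "1 < \<alpha>" "a \<noteq> b"
  shows "(b - a) \<bullet> parallel_dir \<alpha> a b v \<ge> norm (a - b) * (sqrt (\<alpha>\<^sup>2 - 1) / \<alpha>)"
proof -
  let ?h = "sgn (a - b)"
  have hh: "?h \<bullet> ?h = 1" using assms by (simp add: dot_square_norm norm_sgn)
  have e: "- ?h \<bullet> parallel_dir \<alpha> a b v = sqrt ((v \<bullet> ?h)\<^sup>2 + (\<alpha>\<^sup>2 - 1)) / \<alpha>"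
  proof -
    have "?h \<bullet> (v - (v \<bullet> ?h + R) *\<^sub>R ?h) = - R" for R
      unfolding inner_diff_right inner_scaleR_right hh inner_commute[of ?h v] by simp
    then show ?thesis unfolding parallel_dir_def inner_minus_left inner_scaleR_right by simp
  qed
  have "b - a = norm (a - b) *\<^sub>R (- ?h)" using assms by (simp add: sgn_div_norm)
  then have "(b - a) \<bullet> parallel_dir \<alpha> a b v = norm (a - b) * (- ?h \<bullet> parallel_dir \<alpha> a b v)"
    by (metis inner_scaleR_left)
  moreover have "sqrt (\<alpha>\<^sup>2 - 1) / \<alpha> \<le> sqrt ((v \<bullet> ?h)\<^sup>2 + (\<alpha>\<^sup>2 - 1)) / \<alpha>"
    using assms by (intro divide_right_mono) auto
  ultimately show ?thesis unfolding e by (metis mult_left_mono norm_ge_zero)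
qed

lemma parallel_dir_forward_pos:
  assumes "1 < \<alpha>" "a \<noteq> b" shows "0 < (b - a) \<bullet> parallel_dir \<alpha> a b v"
proof -
  have "0 < norm (a - b) * (sqrt (\<alpha>\<^sup>2 - 1) / \<alpha>)"
    using assms by (intro mult_pos_pos divide_pos_pos) (auto simp: one_less_power)
  then show ?thesis using parallel_dir_forward[OF assms, of v] by linarith
qed

text \<open>The point of the Apollonius circle in direction v, and the fact that the ray leaves the disc there.\<close>
lemma parallel_dir_ray:
  assumes "1 < \<alpha>" "a \<noteq> b" "norm v = 1"
  obtains r where "0 < r" "b + r *\<^sub>R v = a + (\<alpha> * r) *\<^sub>R parallel_dir \<alpha> a b v" "norm (b + r *\<^sub>R v - a) = \<alpha> * r"
    "\<And>t. 0 < t \<Longrightarrow> norm (b + t *\<^sub>R v - a) \<le> \<alpha> * t \<Longrightarrow> r \<le> t"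
proof -
  define h where "h = sgn (a - b)"
  define k where "k = v \<bullet> h"
  define R where "R = sqrt (k\<^sup>2 + (\<alpha>\<^sup>2 - 1))"
  have a1: "1 < \<alpha>\<^sup>2" using assms by simp
  have R: "\<bar>k\<bar> < R" unfolding R_def using a1 by (intro real_less_rsqrt) auto
  then have kR: "0 < k + R" by linarith
  define l where "l = norm (a - b)"
  have l: "0 < l" "a - b = l *\<^sub>R h" using assms by (auto simp: l_def h_def sgn_div_norm)
  define r where "r = l / (k + R)"
  have r: "0 < r" "r * (k + R) = l" using l kR by (auto simp: r_def)
  have eq: "b + r *\<^sub>R v = a + (\<alpha> * r) *\<^sub>R parallel_dir \<alpha> a b v"
  proof -
    have "(\<alpha> * r) *\<^sub>R parallel_dir \<alpha> a b v = r *\<^sub>R v - (r * (k + R)) *\<^sub>R h"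
      unfolding parallel_dir_def h_def[symmetric] k_def[symmetric] R_def[symmetric] using assms
      by (simp add: scaleR_diff_right)
    then show ?thesis unfolding r(2) l(2)[symmetric] by simp
  qed
  show thesis
  proof (rule that[OF r(1) eq])
    have "b + r *\<^sub>R v - a = (\<alpha> * r) *\<^sub>R parallel_dir \<alpha> a b v" using eq by simp
    then show "norm (b + r *\<^sub>R v - a) = \<alpha> * r" using parallel_dir_norm[OF assms] r assms by simp
  next
    fix t :: real assume t: "0 < t" "norm (b + t *\<^sub>R v - a) \<le> \<alpha> * t"
    have hh: "h \<bullet> h = 1" using assms by (simp add: h_def dot_square_norm norm_sgn)
    have vv: "v \<bullet> v = 1" using assms by (simp add: dot_square_norm)
    have "b + t *\<^sub>R v - a = t *\<^sub>R v - l *\<^sub>R h" using l(2) by (simp add: algebra_simps)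
    then have "(norm (b + t *\<^sub>R v - a))\<^sup>2 = t\<^sup>2 * (norm v)\<^sup>2 + l\<^sup>2 * (norm h)\<^sup>2 - 2 * t * l * (v \<bullet> h)"
      by (simp only: norm_sq_difference)
    then have "(norm (b + t *\<^sub>R v - a))\<^sup>2 = t\<^sup>2 - 2 * t * l * k + l\<^sup>2"
      using assms by (simp add: k_def h_def norm_sgn)
    moreover have "(norm (b + t *\<^sub>R v - a))\<^sup>2 \<le> (\<alpha> * t)\<^sup>2" using t by (intro power_mono) auto
    ultimately have "(l - t * k)\<^sup>2 \<le> t\<^sup>2 * (k\<^sup>2 + (\<alpha>\<^sup>2 - 1))"
      by (simp add: power2_eq_square algebra_simps)
    then have "l - t * k \<le> sqrt (t\<^sup>2 * (k\<^sup>2 + (\<alpha>\<^sup>2 - 1)))" by (rule real_le_rsqrt)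
    then have "l - t * k \<le> t * R" using t by (simp add: real_sqrt_mult R_def)
    then have "l \<le> t * (k + R)" by (simp add: algebra_simps)
    then have "r * (k + R) \<le> t * (k + R)" using r by simp
    then show "r \<le> t" using kR by simp
  qed
qed

text \<open>The ray from b through x meets the Apollonius circle only once. After the first meeting
  at parameter r, going on by t - r raises the distance from a by at most t - r, whereas a second
  meeting would require \<open>\<alpha> * (t - r)\<close>.\<close>

lemma parallel_dir_aim:
  assumes "1 < \<alpha>" "a \<noteq> b" "x \<noteq> b" "norm (x - a) = \<alpha> * norm (x - b)"
  shows "x - a = (\<alpha> * norm (x - b)) *\<^sub>R parallel_dir \<alpha> a b (sgn (x - b))"
proof -
  have n: "norm (sgn (x - b)) = 1" using assms by (simp add: norm_sgn)
  obtain r where r: "0 < r" "b + r *\<^sub>R sgn (x - b) = a + (\<alpha> * r) *\<^sub>R parallel_dir \<alpha> a b (sgn (x - b))"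
    "norm (b + r *\<^sub>R sgn (x - b) - a) = \<alpha> * r"
    "\<And>t. 0 < t \<Longrightarrow> norm (b + t *\<^sub>R sgn (x - b) - a) \<le> \<alpha> * t \<Longrightarrow> r \<le> t"
    using parallel_dir_ray[OF assms(1,2) n] by metis
  define t where "t = norm (x - b)"
  have x: "x = b + t *\<^sub>R sgn (x - b)" and t: "0 < t" using assms by (auto simp: t_def sgn_div_norm)
  have "r \<le> t" using r(4)[of t] assms x t by (simp add: t_def)
  moreover have "t \<le> r"
  proof -
    have "\<alpha> * t \<le> \<alpha> * r + (t - r)"
    proof -
      have "x - a = (b + r *\<^sub>R sgn (x - b) - a) + (t - r) *\<^sub>R sgn (x - b)"
        by (subst (1) x) (simp add: algebra_simps)
      then have "norm (x - a) \<le> norm (b + r *\<^sub>R sgn (x - b) - a) + norm ((t - r) *\<^sub>R sgn (x - b))"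
        by (metis norm_triangle_ineq)
      then show ?thesis using assms(4) r(3) n \<open>r \<le> t\<close> by (simp add: t_def)
    qed
    then have "(\<alpha> - 1) * (t - r) \<le> 0" by (simp add: algebra_simps)
    then show ?thesis using assms by (simp add: mult_le_0_iff)
  qed
  ultimately have "t = r" by simp
  then show ?thesis using x r(2) unfolding t_def by (metis add_diff_cancel_left')
qed

lemma continuous_on_UA: "continuous_on S (parallel_dir \<alpha> a b)"
  unfolding parallel_dir_def by (intro continuous_intros)

subsection \<open>Averages of a direction law\<close>

text \<open>(I, K) is the displacement pair produced by a direction law U in time s; only the linear
  inequalities inherited from the graph of U matter.\<close>
definition avg :: "(plane \<Rightarrow> plane) \<Rightarrow> real \<Rightarrow> plane \<Rightarrow> plane \<Rightarrow> bool" where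
  "avg U s I K \<longleftrightarrow> (\<forall>w p k. (\<forall>v. norm v = 1 \<longrightarrow> p \<bullet> v + k \<le> w \<bullet> U v) \<longrightarrow> p \<bullet> I + k * s \<le> w \<bullet> K)"

lemma avgD: "avg U s I K \<Longrightarrow> (\<And>v. norm v = 1 \<Longrightarrow> p \<bullet> v + k \<le> w \<bullet> U v) \<Longrightarrow> p \<bullet> I + k * s \<le> w \<bullet> K"
  unfolding avg_def by blast

lemma avg_const: "norm v = 1 \<Longrightarrow> 0 \<le> s \<Longrightarrow> avg U s (s *\<^sub>R v) (s *\<^sub>R U v)"
  unfolding avg_def
proof (intro allI impI)
  fix w p k assume h: "norm v = 1" "0 \<le> s" "\<forall>v. norm v = 1 \<longrightarrow> p \<bullet> v + k \<le> w \<bullet> U v"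
  then have "s * (p \<bullet> v + k) \<le> s * (w \<bullet> U v)" by (intro mult_left_mono) blast+
  then show "p \<bullet> (s *\<^sub>R v) + k * s \<le> w \<bullet> (s *\<^sub>R U v)" by (simp add: algebra_simps)
qed

lemma avg_norm:
  assumes "avg U s I K" "\<And>v. norm v = 1 \<Longrightarrow> norm (U v) = 1"
  shows "norm K \<le> s" "norm I \<le> s"
proof -
  have sg: "\<bar>sgn z \<bullet> y\<bar> \<le> norm y" for z y :: plane
    using Cauchy_Schwarz_ineq2[of "sgn z" y] norm_sgn[of z] by (auto split: if_splits)
  have sn: "sgn z \<bullet> z = norm z" for z :: plane
    by (cases "z = 0") (simp_all add: sgn_div_norm dot_square_norm power2_eq_square)
  have "0 \<bullet> I + (- 1) * s \<le> (- sgn K) \<bullet> K"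
  proof (rule avgD[OF assms(1)])
    fix v :: plane assume "norm v = 1"
    then show "0 \<bullet> v + (- 1) \<le> (- sgn K) \<bullet> U v" using sg[of K "U v"] assms(2)[of v] by (simp add: abs_le_iff)
  qed
  then show "norm K \<le> s" using sn[of K] by simp
  have "sgn I \<bullet> I + (- 1) * s \<le> 0 \<bullet> K"
  proof (rule avgD[OF assms(1)])
    fix v :: plane assume "norm v = 1"
    then show "sgn I \<bullet> v + (- 1) \<le> 0 \<bullet> U v" using sg[of I v] by (simp add: abs_le_iff)
  qed
  then show "norm I \<le> s" using sn[of I] by simp
qed

text \<open>The contraction inequality is affine in the pair of directions, hence survives
  averaging.\<close>

lemma avg_contract:
  assumes "avg U s I K" "\<And>v. norm v = 1 \<Longrightarrow> 1 - u \<bullet> U v \<le> (1 - w \<bullet> v) / \<alpha>\<^sup>2"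
  shows "s - (s - w \<bullet> I) / \<alpha>\<^sup>2 \<le> u \<bullet> K"
proof -
  have "((1 / \<alpha>\<^sup>2) *\<^sub>R w) \<bullet> I + (1 - 1 / \<alpha>\<^sup>2) * s \<le> u \<bullet> K"
  proof (rule avgD[OF assms(1)])
    fix v :: plane assume "norm v = 1"
    from assms(2)[OF this] show "((1 / \<alpha>\<^sup>2) *\<^sub>R w) \<bullet> v + (1 - 1 / \<alpha>\<^sup>2) \<le> u \<bullet> U v"
      by (simp add: diff_divide_distrib)
  qed
  then show ?thesis by (simp add: diff_divide_distrib left_diff_distrib)
qed

lemma inner_le_norm_sq: "norm w = 1 \<Longrightarrow> (w \<bullet> I)\<^sup>2 \<le> (norm I)\<^sup>2" for w I :: "'a::real_inner"
  using Cauchy_Schwarz_ineq2[of w I] by (metis mult_1 abs_le_square_iff abs_norm_cancel)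

text \<open>J measures how far the evader fails to run straight at x. In the comparison of squared
  distances the contraction yields a gain of order
  \<open>r * (1 - 1 / \<alpha>\<^sup>2) * J\<close>, while the quadratic terms cost at most
  \<open>t * J\<close> on the same scale. The bound on t lets the gain win, and equality forces J =
  0.\<close>

lemma visible_gain:
  fixes x a b I K u w :: "'a::real_inner"
  assumes "1 < \<alpha>" "x - a = (\<alpha> * r) *\<^sub>R u" "x - b = r *\<^sub>R w" "norm u = 1" "norm w = 1" "0 < r"
    "norm I \<le> t" "norm K \<le> t" "t - (t - w \<bullet> I) / \<alpha>\<^sup>2 \<le> u \<bullet> K" "t < r * (1 - 1 / \<alpha>\<^sup>2)"
  shows "norm (x - (a + \<alpha> *\<^sub>R K)) \<le> \<alpha> * norm (x - (b + I))"
    "norm (x - (a + \<alpha> *\<^sub>R K)) = \<alpha> * norm (x - (b + I)) \<Longrightarrow> w \<bullet> I = t"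
proof -
  define J where "J = t - w \<bullet> I"
  have t0: "0 \<le> t" using assms(7) norm_ge_zero order_trans by blast
  have J: "0 \<le> J" using Cauchy_Schwarz_ineq2[of w I] assms by (simp add: J_def)
  have N1: "(norm (x - (a + \<alpha> *\<^sub>R K)))\<^sup>2 = \<alpha>\<^sup>2 * (r\<^sup>2 - 2 * r * (u \<bullet> K) + (norm K)\<^sup>2)"
  proof -
    have "x - (a + \<alpha> *\<^sub>R K) = (\<alpha> * r) *\<^sub>R u - \<alpha> *\<^sub>R K" using assms(2) by (simp add: algebra_simps)
    then have "(norm (x - (a + \<alpha> *\<^sub>R K)))\<^sup>2 = (\<alpha> * r)\<^sup>2 * (norm u)\<^sup>2 + \<alpha>\<^sup>2 * (norm K)\<^sup>2 - 2 * (\<alpha> * r) * \<alpha> * (u \<bullet> K)"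
      by (simp only: norm_sq_difference)
    then show ?thesis using assms(4) by (simp add: power2_eq_square algebra_simps)
  qed
  have N2: "(\<alpha> * norm (x - (b + I)))\<^sup>2 = \<alpha>\<^sup>2 * (r\<^sup>2 - 2 * r * (w \<bullet> I) + (norm I)\<^sup>2)"
  proof -
    have "x - (b + I) = r *\<^sub>R w - I" using assms(3) by (simp add: algebra_simps)
    then have "x - (b + I) = r *\<^sub>R w - 1 *\<^sub>R I" by simp
    then have "(norm (x - (b + I)))\<^sup>2 = r\<^sup>2 * (norm w)\<^sup>2 + 1\<^sup>2 * (norm I)\<^sup>2 - 2 * r * 1 * (w \<bullet> I)"
      by (simp only: norm_sq_difference)
    then have "(norm (x - (b + I)))\<^sup>2 = r\<^sup>2 - 2 * r * (w \<bullet> I) + (norm I)\<^sup>2" using assms(5) by simp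
    then show ?thesis by (simp only: power_mult_distrib)
  qed
  have k1: "(norm K)\<^sup>2 \<le> t\<^sup>2" using assms(8) by (intro power_mono) auto
  have k2: "t\<^sup>2 - 2 * (t * J) + J\<^sup>2 \<le> (norm I)\<^sup>2"
    using inner_le_norm_sq[OF assms(5), of I] by (simp add: J_def power2_eq_square algebra_simps)
  have "J - J / \<alpha>\<^sup>2 \<le> u \<bullet> K - w \<bullet> I" using assms(9) by (simp add: J_def)
  then have "r * (J - J / \<alpha>\<^sup>2) \<le> r * (u \<bullet> K - w \<bullet> I)" using assms(6) by simp
  then have k3: "r * (J - J / \<alpha>\<^sup>2) \<le> r * (u \<bullet> K) - r * (w \<bullet> I)" by (simp only: right_diff_distrib)
  have k4: "J * (r * (1 - 1 / \<alpha>\<^sup>2)) = r * (J - J / \<alpha>\<^sup>2)" "0 \<le> J\<^sup>2"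
    by (simp_all add: algebra_simps)
  have "(r\<^sup>2 - 2 * r * (u \<bullet> K) + (norm K)\<^sup>2) - (r\<^sup>2 - 2 * r * (w \<bullet> I) + (norm I)\<^sup>2)
      \<le> - 2 * (J * (r * (1 - 1 / \<alpha>\<^sup>2))) + 2 * (t * J)"
  proof -
    have "(rr - 2 * A + k) - (rr - 2 * B + i) \<le> - 2 * P + 2 * Q"
      if "k \<le> tt" "tt - 2 * Q + j \<le> i" "P \<le> A - B" "0 \<le> j" for A B P Q k i j tt rr :: real
      using that by linarith
    from this[OF k1 k2 k3 k4(2)] show ?thesis unfolding k4(1) by (simp only: mult.assoc)
  qed
  also have "\<dots> = - 2 * J * (r * (1 - 1 / \<alpha>\<^sup>2) - t)"
    by (simp only: right_diff_distrib mult.assoc mult.commute[of t J])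
  finally have D: "(r\<^sup>2 - 2 * r * (u \<bullet> K) + (norm K)\<^sup>2) - (r\<^sup>2 - 2 * r * (w \<bullet> I) + (norm I)\<^sup>2) \<le> - 2 * J * (r * (1 - 1 / \<alpha>\<^sup>2) - t)" .
  have p: "0 < r * (1 - 1 / \<alpha>\<^sup>2) - t" using assms by simp
  define Q where "Q = J * (r * (1 - 1 / \<alpha>\<^sup>2) - t)"
  define kk where "kk = r\<^sup>2 - 2 * r * (u \<bullet> K) + (norm K)\<^sup>2"
  define ii where "ii = r\<^sup>2 - 2 * r * (w \<bullet> I) + (norm I)\<^sup>2"
  have Q: "0 \<le> Q" unfolding Q_def using J p by (intro mult_nonneg_nonneg) auto
  have D': "kk - ii \<le> - 2 * Q" using D unfolding Q_def kk_def ii_def by (simp only: mult.assoc)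
  then have "kk \<le> ii" using Q by linarith
  then have "(norm (x - (a + \<alpha> *\<^sub>R K)))\<^sup>2 \<le> (\<alpha> * norm (x - (b + I)))\<^sup>2"
    unfolding N1 N2 kk_def[symmetric] ii_def[symmetric] by (rule mult_left_mono) (rule zero_le_power2)
  moreover have "0 \<le> \<alpha> * norm (x - (b + I))" using assms(1) by simp
  ultimately show "norm (x - (a + \<alpha> *\<^sub>R K)) \<le> \<alpha> * norm (x - (b + I))"
    by (rule power2_le_imp_le)
  assume eq: "norm (x - (a + \<alpha> *\<^sub>R K)) = \<alpha> * norm (x - (b + I))"
  have "\<alpha>\<^sup>2 * kk = \<alpha>\<^sup>2 * ii"
    unfolding kk_def ii_def N1[symmetric] N2[symmetric] eq by (rule refl)
  then have "kk = ii" using assms(1) by simp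
  then have "Q \<le> 0" using D' by linarith
  then have "J * (r * (1 - 1 / \<alpha>\<^sup>2) - t) \<le> 0" unfolding Q_def .
  then have "J = 0" using J p by (simp add: mult_le_0_iff)
  then show "w \<bullet> I = t" by (simp add: J_def)
qed

text \<open>For a point hidden behind the vertex only the pursuer's distance from the vertex
  changes, so \<open>- sgn a\<close> takes the role of the aiming direction. Both sides are compared
  with \<open>norm x + norm a - \<alpha> * (t - J)\<close>; the bound on t again makes the gain,
  which is linear in J, prevail.\<close>

lemma shadow_gain:
  fixes x a b I K w :: "'a::real_inner"
  assumes "1 < \<alpha>" "norm x + norm a = \<alpha> * r" "x - b = r *\<^sub>R w" "norm w = 1" "a \<noteq> 0"
    "norm I \<le> t" "norm K \<le> t" "t - (t - w \<bullet> I) / \<alpha>\<^sup>2 \<le> (- sgn a) \<bullet> K" "t < norm a * (1 - 1 / \<alpha>\<^sup>2) / \<alpha>"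
  shows "norm x + norm (a + \<alpha> *\<^sub>R K) \<le> \<alpha> * norm (x - (b + I))"
    "norm x + norm (a + \<alpha> *\<^sub>R K) = \<alpha> * norm (x - (b + I)) \<Longrightarrow> w \<bullet> I = t"
proof -
  define J where "J = t - w \<bullet> I"
  have t0: "0 \<le> t" using assms(6) norm_ge_zero order_trans by blast
  have J: "0 \<le> J" using Cauchy_Schwarz_ineq2[of w I] assms by (simp add: J_def)
  have a2: "1 < \<alpha>\<^sup>2" using assms(1) by simp
  have "\<alpha> * t < norm a * (1 - 1 / \<alpha>\<^sup>2)" using assms(1,9) by (simp add: pos_less_divide_eq mult.commute)
  define d where "d = norm a * (1 - 1 / \<alpha>\<^sup>2) - \<alpha> * t"
  have d: "0 < d" using \<open>\<alpha> * t < _\<close> by (simp add: d_def)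
  have at: "\<alpha> * t \<le> norm a"
  proof -
    have "norm a * (1 - 1 / \<alpha>\<^sup>2) \<le> norm a * 1" using a2 by (intro mult_left_mono) auto
    then show ?thesis using \<open>\<alpha> * t < _\<close> by linarith
  qed
  have low: "norm x + norm a - \<alpha> * (t - J) \<le> \<alpha> * norm (x - (b + I))"
  proof -
    have "r - w \<bullet> I = w \<bullet> (x - (b + I))"
    proof -
      have "x - (b + I) = r *\<^sub>R w - I" using assms(3) by (simp add: algebra_simps)
      then have "w \<bullet> (x - (b + I)) = r * (w \<bullet> w) - w \<bullet> I" by (simp only: inner_diff_right inner_scaleR_right)
      then show ?thesis using assms(4) by (simp add: dot_square_norm)
    qed
    also have "\<dots> \<le> norm (x - (b + I))" using Cauchy_Schwarz_ineq2[of w "x - (b + I)"] assms(4) by simp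
    finally have "\<alpha> * (r - w \<bullet> I) \<le> \<alpha> * norm (x - (b + I))" using assms(1) by simp
    then show ?thesis using assms(2) by (simp add: J_def algebra_simps)
  qed
  have "(norm (a + \<alpha> *\<^sub>R K))\<^sup>2 = (norm a)\<^sup>2 - 2 * \<alpha> * norm a * ((- sgn a) \<bullet> K) + \<alpha>\<^sup>2 * (norm K)\<^sup>2"
  proof -
    have "a \<bullet> K = norm a * (sgn a \<bullet> K)" using assms(5) by (simp add: sgn_div_norm)
    moreover have "(norm (1 *\<^sub>R a + \<alpha> *\<^sub>R K))\<^sup>2 = 1\<^sup>2 * (norm a)\<^sup>2 + \<alpha>\<^sup>2 * (norm K)\<^sup>2 + 2 * 1 * \<alpha> * (a \<bullet> K)"
      by (rule norm_sq_combination)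
    ultimately show ?thesis by (simp add: algebra_simps)
  qed
  also have "\<dots> \<le> (norm a)\<^sup>2 - 2 * \<alpha> * norm a * (t - J / \<alpha>\<^sup>2) + \<alpha>\<^sup>2 * t\<^sup>2"
  proof -
    have "norm a * (t - J / \<alpha>\<^sup>2) \<le> norm a * ((- sgn a) \<bullet> K)" using assms(8) by (intro mult_left_mono) (auto simp: J_def)
    then have "2 * \<alpha> * (norm a * (t - J / \<alpha>\<^sup>2)) \<le> 2 * \<alpha> * (norm a * ((- sgn a) \<bullet> K))"
      by (rule mult_left_mono) (use assms(1) in simp)
    moreover have "(norm K)\<^sup>2 \<le> t\<^sup>2" using assms(7) by (intro power_mono) auto
    then have "\<alpha>\<^sup>2 * (norm K)\<^sup>2 \<le> \<alpha>\<^sup>2 * t\<^sup>2" by (intro mult_left_mono) auto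
    ultimately show ?thesis by (simp add: algebra_simps)
  qed
  also have "\<dots> = (norm a - \<alpha> * (t - J))\<^sup>2 - 2 * \<alpha> * J * d - \<alpha>\<^sup>2 * J\<^sup>2"
    by (simp add: d_def power2_eq_square algebra_simps)
  finally have M: "(norm (a + \<alpha> *\<^sub>R K))\<^sup>2 \<le> (norm a - \<alpha> * (t - J))\<^sup>2 - 2 * \<alpha> * J * d - \<alpha>\<^sup>2 * J\<^sup>2" .
  have nn: "0 \<le> 2 * \<alpha> * J * d" "0 \<le> \<alpha>\<^sup>2 * J\<^sup>2" using assms(1) J d by auto
  have pos: "0 \<le> norm a - \<alpha> * (t - J)" using at J assms(1) by (simp add: algebra_simps add_increasing2)
  have le: "norm (a + \<alpha> *\<^sub>R K) \<le> norm a - \<alpha> * (t - J)"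
    using M nn by (intro power2_le_imp_le[OF _ pos]) linarith
  then show "norm x + norm (a + \<alpha> *\<^sub>R K) \<le> \<alpha> * norm (x - (b + I))" using low by linarith
  assume "norm x + norm (a + \<alpha> *\<^sub>R K) = \<alpha> * norm (x - (b + I))"
  then have "norm (a + \<alpha> *\<^sub>R K) = norm a - \<alpha> * (t - J)" using le low by linarith
  then have "(norm (a + \<alpha> *\<^sub>R K))\<^sup>2 = (norm a - \<alpha> * (t - J))\<^sup>2" by (simp only:)
  then have "2 * \<alpha> * J * d \<le> 0" using M nn by linarith
  then have "J = 0" using J d assms(1) by (simp add: mult_le_0_iff)
  then show "w \<bullet> I = t" by (simp add: J_def)
qed

text \<open>The unit vector m lies in the angle spanned by u and U, so its angle with u is at most
  that of U. The sign of the cosine g decides which bound on the length l is the useful one.\<close>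

lemma between_inner:
  fixes u U m d :: "'a::real_inner"
  assumes "norm u = 1" "norm U = 1" "norm m = 1" "0 \<le> p" "0 \<le> q" "0 < l" "p *\<^sub>R u + q *\<^sub>R U = l *\<^sub>R m"
  shows "u \<bullet> U \<le> u \<bullet> m"
proof -
  define g where "g = u \<bullet> U"
  have g1: "\<bar>g\<bar> \<le> 1" using Cauchy_Schwarz_ineq2[of u U] assms by (simp add: g_def)
  have e: "l * (u \<bullet> m) = p + q * g"
  proof -
    have "u \<bullet> (p *\<^sub>R u + q *\<^sub>R U) = u \<bullet> (l *\<^sub>R m)" using assms(7) by simp
    then show ?thesis using assms(1) by (simp add: inner_add_right dot_square_norm g_def)
  qed
  have l2: "l\<^sup>2 = p\<^sup>2 + q\<^sup>2 + 2 * p * q * g"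
  proof -
    have "(norm (l *\<^sub>R m))\<^sup>2 = p\<^sup>2 * (norm u)\<^sup>2 + q\<^sup>2 * (norm U)\<^sup>2 + 2 * p * q * (u \<bullet> U)"
      unfolding assms(7)[symmetric] by (rule norm_sq_combination)
    then show ?thesis using assms(1-3) by (simp add: g_def power_mult_distrib)
  qed
  have "l * g \<le> p + q * g"
  proof (cases "0 \<le> g")
    case True
    have "p * q * g \<le> p * q * 1" using assms(4,5) g1 by (intro mult_left_mono) auto
    then have "l\<^sup>2 \<le> (p + q)\<^sup>2" unfolding l2 by (simp add: power2_eq_square algebra_simps)
    then have "l \<le> p + q" by (rule power2_le_imp_le) (use assms(4,5) in simp)
    then have "l * g \<le> (p + q) * g" using True by (intro mult_right_mono)
    moreover have "p * g \<le> p * 1" using g1 assms(4) by (intro mult_left_mono) auto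
    ultimately show ?thesis by (simp add: algebra_simps)
  next
    case False
    have "(q + p * g)\<^sup>2 \<le> l\<^sup>2"
    proof -
      have "p\<^sup>2 * g\<^sup>2 \<le> p\<^sup>2 * 1" using g1 by (intro mult_left_mono) (auto simp: abs_square_le_1)
      then show ?thesis unfolding l2 by (simp add: power2_eq_square algebra_simps)
    qed
    then have "q + p * g \<le> l" by (rule power2_le_imp_le) (use assms(6) in simp)
    then have "l * g \<le> (q + p * g) * g" using False by (intro mult_right_mono_neg) auto
    also have "\<dots> = q * g + p * (g * g)" by (simp add: algebra_simps)
    also have "\<dots> \<le> q * g + p * 1" using g1 assms(4) by (intro add_left_mono mult_left_mono) (auto simp: abs_square_le_1 power2_eq_square[symmetric])
    finally show ?thesis by simp
  qed
  then have "l * g \<le> l * (u \<bullet> m)" unfolding e .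
  then show ?thesis using assms(6) by (simp add: g_def)
qed

text \<open>A direction that leaves the half plane is reflected in its boundary line. Reflection
  instead of projection keeps the speed at one.\<close>

definition bounce :: "plane \<Rightarrow> plane \<Rightarrow> plane" where
  "bounce n U = U + (2 * max 0 (- (n \<bullet> U))) *\<^sub>R n"

lemma bounce_facts:
  assumes "norm n = 1" "norm U = 1"
  shows "norm (bounce n U) = 1" "0 \<le> n \<bullet> bounce n U" "0 \<le> n \<bullet> u \<Longrightarrow> u \<bullet> U \<le> u \<bullet> bounce n U"
proof -
  have nn: "n \<bullet> n = 1" using assms by (simp add: dot_square_norm)
  have "(norm (1 *\<^sub>R U + (2 * max 0 (- (n \<bullet> U))) *\<^sub>R n))\<^sup>2 = 1"
    unfolding norm_sq_combination using assms by (simp add: max_def inner_commute[of U n] power2_eq_square)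
  then have "(norm (bounce n U))\<^sup>2 = 1" by (simp add: bounce_def)
  then show "norm (bounce n U) = 1" using norm_ge_zero[of "bounce n U"] by (auto simp: power2_eq_1_iff simp del: norm_ge_zero)
  show "0 \<le> n \<bullet> bounce n U" by (simp add: bounce_def inner_add_right nn max_def)
  show "0 \<le> n \<bullet> u \<Longrightarrow> u \<bullet> U \<le> u \<bullet> bounce n U"
    by (simp add: bounce_def inner_add_right inner_commute[of u n])
qed

lemma continuous_on_bounce: "continuous_on S f \<Longrightarrow> continuous_on S (\<lambda>v. bounce n (f v))"
  unfolding bounce_def by (intro continuous_intros)

subsection \<open>Dominance regions\<close>

context corner begin

definition Dom :: "real \<Rightarrow> plane \<Rightarrow> plane \<Rightarrow> plane set" where
  "Dom \<alpha> a b = {z \<in> X. \<alpha> * dl z b < dl z a}"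
definition Cl :: "real \<Rightarrow> plane \<Rightarrow> plane \<Rightarrow> plane set" where
  "Cl \<alpha> a b = {z \<in> X. \<alpha> * dl z b \<le> dl z a}"
definition Bd :: "real \<Rightarrow> plane \<Rightarrow> plane \<Rightarrow> plane set" where
  "Bd \<alpha> a b = {z \<in> X. dl z a = \<alpha> * dl z b}"
text \<open>The last conjunct keeps the vertex outside the closed region \<open>Cl\<close>. By
  \<open>nested_good\<close> it is inherited when regions shrink and no capture has
  occurred.\<close>

definition good :: "real \<Rightarrow> plane \<Rightarrow> plane \<Rightarrow> bool" where
  "good \<alpha> a b \<longleftrightarrow> 1 < \<alpha> \<and> a \<in> X \<and> b \<in> X \<and> a \<noteq> b \<and> norm a < \<alpha> * norm b"

lemma goodD: "good \<alpha> a b \<Longrightarrow> 1 < \<alpha>" "good \<alpha> a b \<Longrightarrow> a \<in> X" "good \<alpha> a b \<Longrightarrow> b \<in> X"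
  "good \<alpha> a b \<Longrightarrow> a \<noteq> b" "good \<alpha> a b \<Longrightarrow> norm a < \<alpha> * norm b"
  by (simp_all add: good_def)

lemma Bd_Cl: "x \<in> Bd \<alpha> a b \<Longrightarrow> x \<in> Cl \<alpha> a b" by (simp add: Bd_def Cl_def)
lemma Dom_Cl: "x \<in> Dom \<alpha> a b \<Longrightarrow> x \<in> Cl \<alpha> a b" by (simp add: Dom_def Cl_def)
lemma Cl_X: "x \<in> Cl \<alpha> a b \<Longrightarrow> x \<in> X" by (simp add: Cl_def)

text \<open>A point of the closed region hidden from the evader would be reached by it through the
  vertex. Being no later than the pursuer at that point, the evader would be no later at the vertex,
  against \<open>good\<close>.\<close>

lemma Cl_unblocked:
  assumes "good \<alpha> a b" "x \<in> Cl \<alpha> a b" shows "\<not> blocked x b" "x \<noteq> 0"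
proof -
  note g = goodD[OF assms(1)]
  have x: "\<alpha> * dl x b \<le> dl x a" using assms(2) by (simp add: Cl_def)
  show "x \<noteq> 0" using x g(5) by auto
  show "\<not> blocked x b"
  proof
    assume "blocked x b"
    then have "\<alpha> * (norm x + norm b) \<le> norm x + norm a" using x dl_le_norms[of x a] by (simp add: dl_def)
    moreover have "norm x \<le> \<alpha> * norm x" using g(1) by (simp add: mult_le_cancel_right1)
    ultimately show False using g(5) by (simp add: distrib_left)
  qed
qed

lemma segment_between: "z \<in> closed_segment b x \<Longrightarrow> dist b x = dist b z + dist z x" for b :: plane
  by (metis between between_mem_segment)

text \<open>Going back from x towards b by a length h shortens the evader's way by h and the
  pursuer's by at most h, so the inequality gains \<open>(\<alpha> - 1) * h\<close>. The region is
  thus star-shaped about the evader, and everything before x is strictly inside.\<close>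

lemma Cl_segment:
  assumes "good \<alpha> a b" "x \<in> Cl \<alpha> a b" "z \<in> closed_segment b x"
  shows "z \<in> X" "\<not> blocked z b" "\<not> blocked x z" "\<alpha> * dl z b \<le> dl z a" "z \<in> Cl \<alpha> a b"
    "z \<noteq> x \<Longrightarrow> z \<in> Dom \<alpha> a b"
proof -
  note g = goodD[OF assms(1)]
  have xX: "x \<in> X" using assms(2) by (rule Cl_X)
  have nb: "\<not> blocked b x" using Cl_unblocked[OF assms(1,2)] blocked_sym by blast
  have sub: "closed_segment b x \<subseteq> X" by (rule not_blocked_segment[OF g(3) xX nb])
  show zX: "z \<in> X" using sub assms(3) by (rule subsetD)
  have "closed_segment b z \<subseteq> closed_segment b x" "closed_segment z x \<subseteq> closed_segment b x"
    using assms(3) by (simp_all add: subset_closed_segment)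
  then have s: "closed_segment b z \<subseteq> X" "closed_segment z x \<subseteq> X" using sub by (meson subset_trans)+
  then show nb1: "\<not> blocked z b" and nb2: "\<not> blocked x z"
    using segment_iff[OF g(3) zX] segment_iff[OF zX xX] blocked_sym by blast+
  have d: "dl z b = dist z b" "dl x z = dist x z" "dl x b = dist x b"
    using nb1 nb2 nb by (simp_all add: dl_unblocked blocked_sym[of x b])
  have e: "dist x b = dist z b + dist x z" using segment_between[OF assms(3)] by (simp add: dist_commute)
  have "dl x a \<le> dl x z + dl z a" by (rule dl_triangle[OF xX zX g(2)])
  moreover have "\<alpha> * dl x b \<le> dl x a" using assms(2) by (simp add: Cl_def)
  ultimately have m: "\<alpha> * dl z b + (\<alpha> - 1) * dist x z \<le> dl z a"
    unfolding d e by (simp add: algebra_simps)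
  have "0 \<le> (\<alpha> - 1) * dist x z" using g(1) by simp
  then show "\<alpha> * dl z b \<le> dl z a" using m by linarith
  then show "z \<in> Cl \<alpha> a b" using zX by (simp add: Cl_def)
  assume "z \<noteq> x"
  then have "0 < (\<alpha> - 1) * dist x z" using g(1) by simp
  then have "\<alpha> * dl z b < dl z a" using m by linarith
  then show "z \<in> Dom \<alpha> a b" using zX by (simp add: Dom_def)
qed

lemma Bd_facts:
  assumes "good \<alpha> a b" "x \<in> Bd \<alpha> a b"
  shows "x \<noteq> b" "dl x b = norm (x - b)" "dl a b / (\<alpha> + 1) \<le> norm (x - b)" "dl x a = \<alpha> * norm (x - b)"
    "norm (sgn (x - b)) = 1" "x - b = norm (x - b) *\<^sub>R sgn (x - b)"
proof -
  note g = goodD[OF assms(1)]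
  have x: "x \<in> X" "dl x a = \<alpha> * dl x b" using assms(2) by (simp_all add: Bd_def)
  show d: "dl x b = norm (x - b)"
    using dl_unblocked[OF Cl_unblocked(1)[OF assms(1) Bd_Cl[OF assms(2)]]] by (simp add: dist_norm)
  then show "dl x a = \<alpha> * norm (x - b)" using x by simp
  show xb: "x \<noteq> b"
  proof
    assume "x = b"
    then have "dl b a = 0" using x by simp
    then show False using g(4) by (metis dl_eq_0_iff)
  qed
  then show "norm (sgn (x - b)) = 1" "x - b = norm (x - b) *\<^sub>R sgn (x - b)"
    by (simp_all add: norm_sgn sgn_div_norm)
  have "dl a b \<le> dl a x + dl x b" by (rule dl_triangle[OF g(2) x(1) g(3)])
  also have "\<dots> = (\<alpha> + 1) * norm (x - b)" using x(2) d by (simp add: dl_sym[of a x] algebra_simps)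
  finally show "dl a b / (\<alpha> + 1) \<le> norm (x - b)" using g(1) by (simp add: pos_divide_le_eq mult.commute)
qed

lemma Cl_bound:
  assumes "1 < \<alpha>" "a \<in> X" "b \<in> X" "x \<in> Cl \<alpha> a b" shows "dl x b \<le> dl a b / (\<alpha> - 1)"
proof -
  have "\<alpha> * dl x b \<le> dl x a" "x \<in> X" using assms(4) by (simp_all add: Cl_def)
  moreover have "dl x a \<le> dl x b + dl b a" by (rule dl_triangle) (use assms calculation in simp_all)
  ultimately have "dl x b * (\<alpha> - 1) \<le> dl a b" by (simp add: algebra_simps dl_sym[of b a])
  then show ?thesis using assms(1) by (simp add: pos_le_divide_eq)
qed

lemma closed_Bd: "a \<in> X \<Longrightarrow> b \<in> X \<Longrightarrow> closed (Bd \<alpha> a b)"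
proof -
  assume ab: "a \<in> X" "b \<in> X"
  have "continuous_on X (\<lambda>z. dl z a - \<alpha> * dl z b)"
    by (intro continuous_intros continuous_on_dl ab order_refl)
  then have "closed (X \<inter> (\<lambda>z. dl z a - \<alpha> * dl z b) -` {0})"
    by (intro continuous_closed_preimage closed_X) simp_all
  moreover have "X \<inter> (\<lambda>z. dl z a - \<alpha> * dl z b) -` {0} = Bd \<alpha> a b" by (auto simp: Bd_def)
  ultimately show ?thesis by simp
qed

lemma compact_Bd:
  assumes "1 < \<alpha>" "a \<in> X" "b \<in> X" shows "compact (Bd \<alpha> a b)"
proof -
  have "Bd \<alpha> a b \<subseteq> cball b (dl a b / (\<alpha> - 1))"
  proof
    fix x assume "x \<in> Bd \<alpha> a b"
    then have "dl x b \<le> dl a b / (\<alpha> - 1)" by (intro Cl_bound assms Bd_Cl)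
    then show "x \<in> cball b (dl a b / (\<alpha> - 1))" using dl_ge_dist[of x b] by (simp add: dist_commute)
  qed
  then have "bounded (Bd \<alpha> a b)" by (rule bounded_subset[OF bounded_cball])
  then show ?thesis using closed_Bd[OF assms(2,3)] by (simp add: compact_eq_bounded_closed)
qed

text \<open>A law for the pursuer's direction as a function of the evader's, frozen at the state (a, b), that
  keeps the boundary of the dominance region guarded for a short time, with equality at a boundary point
  only if the evader heads straight for it.\<close>
definition local_law :: "real \<Rightarrow> plane \<Rightarrow> plane \<Rightarrow> (plane \<Rightarrow> plane) \<Rightarrow> real \<Rightarrow> bool" where
  "local_law \<alpha> a b U s0 \<longleftrightarrow> 0 < s0 \<and> continuous_on (sphere 0 1) U \<and> (\<forall>v. norm v = 1 \<longrightarrow> norm (U v) = 1) \<and>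
     (\<forall>t I K. 0 \<le> t \<longrightarrow> t \<le> s0 \<longrightarrow> avg U t I K \<longrightarrow> a + \<alpha> *\<^sub>R K \<in> X \<and>
        (\<forall>x\<in>Bd \<alpha> a b. dl x (a + \<alpha> *\<^sub>R K) \<le> \<alpha> * norm (x - (b + I)) \<and>
           (dl x (a + \<alpha> *\<^sub>R K) = \<alpha> * norm (x - (b + I)) \<longrightarrow> I = t *\<^sub>R sgn (x - b))))"

lemma full_speed_straight:
  fixes I w :: plane
  assumes "norm w = 1" "norm I \<le> t" "w \<bullet> I = t" shows "I = t *\<^sub>R w"
proof -
  have "(norm (1 *\<^sub>R I - t *\<^sub>R w))\<^sup>2 = (norm I)\<^sup>2 - t\<^sup>2"
    unfolding norm_sq_difference using assms by (simp add: inner_commute[of I w] power2_eq_square)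
  also have "\<dots> \<le> 0" using assms(2) power_mono[of "norm I" t 2] by simp
  finally show ?thesis by simp
qed

text \<open>A boundary point is guarded either along a direction u straight at it, provided that it
  stays visible, or through the vertex. In the second alternative \<open>norm x + norm a'\<close>
  bounds \<open>dl x a'\<close> for every position a', so visibility after the move need not be
  traced.\<close>

lemma local_law_criterion:
  assumes g: "good \<alpha> a b" and U: "continuous_on (sphere 0 1) U" "\<And>v. norm v = 1 \<Longrightarrow> norm (U v) = 1"
    and d: "0 < d"
    and H1: "\<And>t I K. 0 \<le> t \<Longrightarrow> t \<le> d \<Longrightarrow> avg U t I K \<Longrightarrow> a + \<alpha> *\<^sub>R K \<in> X"
    and H2: "\<And>x. x \<in> Bd \<alpha> a b \<Longrightarrow>
      (\<exists>u. norm u = 1 \<and> x - a = (\<alpha> * norm (x - b)) *\<^sub>R u \<and>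
          (\<forall>v. norm v = 1 \<longrightarrow> 1 - u \<bullet> U v \<le> (1 - sgn (x - b) \<bullet> v) / \<alpha>\<^sup>2) \<and>
          (\<forall>t I K. 0 \<le> t \<longrightarrow> t \<le> d \<longrightarrow> avg U t I K \<longrightarrow> \<not> blocked x (a + \<alpha> *\<^sub>R K)))
      \<or> (norm x + norm a = \<alpha> * norm (x - b) \<and> a \<noteq> 0 \<and>
          (\<forall>v. norm v = 1 \<longrightarrow> 1 - (- sgn a) \<bullet> U v \<le> (1 - sgn (x - b) \<bullet> v) / \<alpha>\<^sup>2))"
  shows "\<exists>s0. local_law \<alpha> a b U s0"
proof -
  note gd = goodD[OF g]
  define q where "q = 1 - 1 / \<alpha>\<^sup>2"
  \<comment> \<open>All boundary points are at least r away from b by \<open>Bd_facts\<close>, so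
    one time serves them all. The factors 1/2 make the thresholds of \<open>visible_gain\<close> and
    \<open>shadow_gain\<close> strict; the value 1 for a pursuer at the vertex is a mere default, as
    the shadow alternative includes \<open>a \<noteq> 0\<close>.\<close>
  define r where "r = dl a b / (\<alpha> + 1)"
  have "1 < \<alpha>\<^sup>2" using gd(1) by simp
  then have "1 / \<alpha>\<^sup>2 < 1" by (subst divide_less_eq_1_pos) linarith+
  then have q: "0 < q" by (simp add: q_def)
  have "0 < dl a b" using gd(4) dl_nonneg[of a b] by (metis dl_eq_0_iff order_le_less)
  then have r: "0 < r" using gd(1) by (simp add: r_def)
  define m where "m = (if a = 0 then 1 else norm a * q / (2 * \<alpha>))"
  have m: "0 < m" using q gd(1) by (simp add: m_def)
  define s0 where "s0 = min d (min (r * q / 2) m)"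
  have s0: "0 < s0" using d m r q by (simp add: s0_def)
  have "local_law \<alpha> a b U s0"
    unfolding local_law_def
  proof (intro conjI allI impI ballI s0 U(1) U(2))
    fix t I K assume t: "0 \<le> t" "t \<le> s0" and av: "avg U t I K"
    have td: "t \<le> d" using t by (simp add: s0_def)
    show "a + \<alpha> *\<^sub>R K \<in> X" by (rule H1[OF t(1) td av])
    have nm: "norm K \<le> t" "norm I \<le> t" using avg_norm[OF av U(2)] by simp_all
    fix x assume x: "x \<in> Bd \<alpha> a b"
    note bf = Bd_facts[OF g x]
    define w where "w = sgn (x - b)"
    have w: "norm w = 1" using bf(5) by (simp only: w_def)
    have xw: "x - b = norm (x - b) *\<^sub>R w" using bf(6) by (simp only: w_def)
    have rho: "0 < norm (x - b)" using bf(1) by simp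
    have tr: "t < norm (x - b) * (1 - 1 / \<alpha>\<^sup>2)"
    proof -
      have "t \<le> r * q / 2" using t by (simp add: s0_def)
      also have "\<dots> < r * q" using r q by simp
      also have "\<dots> \<le> norm (x - b) * q" using bf(3) q unfolding r_def by (intro mult_right_mono) simp_all
      finally show ?thesis by (simp only: q_def)
    qed
    have "dl x (a + \<alpha> *\<^sub>R K) \<le> \<alpha> * norm (x - (b + I)) \<and>
      (dl x (a + \<alpha> *\<^sub>R K) = \<alpha> * norm (x - (b + I)) \<longrightarrow> w \<bullet> I = t)"
      using H2[OF x]
    proof
      assume "\<exists>u. norm u = 1 \<and> x - a = (\<alpha> * norm (x - b)) *\<^sub>R u \<and>
          (\<forall>v. norm v = 1 \<longrightarrow> 1 - u \<bullet> U v \<le> (1 - sgn (x - b) \<bullet> v) / \<alpha>\<^sup>2) \<and>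
          (\<forall>t I K. 0 \<le> t \<longrightarrow> t \<le> d \<longrightarrow> avg U t I K \<longrightarrow> \<not> blocked x (a + \<alpha> *\<^sub>R K))"
      then obtain u where u: "norm u = 1" "x - a = (\<alpha> * norm (x - b)) *\<^sub>R u"
        "\<And>v. norm v = 1 \<Longrightarrow> 1 - u \<bullet> U v \<le> (1 - w \<bullet> v) / \<alpha>\<^sup>2" "\<not> blocked x (a + \<alpha> *\<^sub>R K)"
        unfolding w_def using t(1) td av by blast
      have c: "t - (t - w \<bullet> I) / \<alpha>\<^sup>2 \<le> u \<bullet> K" by (rule avg_contract[OF av u(3)])
      have e: "dl x (a + \<alpha> *\<^sub>R K) = norm (x - (a + \<alpha> *\<^sub>R K))" using dl_unblocked[OF u(4)] by (simp add: dist_norm)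
      show ?thesis unfolding e
        using visible_gain[OF gd(1) u(2) xw u(1) w rho nm(2) nm(1) c tr] by blast
    next
      assume "norm x + norm a = \<alpha> * norm (x - b) \<and> a \<noteq> 0 \<and>
          (\<forall>v. norm v = 1 \<longrightarrow> 1 - (- sgn a) \<bullet> U v \<le> (1 - sgn (x - b) \<bullet> v) / \<alpha>\<^sup>2)"
      then have h: "norm x + norm a = \<alpha> * norm (x - b)" "a \<noteq> 0"
        "\<And>v. norm v = 1 \<Longrightarrow> 1 - (- sgn a) \<bullet> U v \<le> (1 - w \<bullet> v) / \<alpha>\<^sup>2" unfolding w_def by blast+
      have c: "t - (t - w \<bullet> I) / \<alpha>\<^sup>2 \<le> (- sgn a) \<bullet> K" by (rule avg_contract[OF av h(3)])
      have tm: "t < norm a * (1 - 1 / \<alpha>\<^sup>2) / \<alpha>"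
      proof -
        have "t \<le> norm a * q / (2 * \<alpha>)" using t h(2) by (simp add: s0_def m_def)
        moreover have "norm a * q / (2 * \<alpha>) < norm a * q / \<alpha>"
          using h(2) q gd(1) by (intro divide_strict_left_mono mult_pos_pos) simp_all
        ultimately show ?thesis unfolding q_def by (rule le_less_trans)
      qed
      note sg = shadow_gain[OF gd(1) h(1) xw w h(2) nm(2) nm(1) c tm]
      show ?thesis using sg dl_le_norms[of x "a + \<alpha> *\<^sub>R K"] by (metis order_antisym order_trans)
    qed
    then show "dl x (a + \<alpha> *\<^sub>R K) \<le> \<alpha> * norm (x - (b + I))"
      "dl x (a + \<alpha> *\<^sub>R K) = \<alpha> * norm (x - (b + I)) \<Longrightarrow> I = t *\<^sub>R sgn (x - b)"
      using full_speed_straight[OF w nm(2)] by (simp_all add: w_def)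
  qed
  then show ?thesis by blast
qed

text \<open>The form used when the entire boundary is and remains visible. The premise
  \<open>better\<close> admits modifications of parallel pursuit: a changed reply only has to be no
  farther from the aiming directions of boundary points.\<close>

lemma local_law_visible:
  assumes g: "good \<alpha> a b" and U: "continuous_on (sphere 0 1) U" "\<And>v. norm v = 1 \<Longrightarrow> norm (U v) = 1"
    and d: "0 < d"
    and H1: "\<And>t I K. 0 \<le> t \<Longrightarrow> t \<le> d \<Longrightarrow> avg U t I K \<Longrightarrow> a + \<alpha> *\<^sub>R K \<in> X"
    and vis: "\<And>x. x \<in> Bd \<alpha> a b \<Longrightarrow> \<not> blocked x a"
    and better: "\<And>x v. x \<in> Bd \<alpha> a b \<Longrightarrow> norm v = 1 \<Longrightarrow>
      x - a = (\<alpha> * norm (x - b)) *\<^sub>R parallel_dir \<alpha> a b (sgn (x - b)) \<Longrightarrow>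
      parallel_dir \<alpha> a b (sgn (x - b)) \<bullet> parallel_dir \<alpha> a b v \<le> parallel_dir \<alpha> a b (sgn (x - b)) \<bullet> U v"
    and H2: "\<And>x t I K. x \<in> Bd \<alpha> a b \<Longrightarrow> 0 \<le> t \<Longrightarrow> t \<le> d \<Longrightarrow> avg U t I K \<Longrightarrow> \<not> blocked x (a + \<alpha> *\<^sub>R K)"
  shows "\<exists>s0. local_law \<alpha> a b U s0"
proof (rule local_law_criterion[OF g U d H1])
  fix x assume x: "x \<in> Bd \<alpha> a b"
  note bf = Bd_facts[OF g x] and gd = goodD[OF g]
  have "norm (x - a) = \<alpha> * norm (x - b)" using dl_unblocked[OF vis[OF x]] bf(4) by (simp add: dist_norm)
  then have aim: "x - a = (\<alpha> * norm (x - b)) *\<^sub>R parallel_dir \<alpha> a b (sgn (x - b))"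
    by (rule parallel_dir_aim[OF gd(1) gd(4) bf(1)])
  have "1 - parallel_dir \<alpha> a b (sgn (x - b)) \<bullet> U v \<le> (1 - sgn (x - b) \<bullet> v) / \<alpha>\<^sup>2" if "norm v = 1" for v
    using better[OF x that aim] parallel_dir_contraction[OF gd(1,4), of "sgn (x - b)" v] by linarith
  then show "(\<exists>u. norm u = 1 \<and> x - a = (\<alpha> * norm (x - b)) *\<^sub>R u \<and>
          (\<forall>v. norm v = 1 \<longrightarrow> 1 - u \<bullet> U v \<le> (1 - sgn (x - b) \<bullet> v) / \<alpha>\<^sup>2) \<and>
          (\<forall>t I K. 0 \<le> t \<longrightarrow> t \<le> d \<longrightarrow> avg U t I K \<longrightarrow> \<not> blocked x (a + \<alpha> *\<^sub>R K)))
      \<or> (norm x + norm a = \<alpha> * norm (x - b) \<and> a \<noteq> 0 \<and>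
          (\<forall>v. norm v = 1 \<longrightarrow> 1 - (- sgn a) \<bullet> U v \<le> (1 - sgn (x - b) \<bullet> v) / \<alpha>\<^sup>2))"
    using parallel_dir_norm[OF gd(1,4) bf(5)] aim H2[OF x] by blast
qed

lemma avg_halfplane:
  assumes "avg U t I K" "\<And>v. norm v = 1 \<Longrightarrow> 0 \<le> n \<bullet> U v" shows "0 \<le> n \<bullet> K"
  using avgD[OF assms(1), of 0 0 n] assms(2) by simp

lemma abs_cr_le: "\<bar>cross_prod K x\<bar> \<le> 2 * norm K * norm x"
proof -
  have "\<bar>T K * B x\<bar> \<le> norm K * norm x" "\<bar>T x * B K\<bar> \<le> norm x * norm K"
    unfolding abs_mult by (intro mult_mono abs_T_le abs_B_le; simp)+
  then show ?thesis unfolding cross_prod_def mult.commute[of "norm x"] mult.assoc[of 2] by linarith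
qed

lemma cross_prod_add_left: "cross_prod (a + k *\<^sub>R K) x = cross_prod a x + k * cross_prod K x"
  by (simp add: cross_prod_def algebra_simps)

text \<open>A point strictly on the free side of both wall lines is blocked from nothing and stays
  so during a short move, so unmodified parallel pursuit serves.\<close>

lemma local_law_interior:
  assumes g: "good \<alpha> a b" and a: "0 < T a" "0 < B a"
  shows "\<exists>U s0. local_law \<alpha> a b U s0"
proof -
  note gd = goodD[OF g]
  define d where "d = min (T a) (B a) / (2 * \<alpha>)"
  have d: "0 < d" using a gd(1) by (simp add: d_def)
  have TB: "0 < T (a + \<alpha> *\<^sub>R K)" "0 < B (a + \<alpha> *\<^sub>R K)" if h: "t \<le> d" "avg (parallel_dir \<alpha> a b) t I K" for t I K
  proof -
    have "norm K \<le> d" using avg_norm(1)[OF h(2) parallel_dir_norm[OF gd(1,4)]] h(1) by linarith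
    then have "\<bar>T K\<bar> \<le> d" "\<bar>B K\<bar> \<le> d" using abs_T_le[of K] abs_B_le[of K] by linarith+
    then have "\<alpha> * \<bar>T K\<bar> \<le> \<alpha> * d" "\<alpha> * \<bar>B K\<bar> \<le> \<alpha> * d" using gd(1) by (intro mult_left_mono; simp)+
    moreover have "\<alpha> * d = min (T a) (B a) / 2" using gd(1) by (simp add: d_def)
    moreover have "- (\<alpha> * \<bar>T K\<bar>) \<le> \<alpha> * T K" "- (\<alpha> * \<bar>B K\<bar>) \<le> \<alpha> * B K"
      using gd(1) unfolding minus_mult_right by (intro mult_left_mono; simp)+
    ultimately show "0 < T (a + \<alpha> *\<^sub>R K)" "0 < B (a + \<alpha> *\<^sub>R K)" using a by simp_all
  qed
  have "\<exists>s0. local_law \<alpha> a b (parallel_dir \<alpha> a b) s0"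
  proof (rule local_law_visible[OF g continuous_on_UA parallel_dir_norm[OF gd(1,4)] d])
    fix t I K assume "t \<le> d" "avg (parallel_dir \<alpha> a b) t I K"
    then show "a + \<alpha> *\<^sub>R K \<in> X" using TB(1) by (simp add: X_def less_imp_le)
  next
    fix x t I K assume "t \<le> d" "avg (parallel_dir \<alpha> a b) t I K"
    note TB[OF this]
    then show "\<not> blocked x (a + \<alpha> *\<^sub>R K)" unfolding blocked_def by linarith
  next
    fix x show "\<not> blocked x a" unfolding blocked_def using a by linarith
  qed simp_all
  then show ?thesis by blast
qed

text \<open>By compactness the shadow behind the vertex misses the boundary by a uniform amount e,
  hence a short move hides no boundary point.\<close>

lemma local_law_no_shadow:
  assumes g: "good \<alpha> a b" and a: "0 < T a" "B a \<le> 0" and ns: "\<And>x. x \<in> Bd \<alpha> a b \<Longrightarrow> T x < 0 \<Longrightarrow> 0 < cross_prod a x"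
  shows "\<exists>U s0. local_law \<alpha> a b U s0"
proof -
  note gd = goodD[OF g]
  \<comment> \<open>The condition \<open>T x < 0\<close> is closed up to make S compact. The added
    points satisfy \<open>T x = 0\<close> and \<open>B x > 0\<close>, because the vertex is no
    boundary point, and there \<open>T a > 0\<close> makes the cross product positive.\<close>
  define S where "S = Bd \<alpha> a b \<inter> {x. T x \<le> 0} \<inter> {x. 0 \<le> B x}"
  have cS: "compact S" unfolding S_def
    by (intro compact_Int_closed compact_Bd gd closed_Collect_le continuous_intros)
  have pos: "0 < cross_prod a x" if "x \<in> S" for x
  proof -
    have x: "x \<in> Bd \<alpha> a b" "T x \<le> 0" "0 \<le> B x" using that by (simp_all add: S_def)
    show ?thesis
    proof (cases "T x < 0")
      case True then show ?thesis using ns x by blast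
    next
      case False
      then have "T x = 0" using x by simp
      moreover have "x \<noteq> 0" using Cl_unblocked(2)[OF g Bd_Cl[OF x(1)]] .
      ultimately have "0 < B x" using TB_eq_0_iff[of x] x(3) by (metis order_le_less)
      then show ?thesis using a \<open>T x = 0\<close> by (simp add: cross_prod_def)
    qed
  qed
  obtain e where e: "0 < e" "\<And>x. x \<in> S \<Longrightarrow> e \<le> cross_prod a x"
  proof (cases "S = {}")
    case True then show ?thesis using that[of 1] by simp
  next
    case False
    have "continuous_on S (cross_prod a)" unfolding cross_prod_def by (intro continuous_intros)
    then obtain y where "y \<in> S" "\<And>x. x \<in> S \<Longrightarrow> cross_prod a y \<le> cross_prod a x" using continuous_attains_inf[OF cS False] by blast
    then show ?thesis using that[of "cross_prod a y"] pos by blast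
  qed
  have "bounded (Bd \<alpha> a b)" using compact_Bd gd compact_imp_bounded by blast
  then obtain M where M: "0 < M" "\<And>x. x \<in> Bd \<alpha> a b \<Longrightarrow> norm x \<le> M" unfolding bounded_pos by blast
  \<comment> \<open>The first bound keeps \<open>T\<close> positive during the move; the second
    keeps the cross product above e / 2, by \<open>abs_cr_le\<close>.\<close>
  define d where "d = min (T a / (2 * \<alpha>)) (e / (4 * \<alpha> * M))"
  have d: "0 < d" using a e M gd(1) by (simp add: d_def)
  have K: "norm K \<le> d" if h: "t \<le> d" "avg (parallel_dir \<alpha> a b) t I K" for t I K
    using avg_norm(1)[OF h(2) parallel_dir_norm[OF gd(1,4)]] h(1) by linarith
  have Tr: "0 < T (a + \<alpha> *\<^sub>R K)" if "norm K \<le> d" for K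
  proof -
    have "\<bar>T K\<bar> \<le> T a / (2 * \<alpha>)" using abs_T_le[of K] that by (simp add: d_def)
    then have "\<alpha> * \<bar>T K\<bar> \<le> \<alpha> * (T a / (2 * \<alpha>))" using gd(1) by (intro mult_left_mono) simp_all
    moreover have "\<alpha> * (T a / (2 * \<alpha>)) = T a / 2" using gd(1) by simp
    moreover have "- (\<alpha> * \<bar>T K\<bar>) \<le> \<alpha> * T K"
      using gd(1) unfolding minus_mult_right by (intro mult_left_mono) simp_all
    ultimately show ?thesis using a by simp
  qed
  have crr: "0 < cross_prod (a + \<alpha> *\<^sub>R K) x" if h: "norm K \<le> d" "x \<in> Bd \<alpha> a b" "T x < 0" for K x
  proof -
    have "x \<in> S" unfolding S_def using h X_D(1)[of x] Cl_X[OF Bd_Cl[OF h(2)]] by simp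
    then have "e \<le> cross_prod a x" by (rule e(2))
    moreover have "\<bar>cross_prod K x\<bar> \<le> 2 * d * M"
    proof -
      have "2 * norm K * norm x \<le> 2 * d * M" using h M d by (intro mult_mono) simp_all
      then show ?thesis using abs_cr_le[of K x] by linarith
    qed
    then have "\<alpha> * \<bar>cross_prod K x\<bar> \<le> \<alpha> * (2 * d * M)" using gd(1) by (intro mult_left_mono) simp_all
    moreover have "\<alpha> * (2 * d * M) \<le> e / 2"
    proof -
      have "d \<le> e / (4 * \<alpha> * M)" by (simp add: d_def)
      then have "d * (4 * \<alpha> * M) \<le> e" using gd(1) M by (simp add: pos_le_divide_eq)
      then show ?thesis by (simp add: algebra_simps)
    qed
    moreover have "- (\<alpha> * \<bar>cross_prod K x\<bar>) \<le> \<alpha> * cross_prod K x"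
      using gd(1) unfolding minus_mult_right by (intro mult_left_mono) simp_all
    ultimately show ?thesis unfolding cross_prod_add_left using e(1) by linarith
  qed
  have "\<exists>s0. local_law \<alpha> a b (parallel_dir \<alpha> a b) s0"
  proof (rule local_law_visible[OF g continuous_on_UA parallel_dir_norm[OF gd(1,4)] d])
    fix t I K assume "t \<le> d" "avg (parallel_dir \<alpha> a b) t I K"
    then show "a + \<alpha> *\<^sub>R K \<in> X" using Tr[OF K] by (simp add: X_def less_imp_le)
  next
    fix x t I K assume x: "x \<in> Bd \<alpha> a b" and h: "t \<le> d" "avg (parallel_dir \<alpha> a b) t I K"
    then show "\<not> blocked x (a + \<alpha> *\<^sub>R K)"
      using Tr[OF K[OF h]] crr[OF K[OF h] x] unfolding blocked_def cross_prod_def by linarith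
  next
    fix x assume "x \<in> Bd \<alpha> a b"
    then show "\<not> blocked x a" using ns[of x] a unfolding blocked_def cross_prod_def by linarith
  qed simp_all
  then show ?thesis by blast
qed

text \<open>A pursuer on the boundary line of a half plane that contains the whole boundary: reflect
  the direction of parallel pursuit into the half plane.\<close>
lemma local_law_bounce:
  assumes g: "good \<alpha> a b" and n: "norm n = 1" and H: "{w. 0 \<le> n \<bullet> w} \<subseteq> X" and a: "n \<bullet> a = 0"
    and Bd: "\<And>x. x \<in> Bd \<alpha> a b \<Longrightarrow> 0 \<le> n \<bullet> x"
  shows "\<exists>U s0. local_law \<alpha> a b U s0"
proof -
  note gd = goodD[OF g]
  let ?U = "\<lambda>v. bounce n (parallel_dir \<alpha> a b v)"
  have cv: "convex {w. 0 \<le> n \<bullet> w}" using convex_halfspace_ge[of 0 n] by simp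
  have r: "0 \<le> n \<bullet> (a + \<alpha> *\<^sub>R K)" if "avg ?U t I K" for t I K
  proof -
    have "0 \<le> n \<bullet> K" by (rule avg_halfplane[OF that bounce_facts(2)[OF n parallel_dir_norm[OF gd(1,4)]]])
    then show ?thesis using a gd(1) by (simp add: inner_add_right)
  qed
  have "\<exists>s0. local_law \<alpha> a b ?U s0"
  proof (rule local_law_visible[OF g continuous_on_bounce[OF continuous_on_UA] bounce_facts(1)[OF n parallel_dir_norm[OF gd(1,4)]] zero_less_one])
    fix t I K assume "avg ?U t I K"
    then show "a + \<alpha> *\<^sub>R K \<in> X" using r H by blast
  next
    fix x t I K assume "x \<in> Bd \<alpha> a b" "avg ?U t I K"
    then show "\<not> blocked x (a + \<alpha> *\<^sub>R K)" using r Bd by (intro not_blocked_convex[OF cv H]) simp_all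
  next
    fix x assume "x \<in> Bd \<alpha> a b"
    then show "\<not> blocked x a" using Bd a by (intro not_blocked_convex[OF cv H]) simp_all
  next
    fix x v :: plane assume x: "x \<in> Bd \<alpha> a b" and v: "norm v = 1"
      and aim: "x - a = (\<alpha> * norm (x - b)) *\<^sub>R parallel_dir \<alpha> a b (sgn (x - b))"
    note bf = Bd_facts[OF g x]
    have "0 \<le> n \<bullet> (x - a)" using Bd[OF x] a by (simp add: inner_diff_right)
    then have "0 \<le> (\<alpha> * norm (x - b)) * (n \<bullet> parallel_dir \<alpha> a b (sgn (x - b)))" unfolding aim by simp
    moreover have "0 < \<alpha> * norm (x - b)" using bf(1) gd(1) by simp
    ultimately have "0 \<le> n \<bullet> parallel_dir \<alpha> a b (sgn (x - b))" by (simp only: zero_le_mult_iff) linarith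
    then show "parallel_dir \<alpha> a b (sgn (x - b)) \<bullet> parallel_dir \<alpha> a b v \<le> parallel_dir \<alpha> a b (sgn (x - b)) \<bullet> bounce n (parallel_dir \<alpha> a b v)"
      by (rule bounce_facts(3)[OF n parallel_dir_norm[OF gd(1,4) v]])
  qed
  then show ?thesis by blast
qed


subsection \<open>A pursuer whose view is blocked by the vertex\<close>

text \<open>The evader is nearer than the pursuer to the point \<open>l *\<^sub>R a\<close>, so b
  lies in the open disc about this point whose circle passes through a. That disc lies on the vertex
  side of its tangent at a, and this is what the inequality says.\<close>

lemma opposite_ray_forward:
  assumes g: "good \<alpha> a b" and l: "l \<le> 0" "l *\<^sub>R a \<in> Cl \<alpha> a b" and a0: "a \<noteq> 0"
  shows "a \<bullet> b < a \<bullet> a"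
proof (rule ccontr)
  note gd = goodD[OF g]
  assume "\<not> a \<bullet> b < a \<bullet> a"
  then have C: "a \<bullet> a \<le> a \<bullet> b" by simp
  have "norm a * norm a \<le> norm a * norm b"
    using C norm_cauchy_schwarz[of a b] by (simp add: dot_square_norm power2_eq_square)
  then have ab: "norm a \<le> norm b" using a0 by simp
  have "\<alpha> * dl (l *\<^sub>R a) b \<le> dl (l *\<^sub>R a) a" using l(2) by (simp add: Cl_def)
  also have "\<dots> \<le> norm (l *\<^sub>R a) + norm a" by (rule dl_le_norms)
  also have "\<dots> = (1 - l) * norm a" using l(1) by (simp add: algebra_simps)
  finally have 1: "\<alpha> * dl (l *\<^sub>R a) b \<le> (1 - l) * norm a" .
  have p: "0 < (1 - l) * norm a" using l(1) a0 by simp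
  have "dist (l *\<^sub>R a) b < (1 - l) * norm a"
  proof (cases "dl (l *\<^sub>R a) b = 0")
    case True then show ?thesis using p dl_ge_dist[of "l *\<^sub>R a" b] by linarith
  next
    case False
    then have "0 < dl (l *\<^sub>R a) b" using dl_nonneg[of "l *\<^sub>R a" b] by linarith
    then have "dl (l *\<^sub>R a) b < \<alpha> * dl (l *\<^sub>R a) b" using gd(1) by simp
    then show ?thesis using 1 dl_ge_dist[of "l *\<^sub>R a" b] by linarith
  qed
  then have "(norm (l *\<^sub>R a - 1 *\<^sub>R b))\<^sup>2 < ((1 - l) * norm a)\<^sup>2"
    by (intro power_strict_mono) (simp_all add: dist_norm)
  then have "l\<^sup>2 * (norm a)\<^sup>2 + (norm b)\<^sup>2 - 2 * l * (a \<bullet> b) < (1 - l)\<^sup>2 * (norm a)\<^sup>2"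
    unfolding norm_sq_difference by (simp add: power_mult_distrib)
  moreover have "(- l) * (norm a)\<^sup>2 \<le> (- l) * (a \<bullet> b)" using C l(1) by (intro mult_left_mono) (simp_all add: dot_square_norm)
  moreover have "(norm a)\<^sup>2 \<le> (norm b)\<^sup>2" using ab by (simp add: power_mono)
  ultimately show False by (simp add: power2_eq_square algebra_simps)
qed

text \<open>Half plane to the left of the line from a to the vertex; for a above the bottom wall's line it is free of the obstacle.\<close>
lemma left_of_sight_X:
  assumes "0 \<le> T a" "B a \<le> 0" "a \<noteq> 0" "0 \<le> cross_prod a w" shows "w \<in> X"
proof (rule ccontr)
  assume "w \<notin> X"
  then have w: "T w < 0" "B w < 0" by (simp_all add: X_def)
  have "T a * B w \<le> 0" "0 \<le> T w * B a" using w assms by (simp_all add: mult_nonneg_nonpos mult_nonpos_nonpos)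
  moreover have "0 \<le> T a * B w - T w * B a" using assms(4) by (simp only: cross_prod_def)
  ultimately have "T a * B w = 0" "T w * B a = 0" by linarith+
  then show False using w assms(3) TB_eq_0_iff[of a] by simp
qed

text \<open>Points beyond the pursuer are excluded once some boundary point is in the shadow. An
  evader right of the line of sight would have its view of x or of x0 blocked. Otherwise its
  segments to both cross the line of sight in points of \<open>Cl\<close>. If these are on opposite
  sides of the vertex, the vertex is forced into the closed region; if not, the crossing point would
  be hidden from x.\<close>

lemma Bd_sides:
  assumes g: "good \<alpha> a b" and a: "0 \<le> T a" "B a \<le> 0" "a \<noteq> 0"
    and x0: "x0 \<in> Bd \<alpha> a b" "T x0 < 0" "cross_prod a x0 \<le> 0" and x: "x \<in> Bd \<alpha> a b"
  shows "0 \<le> cross_prod a x \<or> (T x < 0 \<and> cross_prod a x < 0)"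
proof (rule ccontr)
  note gd = goodD[OF g]
  assume "\<not> ?thesis"
  then have n: "cross_prod a x < 0" "0 \<le> T x" by linarith+
  have X: "x0 \<in> X" "x \<in> X" using Cl_X[OF Bd_Cl] x0(1) x by blast+
  have u: "\<not> blocked x b" "\<not> blocked x0 b" using Cl_unblocked(1)[OF g Bd_Cl] x0(1) x by blast+
  have Bx: "B x < 0" by (rule blocked_far(1)[OF a X(1) x0(2,3) n(2,1)])
  show False
  proof (cases "0 \<le> cross_prod a b")
    case False
    show False
    proof (cases "0 \<le> T b")
      case True
      have "blocked b x0" by (rule blocked_far(2)[OF a X(1) x0(2,3) True]) (use False in simp)
      then show False using u blocked_sym by blast
    next
      case F: False
      have "blocked x b" by (rule blocked_far(2)[OF a gd(3) _ _ n(2,1)]) (use False F in simp_all)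
      then show False using u by blast
    qed
  next
    case True
    obtain l where l: "l *\<^sub>R a \<in> closed_segment b x" using cross_prod_zero_on_segment[OF True _ a(3), of x] n by (meson less_imp_le)
    obtain m where m: "m \<le> 0" "m *\<^sub>R a \<in> closed_segment b x0"
      using opposite_ray_on_segment[OF a X(1) x0(2,3) gd(3) _ True] u(2) blocked_sym by blast
    note ls = Cl_segment[OF g Bd_Cl[OF x] l] and ms = Cl_segment[OF g Bd_Cl[OF x0(1)] m(2)]
    have nz: "l *\<^sub>R a \<noteq> 0" "m *\<^sub>R a \<noteq> 0" using Cl_unblocked(2)[OF g] ls(5) ms(5) by blast+
    then have l0: "l \<noteq> 0" "m < 0" using m(1) by (auto simp: order_less_le)
    show False
    proof (cases "l < 0")
      case True
      have Ta: "0 < T a"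
      proof (rule ccontr)
        assume "\<not> 0 < T a"
        then have "T a = 0" using a by simp
        then have "0 \<le> cross_prod a x" using n(2) a(2) by (simp add: cross_prod_def mult_nonneg_nonpos)
        then show False using n by simp
      qed
      have "cross_prod x a = - cross_prod a x" by (simp add: cross_prod_def)
      then have "0 < cross_prod x a" using n(1) by linarith
      then have "cross_prod x (l *\<^sub>R a) < 0" using True by (simp add: mult_neg_pos)
      moreover have "T (l *\<^sub>R a) < 0" using True Ta by (simp add: mult_neg_pos)
      ultimately have "blocked x (l *\<^sub>R a)" using Bx by (intro blocked1)
      then show False using ls(3) by blast
    next
      case False
      then have lp: "0 < l" using l0 by simp
      define A where "A = (norm a)\<^sup>2"
      \<comment> \<open>The Apollonius function on the line through a and the vertex, in squared
        Euclidean distances. Its leading coefficient \<open>(1 - \<alpha>\<^sup>2) * A\<close> is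
        negative, so it is concave: nonnegative at l > 0 and at m < 0, it is nonnegative at 0, which
        contradicts \<open>good\<close>.\<close>
      define f where "f t = (t - 1)\<^sup>2 * A - \<alpha>\<^sup>2 * (t\<^sup>2 * A + (norm b)\<^sup>2 - 2 * t * (a \<bullet> b))" for t
      have fpos: "0 \<le> f t" if h: "\<alpha> * dl (t *\<^sub>R a) b \<le> \<bar>t - 1\<bar> * norm a" for t
      proof -
        have "\<alpha> * norm (t *\<^sub>R a - 1 *\<^sub>R b) \<le> \<alpha> * dl (t *\<^sub>R a) b"
          using gd(1) dl_ge_dist[of "t *\<^sub>R a" b] by (intro mult_left_mono) (simp_all add: dist_norm)
        from power_mono[OF order_trans[OF this h]]
        have "(\<alpha> * norm (t *\<^sub>R a - 1 *\<^sub>R b))\<^sup>2 \<le> (\<bar>t - 1\<bar> * norm a)\<^sup>2" using gd(1) by simp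
        then show ?thesis unfolding power_mult_distrib norm_sq_difference by (simp add: f_def A_def)
      qed
      have "0 \<le> f l"
      proof (rule fpos)
        have "\<not> blocked (l *\<^sub>R a) a" using a(1) lp by (auto simp: blocked_def mult_less_0_iff)
        then have "dl (l *\<^sub>R a) a = norm ((l - 1) *\<^sub>R a)" by (simp add: dl_unblocked dist_norm scaleR_left_diff_distrib)
        then show "\<alpha> * dl (l *\<^sub>R a) b \<le> \<bar>l - 1\<bar> * norm a" using ls(4) by simp
      qed
      moreover have "0 \<le> f m"
      proof (rule fpos)
        have "dl (m *\<^sub>R a) a \<le> norm (m *\<^sub>R a) + norm a" by (rule dl_le_norms)
        also have "\<dots> = \<bar>m - 1\<bar> * norm a" using m(1) by (simp add: algebra_simps)
        finally show "\<alpha> * dl (m *\<^sub>R a) b \<le> \<bar>m - 1\<bar> * norm a" using ms(4) by linarith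
      qed
      ultimately have "0 \<le> l * f m + (- m) * f l" using lp m(1) by (intro add_nonneg_nonneg mult_nonneg_nonneg) simp_all
      also have "l * f m + (- m) * f l = (l - m) * (f 0 + (\<alpha>\<^sup>2 - 1) * A * (l * m))"
        by (simp add: f_def power2_eq_square algebra_simps)
      finally have "0 \<le> f 0 + (\<alpha>\<^sup>2 - 1) * A * (l * m)" using lp m(1) by (simp add: zero_le_mult_iff)
      moreover have "(\<alpha>\<^sup>2 - 1) * A * (l * m) \<le> 0"
        using gd(1) lp m(1) by (intro mult_nonneg_nonpos mult_nonneg_nonneg) (simp_all add: A_def mult_le_0_iff)
      ultimately have "0 \<le> f 0" by linarith
      then have "(\<alpha> * norm b)\<^sup>2 \<le> (norm a)\<^sup>2" by (simp add: f_def A_def power_mult_distrib)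
      then have "\<alpha> * norm b \<le> norm a" by (rule power2_le_imp_le) simp
      then show False using gd(5) by simp
    qed
  qed
qed

text \<open>By \<open>opposite_ray_forward\<close> and \<open>nf\<close>, no point of
  \<open>Cl\<close> is on the ray opposite to a. The evader's segments to boundary points therefore
  never cross that ray, the whole boundary is in the shadow, and running to the vertex is the right
  reply to every direction.\<close>

lemma local_law_to_vertex:
  assumes g: "good \<alpha> a b" and a: "0 \<le> T a" "B a \<le> 0" "a \<noteq> 0"
    and x0: "x0 \<in> Bd \<alpha> a b" "T x0 < 0" "cross_prod a x0 \<le> 0" and nf: "\<not> a \<bullet> b < a \<bullet> a"
  shows "\<exists>U s0. local_law \<alpha> a b U s0"
proof -
  note gd = goodD[OF g]
  let ?m = "- sgn a"
  have m: "norm ?m = 1" using a(3) by (simp add: norm_sgn)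
  have shadow: "T x < 0 \<and> cross_prod a x < 0" if x: "x \<in> Bd \<alpha> a b" for x
  proof (rule ccontr)
    assume "\<not> (T x < 0 \<and> cross_prod a x < 0)"
    then have cx: "0 \<le> cross_prod a x" using Bd_sides[OF g a x0 x] by blast
    have X: "x0 \<in> X" "x \<in> X" using Cl_X[OF Bd_Cl] x0(1) x by blast+
    have u: "\<not> blocked x b" "\<not> blocked b x0" using Cl_unblocked(1)[OF g Bd_Cl] x0(1) x blocked_sym by blast+
    show False
    proof (cases "0 \<le> cross_prod a b")
      case True
      obtain l where l: "l \<le> 0" "l *\<^sub>R a \<in> closed_segment b x0"
        using opposite_ray_on_segment[OF a X(1) x0(2,3) gd(3) u(2) True] by blast
      show False using opposite_ray_forward[OF g l(1) Cl_segment(5)[OF g Bd_Cl[OF x0(1)] l(2)] a(3)] nf by blast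
    next
      case False
      have Tb: "T b < 0"
      proof (rule ccontr)
        assume "\<not> T b < 0"
        then have "blocked b x0" using False by (intro blocked_far(2)[OF a X(1) x0(2,3)]) simp_all
        then show False using u by blast
      qed
      have "cross_prod a b \<le> 0" using False by simp
      then obtain l where l: "l \<le> 0" "l *\<^sub>R a \<in> closed_segment x b"
        using opposite_ray_on_segment[OF a gd(3) Tb _ X(2) u(1) cx] by blast
      then have l2: "l *\<^sub>R a \<in> closed_segment b x" by (simp add: closed_segment_commute)
      show False using opposite_ray_forward[OF g l(1) Cl_segment(5)[OF g Bd_Cl[OF x] l2] a(3)] nf by blast
    qed
  qed
  \<comment> \<open>Testing \<open>avg\<close> against the negative of the error vector shows that a
    constant law has no other average.\<close>
  have K: "K = t *\<^sub>R ?m" if "avg (\<lambda>v. ?m) t I K" for t I K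
  proof -
    have "0 \<bullet> I + ((- (K - t *\<^sub>R ?m)) \<bullet> ?m) * t \<le> (- (K - t *\<^sub>R ?m)) \<bullet> K"
      by (rule avgD[OF that]) simp
    then have "(K - t *\<^sub>R ?m) \<bullet> (K - t *\<^sub>R ?m) \<le> 0"
      by (simp add: inner_diff_left inner_diff_right inner_commute algebra_simps)
    then show ?thesis by (metis inner_ge_zero inner_eq_zero_iff order_antisym right_minus_eq)
  qed
  have "\<exists>s0. local_law \<alpha> a b (\<lambda>v. ?m) s0"
  proof (rule local_law_criterion[OF g continuous_on_const m])
    show "0 < norm a / \<alpha>" using a(3) gd(1) by simp
  next
    fix t I K assume t: "0 \<le> t" "t \<le> norm a / \<alpha>" "avg (\<lambda>v. ?m) t I K"
    have "a + \<alpha> *\<^sub>R K = (1 - \<alpha> * t / norm a) *\<^sub>R a"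
      unfolding K[OF t(3)] by (simp add: sgn_div_norm algebra_simps divide_inverse)
    moreover have "0 \<le> 1 - \<alpha> * t / norm a" using t(2) a(3) gd(1) by (simp add: pos_le_divide_eq mult.commute)
    ultimately show "a + \<alpha> *\<^sub>R K \<in> X" using scale_X[OF gd(2)] by simp
  next
    fix x assume x: "x \<in> Bd \<alpha> a b"
    note sh = shadow[OF x] and bf = Bd_facts[OF g x]
    have Ba: "B a < 0"
    proof (rule ccontr)
      assume "\<not> B a < 0"
      then have "B a = 0" using a by simp
      then have "0 \<le> cross_prod a x" using X_D(1)[OF Cl_X[OF Bd_Cl[OF x]]] sh a(1) by (simp add: cross_prod_def)
      then show False using sh by simp
    qed
    have "blocked x a" using blocked1[OF Ba] sh blocked_sym by blast
    then have "norm x + norm a = \<alpha> * norm (x - b)" using bf(4) by (simp add: dl_def)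
    moreover have "1 - ?m \<bullet> ?m \<le> (1 - sgn (x - b) \<bullet> v) / \<alpha>\<^sup>2" if v: "norm v = 1" for v
    proof -
      have "?m \<bullet> ?m = 1" using m by (simp only: dot_square_norm) simp
      moreover have "sgn (x - b) \<bullet> v \<le> 1" using norm_cauchy_schwarz[of "sgn (x - b)" v] bf(5) v by simp
      ultimately show ?thesis by simp
    qed
    ultimately show "(\<exists>u. norm u = 1 \<and> x - a = (\<alpha> * norm (x - b)) *\<^sub>R u \<and>
          (\<forall>v. norm v = 1 \<longrightarrow> 1 - u \<bullet> ?m \<le> (1 - sgn (x - b) \<bullet> v) / \<alpha>\<^sup>2) \<and>
          (\<forall>t I K. 0 \<le> t \<longrightarrow> t \<le> norm a / \<alpha> \<longrightarrow> avg (\<lambda>v. ?m) t I K \<longrightarrow> \<not> blocked x (a + \<alpha> *\<^sub>R K)))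
      \<or> (norm x + norm a = \<alpha> * norm (x - b) \<and> a \<noteq> 0 \<and>
          (\<forall>v. norm v = 1 \<longrightarrow> 1 - ?m \<bullet> ?m \<le> (1 - sgn (x - b) \<bullet> v) / \<alpha>\<^sup>2))"
      using a(3) by blast
  qed
  then show ?thesis by blast
qed


text \<open>The remaining case mixes visible and hidden boundary points. Parallel pursuit is kept
  while it stays left of the line of sight and is replaced by the run to the vertex otherwise. For
  visible points the aiming direction is on the left, so clamping only brings the reply closer; for
  hidden points the aim is the vertex itself, and their parallel replies lie right of it.\<close>

lemma local_law_clamp:
  assumes g: "good \<alpha> a b" and a: "0 \<le> T a" "B a \<le> 0" "a \<noteq> 0"
    and x0: "x0 \<in> Bd \<alpha> a b" "T x0 < 0" "cross_prod a x0 \<le> 0" and fw: "a \<bullet> b < a \<bullet> a"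
  shows "\<exists>U s0. local_law \<alpha> a b U s0"
proof -
  note gd = goodD[OF g]
  let ?m = "- sgn a"
  have m1: "norm ?m = 1" using a(3) by (simp add: norm_sgn)
  have ma: "norm a *\<^sub>R ?m = - a" using a(3) by (simp add: sgn_div_norm)
  define n where "n = (1 / norm a) *\<^sub>R (- snd a, fst a)"
  define k where "k = 2 * c * s * norm a"
  have k: "0 < k" using c_pos s_pos a(3) by (simp add: k_def)
  have nk: "k * (n \<bullet> w) = cross_prod a w" for w
    using a(3) by (simp add: n_def k_def cross_prod_cross inner_prod_def algebra_simps)
  have n_sgn: "0 \<le> n \<bullet> w \<longleftrightarrow> 0 \<le> cross_prod a w" "n \<bullet> w = 0 \<longleftrightarrow> cross_prod a w = 0" for w
    unfolding nk[symmetric] using k by (simp_all add: zero_le_mult_iff)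
  have ba: "(b - a) \<bullet> a < 0" using fw inner_commute[of a b] by (simp add: inner_diff_left)
  have col: "l < 0" "l *\<^sub>R a = (- l * norm a) *\<^sub>R ?m" if "0 < (b - a) \<bullet> (l *\<^sub>R a)" for l
  proof -
    show "l < 0" using that ba by (simp add: zero_less_mult_iff)
    show "l *\<^sub>R a = (- l * norm a) *\<^sub>R ?m" using ma by (metis minus_minus scaleR_minus_left scaleR_minus_right scaleR_scaleR)
  qed
  \<comment> \<open>The two branches of \<open>?U\<close> agree where they meet: by
    \<open>fw\<close> a direction on the line of sight with a component towards the evader can only
    point to the vertex.\<close>
  have on_line: "U = ?m" if "norm U = 1" "n \<bullet> U = 0" "0 < (b - a) \<bullet> U" for U
  proof -
    obtain l where l: "U = l *\<^sub>R a" using cross_prod_eq_0[of a U] n_sgn(2) \<open>n \<bullet> U = 0\<close> a(3) by blast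
    note c = col[of l, folded l, OF that(3)]
    have "\<bar>l\<bar> * norm a = 1" using that(1) l by simp
    then show ?thesis using c by simp
  qed
  \<comment> \<open>The combination of u and U that falls on the line of sight is again directed at
    the evader, hence a positive multiple of \<open>?m\<close>. So \<open>?m\<close> lies in the
    angle between u and U.\<close>
  have between: "u \<bullet> U \<le> u \<bullet> ?m"
    if h: "norm u = 1" "norm U = 1" "0 \<le> n \<bullet> u" "n \<bullet> U \<le> 0" "0 < (b - a) \<bullet> u" "0 < (b - a) \<bullet> U" for u U
  proof (cases "n \<bullet> u = 0 \<and> n \<bullet> U = 0")
    case True
    then show ?thesis using on_line[of U] h by simp
  next
    case False
    define z where "z = (- (n \<bullet> U)) *\<^sub>R u + (n \<bullet> u) *\<^sub>R U"
    have "n \<bullet> z = 0" unfolding z_def inner_add_right inner_scaleR_right by (simp add: mult.commute)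
    then obtain l where l: "z = l *\<^sub>R a" using cross_prod_eq_0[of a z] n_sgn(2) a(3) by blast
    have "0 < (b - a) \<bullet> z"
    proof -
      have e: "(b - a) \<bullet> z = (- (n \<bullet> U)) * ((b - a) \<bullet> u) + (n \<bullet> u) * ((b - a) \<bullet> U)"
        by (simp only: z_def inner_add_right inner_scaleR_right)
      show ?thesis
      proof (cases "n \<bullet> u = 0")
        case True
        then have "0 < - (n \<bullet> U)" using False h(4) by linarith
        then show ?thesis unfolding e True using h(5) by (simp only: mult_zero_left add_0_right mult_pos_pos)
      next
        case F: False
        have "0 < (n \<bullet> u) * ((b - a) \<bullet> U)" using F h by simp
        moreover have "0 \<le> (- (n \<bullet> U)) * ((b - a) \<bullet> u)" using h by (intro mult_nonneg_nonneg) simp_all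
        ultimately show ?thesis unfolding e by linarith
      qed
    qed
    note cl = col[of l, folded l, OF this]
    show ?thesis
    proof (rule between_inner[OF h(1,2) m1 _ h(3)])
      show "0 \<le> - (n \<bullet> U)" using h(4) by simp
      show "0 < - l * norm a" using cl(1) a(3) by (simp add: mult_neg_pos)
      show "(- (n \<bullet> U)) *\<^sub>R u + (n \<bullet> u) *\<^sub>R U = (- l * norm a) *\<^sub>R ?m" using cl(2) unfolding z_def .
    qed
  qed
  let ?U = "\<lambda>v. if - (n \<bullet> parallel_dir \<alpha> a b v) \<le> 0 then parallel_dir \<alpha> a b v else ?m"
  note UAn = parallel_dir_norm[OF gd(1,4)] and UAf = parallel_dir_forward_pos[OF gd(1,4)]
  have cont: "continuous_on (sphere 0 1) ?U"
  proof (rule continuous_on_cases_le)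
    show "continuous_on (sphere 0 1) (\<lambda>v. - (n \<bullet> parallel_dir \<alpha> a b v))" by (intro continuous_intros continuous_on_UA)
    fix v assume "v \<in> sphere (0::plane) 1" "- (n \<bullet> parallel_dir \<alpha> a b v) = 0"
    then show "parallel_dir \<alpha> a b v = ?m" using UAf[of v] UAn[of v] by (intro on_line) simp_all
  qed (auto intro: continuous_on_UA)
  have unit: "norm (?U v) = 1" if "norm v = 1" for v using UAn[OF that] m1 by simp
  have nU: "0 \<le> n \<bullet> ?U v" for v
  proof -
    have "n \<bullet> ?m = 0" using n_sgn(2)[of ?m] by (simp add: sgn_div_norm)
    then show ?thesis by simp
  qed
  have G: "{w. 0 \<le> n \<bullet> w} \<subseteq> X" using left_of_sight_X[OF a] n_sgn(1) by blast
  have cv: "convex {w. 0 \<le> n \<bullet> w}" using convex_halfspace_ge[of 0 n] by simp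
  have na: "n \<bullet> a = 0" using n_sgn(2)[of a] by simp
  have r: "0 \<le> n \<bullet> (a + \<alpha> *\<^sub>R K)" if "avg ?U t I K" for t I K
  proof -
    have "0 \<le> n \<bullet> K" by (rule avg_halfplane[OF that nU])
    then show ?thesis using na gd(1) by (simp add: inner_add_right)
  qed
  have "\<exists>s0. local_law \<alpha> a b ?U s0"
  proof (rule local_law_criterion[OF g cont unit zero_less_one])
    fix t I K assume "avg ?U t I K"
    then show "a + \<alpha> *\<^sub>R K \<in> X" using r G by blast
  next
    fix x assume x: "x \<in> Bd \<alpha> a b"
    note bf = Bd_facts[OF g x]
    show "(\<exists>u. norm u = 1 \<and> x - a = (\<alpha> * norm (x - b)) *\<^sub>R u \<and>
          (\<forall>v. norm v = 1 \<longrightarrow> 1 - u \<bullet> ?U v \<le> (1 - sgn (x - b) \<bullet> v) / \<alpha>\<^sup>2) \<and>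
          (\<forall>t I K. 0 \<le> t \<longrightarrow> t \<le> 1 \<longrightarrow> avg ?U t I K \<longrightarrow> \<not> blocked x (a + \<alpha> *\<^sub>R K)))
      \<or> (norm x + norm a = \<alpha> * norm (x - b) \<and> a \<noteq> 0 \<and>
          (\<forall>v. norm v = 1 \<longrightarrow> 1 - ?m \<bullet> ?U v \<le> (1 - sgn (x - b) \<bullet> v) / \<alpha>\<^sup>2))"
    proof (cases "0 \<le> cross_prod a x")
      case True
      then have nx: "0 \<le> n \<bullet> x" using n_sgn(1) by blast
      have "\<not> blocked x a" by (rule not_blocked_convex[OF cv G]) (use nx na in simp_all)
      then have "norm (x - a) = \<alpha> * norm (x - b)" using dl_unblocked[of x a] bf(4) by (simp add: dist_norm)
      then have aim: "x - a = (\<alpha> * norm (x - b)) *\<^sub>R parallel_dir \<alpha> a b (sgn (x - b))"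
        by (rule parallel_dir_aim[OF gd(1) gd(4) bf(1)])
      let ?u = "parallel_dir \<alpha> a b (sgn (x - b))"
      have "0 \<le> n \<bullet> (x - a)" using nx na by (simp add: inner_diff_right)
      then have "0 \<le> (\<alpha> * norm (x - b)) * (n \<bullet> ?u)" unfolding aim by simp
      moreover have "0 < \<alpha> * norm (x - b)" using bf(1) gd(1) by simp
      ultimately have nu: "0 \<le> n \<bullet> ?u" by (simp only: zero_le_mult_iff) linarith
      have "1 - ?u \<bullet> ?U v \<le> (1 - sgn (x - b) \<bullet> v) / \<alpha>\<^sup>2" if v: "norm v = 1" for v
      proof -
        have "?u \<bullet> parallel_dir \<alpha> a b v \<le> ?u \<bullet> ?U v"
          using between[OF UAn[OF bf(5)] UAn[OF v] nu _ UAf UAf] by simp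
        then show ?thesis using parallel_dir_contraction[OF gd(1,4), of "sgn (x - b)" v] by linarith
      qed
      moreover have "\<not> blocked x (a + \<alpha> *\<^sub>R K)" if "avg ?U t I K" for t I K
        using r[OF that] nx by (intro not_blocked_convex[OF cv G]) simp_all
      ultimately show ?thesis using UAn[OF bf(5)] aim by blast
    next
      case False
      then have sh: "T x < 0" "cross_prod a x < 0" using Bd_sides[OF g a x0 x] by blast+
      have Ba: "B a < 0"
      proof (rule ccontr)
        assume "\<not> B a < 0"
        then have "B a = 0" using a by simp
        then have "0 \<le> cross_prod a x" using X_D(1)[OF Cl_X[OF Bd_Cl[OF x]]] sh a(1) by (simp add: cross_prod_def)
        then show False using sh by simp
      qed
      have "blocked x a" using blocked1[OF Ba] sh blocked_sym by blast
      then have e: "norm x + norm a = \<alpha> * norm (x - b)" using bf(4) by (simp add: dl_def)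
      let ?w = "sgn (x - b)"
      \<comment> \<open>Otherwise the Apollonius point z in direction \<open>?w\<close> would be
        visible from a and come before x on the evader's segment. Points before x are strictly
        inside the region, but both players reach z at the same time.\<close>
      have nw: "n \<bullet> parallel_dir \<alpha> a b ?w \<le> 0"
      proof (rule ccontr)
        assume neg: "\<not> n \<bullet> parallel_dir \<alpha> a b ?w \<le> 0"
        obtain r where r: "0 < r" "b + r *\<^sub>R ?w = a + (\<alpha> * r) *\<^sub>R parallel_dir \<alpha> a b ?w"
          "norm (b + r *\<^sub>R ?w - a) = \<alpha> * r"
          "\<And>t. 0 < t \<Longrightarrow> norm (b + t *\<^sub>R ?w - a) \<le> \<alpha> * t \<Longrightarrow> r \<le> t"
          using parallel_dir_ray[OF gd(1,4) bf(5)] by metis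
        define z where "z = b + r *\<^sub>R ?w"
        have "n \<bullet> z = (\<alpha> * r) * (n \<bullet> parallel_dir \<alpha> a b ?w)" unfolding z_def r(2) using na by (simp add: inner_add_right)
        then have nz: "0 < n \<bullet> z" using neg r(1) gd(1) by simp
        have "\<not> blocked z a" by (rule not_blocked_convex[OF cv G]) (use nz na in simp_all)
        then have dz: "dl z a = \<alpha> * r" using r(3) by (simp add: dl_unblocked dist_norm z_def)
        have xb: "x = b + norm (x - b) *\<^sub>R ?w" using bf(6) by (simp add: algebra_simps)
        have "norm (x - a) \<le> \<alpha> * norm (x - b)" using bf(4) dl_ge_dist[of x a] by (simp add: dist_norm)
        then have rx: "r \<le> norm (x - b)" using r(4)[of "norm (x - b)"] xb bf(1) by simp
        have "z \<in> closed_segment b x"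
        proof -
          have "z = b + (r / norm (x - b)) *\<^sub>R (x - b)"
            unfolding z_def using bf(1) bf(6) by (simp add: sgn_div_norm divide_inverse)
          then have "z = (1 - r / norm (x - b)) *\<^sub>R b + (r / norm (x - b)) *\<^sub>R x" by (simp add: algebra_simps)
          moreover have "0 \<le> r / norm (x - b)" "r / norm (x - b) \<le> 1" using r(1) rx bf(1) by (simp_all add: divide_le_eq_1)
          ultimately show ?thesis unfolding in_segment by blast
        qed
        note zs = Cl_segment[OF g Bd_Cl[OF x] this]
        have "z \<noteq> x"
        proof
          assume "z = x"
          then show False using nz n_sgn(1)[of x] sh by simp
        qed
        then have "z \<in> Dom \<alpha> a b" by (rule zs(6))
        then have "\<alpha> * dl z b < \<alpha> * r" unfolding Dom_def using dz by simp
        moreover have "dl z b = r" using dl_unblocked[OF zs(2)] r(1) bf(5) by (simp add: z_def dist_norm)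
        ultimately show False by simp
      qed
      have "1 - ?m \<bullet> ?U v \<le> (1 - ?w \<bullet> v) / \<alpha>\<^sup>2" if v: "norm v = 1" for v
      proof (cases "- (n \<bullet> parallel_dir \<alpha> a b v) \<le> 0")
        case True
        have "parallel_dir \<alpha> a b v \<bullet> parallel_dir \<alpha> a b ?w \<le> parallel_dir \<alpha> a b v \<bullet> ?m"
          by (rule between[OF UAn[OF v] UAn[OF bf(5)] _ nw UAf UAf]) (use True in simp)
        then show ?thesis using True parallel_dir_contraction[OF gd(1,4), of v ?w]
          by (simp add: inner_commute[of v] inner_commute[of "parallel_dir \<alpha> a b v"])
      next
        case F: False
        have "?m \<bullet> ?m = 1" using m1 by (simp only: dot_square_norm) simp
        moreover have "?w \<bullet> v \<le> 1" using norm_cauchy_schwarz[of ?w v] bf(5) v by simp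
        ultimately show ?thesis using F by simp
      qed
      then show ?thesis using e a(3) by blast
    qed
  qed
  then show ?thesis by blast
qed

text \<open>At the vertex nothing is hidden, but a reply might point into the obstacle. If the
  boundary is on the free side of the bottom wall's line, reflection in that line helps. If not, the
  cone about b that contains the boundary and all replies turns out to be free of the obstacle. The
  assumption on b selects one of two mirror images.\<close>

lemma local_law_vertex:
  assumes g: "good \<alpha> 0 b" and b: "T b \<le> B b"
  shows "\<exists>U s0. local_law \<alpha> 0 b U s0"
proof (cases "\<forall>x\<in>Bd \<alpha> 0 b. 0 \<le> B x")
  case True
  show ?thesis
  proof (rule local_law_bounce[OF g norm_nB])
    show "{w. 0 \<le> (- s, - c) \<bullet> w} \<subseteq> X" unfolding B_inner[symmetric] by (auto simp: X_def simp del: split_paired_All)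
  qed (use True in \<open>simp_all add: B_inner[symmetric]\<close>)
next
  case False
  then obtain y where y: "y \<in> Bd \<alpha> 0 b" "B y < 0" by (meson not_le)
  note gd = goodD[OF g]
  have yX: "0 \<le> T y" using X_D(2)[OF Cl_X[OF Bd_Cl[OF y(1)]] y(2)] .
  have Bb: "0 \<le> B b" using gd(3) b by (auto simp: X_def)
  define k where "k = norm b * (sqrt (\<alpha>\<^sup>2 - 1) / \<alpha>)"
  have "0 < norm b" using gd(4) by simp
  then have k: "0 < k" unfolding k_def using gd(1) by (intro mult_pos_pos divide_pos_pos) (auto simp: one_less_power)
  \<comment> \<open>The cone given by \<open>parallel_dir_forward\<close>. It is convex, so once it
    is known to lie in \<open>X\<close> any two of its points see each other.\<close>
  define C where "C = {w. k * norm w \<le> b \<bullet> w}"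
  have cv: "convex C"
  proof (rule convexI)
    fix x y u v assume h: "x \<in> C" "y \<in> C" "0 \<le> (u::real)" "0 \<le> v" "u + v = 1"
    have "k * norm (u *\<^sub>R x + v *\<^sub>R y) \<le> k * (u * norm x + v * norm y)"
      using k h norm_triangle_ineq[of "u *\<^sub>R x" "v *\<^sub>R y"] by (intro mult_left_mono) simp_all
    also have "\<dots> = u * (k * norm x) + v * (k * norm y)" by (simp add: algebra_simps)
    also have "\<dots> \<le> u * (b \<bullet> x) + v * (b \<bullet> y)" using h by (intro add_mono mult_left_mono) (simp_all add: C_def)
    finally show "u *\<^sub>R x + v *\<^sub>R y \<in> C" by (simp add: C_def inner_add_right)
  qed
  have UAC: "k \<le> b \<bullet> parallel_dir \<alpha> 0 b v" for v using parallel_dir_forward[OF gd(1,4), of v] by (simp add: k_def)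
  have BdC: "x \<in> C" if x: "x \<in> Bd \<alpha> 0 b" for x
  proof -
    note bf = Bd_facts[OF g x]
    have "norm (x - 0) = \<alpha> * norm (x - b)" using bf(4) by simp
    then have aim: "x - 0 = (\<alpha> * norm (x - b)) *\<^sub>R parallel_dir \<alpha> 0 b (sgn (x - b))" by (rule parallel_dir_aim[OF gd(1) gd(4) bf(1)])
    have p: "0 \<le> \<alpha> * norm (x - b)" using gd(1) by simp
    have "norm x = \<alpha> * norm (x - b)" using bf(4) by simp
    then have "k * norm x = (\<alpha> * norm (x - b)) * k" by simp
    also have "\<dots> \<le> (\<alpha> * norm (x - b)) * (b \<bullet> parallel_dir \<alpha> 0 b (sgn (x - b)))" by (rule mult_left_mono[OF UAC p])
    also have "\<dots> = b \<bullet> (x - 0)" by (subst aim) simp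
    finally show ?thesis by (simp add: C_def)
  qed
  have pos: "0 < b \<bullet> w" if "w \<in> C" "w \<noteq> 0" for w
  proof -
    have "0 < k * norm w" using k that by simp
    then show ?thesis using that(1) unfolding C_def by simp
  qed
  have CX: "C \<subseteq> X"
  proof
    fix w assume w: "w \<in> C"
    show "w \<in> X"
    proof (rule ccontr)
      assume "w \<notin> X"
      then have TB: "T w < 0" "B w < 0" by (simp_all add: X_def)
      then have "w \<noteq> 0" by auto
      then have bw: "0 < b \<bullet> w" using pos[OF w] by blast
      have by0: "0 < b \<bullet> y" using pos[OF BdC[OF y(1)]] y(2) by force
      have c1: "0 \<le> cross_prod y b"
      proof (cases "0 \<le> T b")
        case True
        then have "0 \<le> T y * B b" "T b * B y \<le> 0" using yX y(2) Bb by (simp_all add: mult_nonneg_nonpos)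
        then show ?thesis unfolding cross_prod_def by linarith
      next
        case False
        then show ?thesis using Cl_unblocked(1)[OF g Bd_Cl[OF y(1)]] y(2) blocked1[of y b] by (meson not_le)
      qed
      have c2: "0 \<le> cross_prod b w"
      proof (cases "T b \<le> 0")
        case True
        then have "0 \<le> T b * B w" "T w * B b \<le> 0" using TB Bb by (simp_all add: mult_nonpos_nonpos mult_nonpos_nonneg)
        then show ?thesis unfolding cross_prod_def by linarith
      next
        case F: False
        have sums: "T b + B b = - (2 * s * fst b)" "T w + B w = - (2 * s * fst w)"
          "T b - B b = 2 * c * snd b" "T w - B w = 2 * c * snd w" by (simp_all add: T_def B_def)
        have "2 * s * fst b < 0" "0 < 2 * s * fst w" "2 * c * snd b \<le> 0" using sums F Bb TB b by linarith+
        then have f: "fst b < 0" "0 < fst w" "snd b \<le> 0" using s_pos c_pos by (simp_all add: mult_less_0_iff zero_less_mult_iff mult_le_0_iff)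
        have "snd w < 0"
        proof (rule ccontr)
          assume "\<not> snd w < 0"
          then have "fst b * fst w \<le> 0" "snd b * snd w \<le> 0" using f by (simp_all add: mult_nonpos_nonneg)
          then show False using bw by (simp add: inner_prod_def)
        qed
        then have "2 * c * snd w < 0" using c_pos by (simp add: mult_pos_neg)
        then have "T w < B w" using sums by linarith
        then have "T w * B b \<le> B w * B b" using Bb by (intro mult_right_mono) simp_all
        also have "\<dots> \<le> B w * T b" using b TB by (intro mult_left_mono_neg) simp_all
        finally show ?thesis unfolding cross_prod_def by (simp add: mult.commute)
      qed
      \<comment> \<open>The addition theorem of the sine for the angles from y to b and from b to w.
        Both turns are counterclockwise, whereas an obstacle point w lies clockwise of y.\<close>
      have "(b \<bullet> b) * cross_prod y w = cross_prod y b * (b \<bullet> w) + (b \<bullet> y) * cross_prod b w"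
        by (simp add: cross_prod_cross inner_prod_def algebra_simps)
      also have "\<dots> \<ge> 0" using c1 c2 bw by0 by (intro add_nonneg_nonneg mult_nonneg_nonneg) simp_all
      finally have "0 \<le> (b \<bullet> b) * cross_prod y w" .
      moreover have "0 < b \<bullet> b" using gd(4) by simp
      ultimately have "0 \<le> cross_prod y w" by (metis not_le mult_pos_neg)
      moreover have "T y * B w \<le> 0" "0 < T w * B y" using yX y(2) TB by (simp_all add: mult_nonneg_nonpos mult_neg_neg)
      ultimately show False unfolding cross_prod_def by linarith
    qed
  qed
  have r: "0 + \<alpha> *\<^sub>R K \<in> C" if "avg (parallel_dir \<alpha> 0 b) t I K" for t I K
  proof -
    have "0 \<bullet> I + k * t \<le> b \<bullet> K" by (rule avgD[OF that]) (use UAC in simp)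
    moreover have "k * norm K \<le> k * t" using avg_norm(1)[OF that parallel_dir_norm[OF gd(1,4)]] k by simp
    ultimately have "k * norm K \<le> b \<bullet> K" by simp
    then have "\<alpha> * (k * norm K) \<le> \<alpha> * (b \<bullet> K)" using gd(1) by simp
    then show ?thesis using gd(1) by (simp add: C_def algebra_simps)
  qed
  have "\<exists>s0. local_law \<alpha> 0 b (parallel_dir \<alpha> 0 b) s0"
  proof (rule local_law_visible[OF g continuous_on_UA parallel_dir_norm[OF gd(1,4)] zero_less_one])
    fix t I K assume "avg (parallel_dir \<alpha> 0 b) t I K"
    then show "0 + \<alpha> *\<^sub>R K \<in> X" using r CX by blast
  next
    fix x t I K assume "x \<in> Bd \<alpha> 0 b" "avg (parallel_dir \<alpha> 0 b) t I K"
    then show "\<not> blocked x (0 + \<alpha> *\<^sub>R K)" using r BdC by (intro not_blocked_convex[OF cv CX])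
  qed simp_all
  then show ?thesis by blast
qed

lemma local_law_upper:
  assumes g: "good \<alpha> a b" and a: "0 \<le> T a" "B a \<le> 0" "a \<noteq> 0"
  shows "\<exists>U s0. local_law \<alpha> a b U s0"
proof (cases "\<exists>x0\<in>Bd \<alpha> a b. T x0 < 0 \<and> cross_prod a x0 \<le> 0")
  case True
  then show ?thesis using local_law_clamp[OF g a] local_law_to_vertex[OF g a] by blast
next
  case False
  show ?thesis
  proof (cases "0 < T a")
    case True
    show ?thesis by (rule local_law_no_shadow[OF g True a(2)]) (use False in \<open>meson not_le\<close>)
  next
    case F: False
    then have Ta: "T a = 0" using a by simp
    then have Ba: "B a < 0" using a TB_eq_0_iff[of a] by (metis order_le_less)
    show ?thesis
    proof (rule local_law_bounce[OF g norm_nT])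
      show "{w. 0 \<le> (- s, c) \<bullet> w} \<subseteq> X" unfolding T_inner[symmetric] by (auto simp: X_def simp del: split_paired_All)
      show "(- s, c) \<bullet> a = 0" using Ta by (simp only: T_inner)
      fix x assume x: "x \<in> Bd \<alpha> a b"
      have "0 \<le> T x"
      proof (rule ccontr)
        assume n: "\<not> 0 \<le> T x"
        then have "cross_prod a x \<le> 0" using Ta Ba by (simp add: cross_prod_def mult_nonpos_nonpos)
        then show False using False x n by (meson not_le)
      qed
      then show "0 \<le> (- s, c) \<bullet> x" by (simp only: T_inner)
    qed
  qed
qed

section \<open>Reflection in the axis of the corner\<close>

definition mirror :: "plane \<Rightarrow> plane" where "mirror z = (fst z, - snd z)"

lemma mirror_simps [simp]: "mirror (mirror z) = z" "T (mirror z) = B z" "B (mirror z) = T z" "mirror 0 = 0"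
  "mirror (x + y) = mirror x + mirror y" "mirror (x - y) = mirror x - mirror y" "mirror (k *\<^sub>R x) = k *\<^sub>R mirror x" "norm (mirror z) = norm z"
  "mirror x = mirror y \<longleftrightarrow> x = y"
  by (auto simp: mirror_def T_def B_def norm_prod_def prod_eq_iff)

lemma mirror_inner: "mirror x \<bullet> y = x \<bullet> mirror y"
  by (simp add: mirror_def inner_prod_def)

lemma mirror_X [simp]: "mirror z \<in> X \<longleftrightarrow> z \<in> X"
  by (auto simp: X_def)

lemma mirror_dl [simp]: "dl (mirror x) (mirror y) = dl x y"
proof -
  have "blocked (mirror x) (mirror y) = blocked x y"
    unfolding blocked_def mirror_simps mult.commute[of "B x" "T y"] mult.commute[of "B y" "T x"] by blast
  moreover have "dist (mirror x) (mirror y) = dist x y" unfolding dist_norm by (metis mirror_simps(6,8))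
  ultimately show ?thesis by (simp add: dl_def)
qed

lemma mirror_sgn: "mirror (sgn z) = sgn (mirror z)"
  by (simp add: sgn_div_norm)

lemma local_law_reflect:
  assumes "local_law \<alpha> (mirror a) (mirror b) U s0"
  shows "local_law \<alpha> a b (\<lambda>v. mirror (U (mirror v))) s0"
proof -
  let ?U = "\<lambda>v. mirror (U (mirror v))"
  have U: "0 < s0" "continuous_on (sphere 0 1) U" "\<And>v. norm v = 1 \<Longrightarrow> norm (U v) = 1"
    and L: "\<And>t I K. 0 \<le> t \<Longrightarrow> t \<le> s0 \<Longrightarrow> avg U t I K \<Longrightarrow> mirror a + \<alpha> *\<^sub>R K \<in> X \<and>
        (\<forall>x\<in>Bd \<alpha> (mirror a) (mirror b). dl x (mirror a + \<alpha> *\<^sub>R K) \<le> \<alpha> * norm (x - (mirror b + I)) \<and>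
           (dl x (mirror a + \<alpha> *\<^sub>R K) = \<alpha> * norm (x - (mirror b + I)) \<longrightarrow> I = t *\<^sub>R sgn (x - mirror b)))"
    using assms unfolding local_law_def by blast+
  have crfl: "continuous_on S mirror" for S unfolding mirror_def by (intro continuous_intros)
  have "mirror ` sphere 0 1 \<subseteq> sphere 0 1" by (auto simp: simp del: split_paired_All)
  then have "continuous_on (sphere 0 1) (U \<circ> mirror)" 
    by (intro continuous_on_compose crfl continuous_on_subset[OF U(2)])
  then have "continuous_on (sphere 0 1) (mirror \<circ> (U \<circ> mirror))" by (rule continuous_on_compose) (rule crfl)
  then have c: "continuous_on (sphere 0 1) ?U" by (simp add: comp_def)
  show ?thesis
    unfolding local_law_def
  proof (intro conjI allI impI U(1) c)
    fix v :: plane assume "norm v = 1" then show "norm (?U v) = 1" using U(3)[of "mirror v"] by simp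
  next
    fix t I K assume t: "0 \<le> t" "t \<le> s0" "avg ?U t I K"
    have "avg U t (mirror I) (mirror K)"
      unfolding avg_def
    proof (intro allI impI)
      fix w p k assume h: "\<forall>v. norm v = 1 \<longrightarrow> p \<bullet> v + k \<le> w \<bullet> U v"
      have "mirror p \<bullet> I + k * t \<le> mirror w \<bullet> K"
      proof (rule avgD[OF t(3)])
        fix v :: plane assume "norm v = 1"
        then have "p \<bullet> mirror v + k \<le> w \<bullet> U (mirror v)" using h by (metis mirror_simps(8))
        then show "mirror p \<bullet> v + k \<le> mirror w \<bullet> ?U v" by (simp add: mirror_inner)
      qed
      then show "p \<bullet> mirror I + k * t \<le> w \<bullet> mirror K" by (simp add: mirror_inner)
    qed
    note l = L[OF t(1,2) this]
    have e: "mirror a + \<alpha> *\<^sub>R mirror K = mirror (a + \<alpha> *\<^sub>R K)" by simp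
    show "a + \<alpha> *\<^sub>R K \<in> X" using l unfolding e mirror_X by blast
    show "\<forall>x\<in>Bd \<alpha> a b. dl x (a + \<alpha> *\<^sub>R K) \<le> \<alpha> * norm (x - (b + I)) \<and>
           (dl x (a + \<alpha> *\<^sub>R K) = \<alpha> * norm (x - (b + I)) \<longrightarrow> I = t *\<^sub>R sgn (x - b))"
    proof
      fix x assume "x \<in> Bd \<alpha> a b"
      then have "mirror x \<in> Bd \<alpha> (mirror a) (mirror b)" by (simp add: Bd_def)
      then have "dl (mirror x) (mirror (a + \<alpha> *\<^sub>R K)) \<le> \<alpha> * norm (mirror (x - (b + I))) \<and>
           (dl (mirror x) (mirror (a + \<alpha> *\<^sub>R K)) = \<alpha> * norm (mirror (x - (b + I))) \<longrightarrow> mirror I = mirror (t *\<^sub>R sgn (x - b)))"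
        using l unfolding e by (simp add: mirror_sgn)
      then show "dl x (a + \<alpha> *\<^sub>R K) \<le> \<alpha> * norm (x - (b + I)) \<and>
           (dl x (a + \<alpha> *\<^sub>R K) = \<alpha> * norm (x - (b + I)) \<longrightarrow> I = t *\<^sub>R sgn (x - b))"
        unfolding mirror_dl mirror_simps(8,9) .
    qed
  qed
qed

theorem local_law_exists:
  assumes g: "good \<alpha> a b" shows "\<exists>U s0. local_law \<alpha> a b U s0"
proof -
  have half: "\<exists>U s0. local_law \<alpha> a b U s0"
    if "good \<alpha> a b" "if a = 0 then T b \<le> B b else 0 \<le> T a \<and> (B a \<le> 0 \<or> 0 < T a \<and> 0 < B a)" for a b
  proof (cases "a = 0")
    case True
    then show ?thesis using that local_law_vertex[of \<alpha> b] by simp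
  next
    case False
    then have h: "0 \<le> T a" "B a \<le> 0 \<or> 0 < T a \<and> 0 < B a" using that(2) by simp_all
    from h(2) show ?thesis
    proof
      assume "B a \<le> 0" then show ?thesis by (rule local_law_upper[OF that(1) h(1) _ False])
    next
      assume "0 < T a \<and> 0 < B a" then show ?thesis using local_law_interior[OF that(1)] by blast
    qed
  qed
  have aX: "a \<in> X" using g by (rule goodD)
  consider "if a = 0 then T b \<le> B b else 0 \<le> T a \<and> (B a \<le> 0 \<or> 0 < T a \<and> 0 < B a)"
    | "if mirror a = 0 then T (mirror b) \<le> B (mirror b) else 0 \<le> T (mirror a) \<and> (B (mirror a) \<le> 0 \<or> 0 < T (mirror a) \<and> 0 < B (mirror a))"
  proof (cases "a = 0")
    case True
    then show ?thesis using that by (cases "T b \<le> B b") simp_all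
  next
    case False
    then have "mirror a \<noteq> 0" by (metis mirror_simps(1,4))
    moreover have "0 \<le> T a \<or> 0 \<le> B a" using aX by (simp add: X_def)
    then have "(0 \<le> T a \<and> (B a \<le> 0 \<or> 0 < T a \<and> 0 < B a)) \<or> (0 \<le> B a \<and> (T a \<le> 0 \<or> 0 < B a \<and> 0 < T a))"
      by linarith
    ultimately show ?thesis using that False by auto
  qed
  then show ?thesis
  proof cases
    case 1 then show ?thesis using half g by blast
  next
    case 2
    have "good \<alpha> (mirror a) (mirror b)" using g by (simp add: good_def)
    then show ?thesis using half[OF _ 2] local_law_reflect by blast
  qed
qed

subsection \<open>Nested dominance regions\<close>

lemma Dom_zero: "1 < \<alpha> \<Longrightarrow> Dom \<alpha> z z = {}"
proof -
  assume a: "1 < \<alpha>"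
  have "\<not> \<alpha> * dl y z < dl y z" for y using a mult_right_mono[of 1 \<alpha> "dl y z"] by simp
  then show ?thesis unfolding Dom_def by simp
qed

lemma Dom_segment:
  assumes a: "1 < \<alpha>" "a \<in> X" "b \<in> X" and x: "x \<in> Dom \<alpha> a b" "\<not> blocked b x" and z: "z \<in> closed_segment b x"
  shows "z \<in> Dom \<alpha> a b"
proof -
  have xX: "x \<in> X" using x(1) by (simp add: Dom_def)
  have sub: "closed_segment b x \<subseteq> X" by (rule not_blocked_segment[OF a(3) xX x(2)])
  then have zX: "z \<in> X" using z by (rule subsetD)
  have "closed_segment b z \<subseteq> X" "closed_segment z x \<subseteq> X"
    using z sub by (meson subset_closed_segment subset_trans ends_in_segment)+
  then have d: "dl z b = dist z b" "dl x z = dist x z"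
    using segment_iff[OF a(3) zX] segment_iff[OF zX xX] by (simp_all add: dl_unblocked dl_sym[of z b] dl_sym[of x z] dist_commute)
  have "dl x b = dist x b" using x(2) by (simp add: dl_sym[of x b] dl_unblocked dist_commute)
  moreover have e: "dist x b = dist z b + dist x z" using segment_between[OF z] by (simp add: dist_commute)
  moreover have "\<alpha> * dl x b < dl x a" using x(1) by (simp add: Dom_def)
  moreover have "dl x a \<le> dl x z + dl z a" by (rule dl_triangle[OF xX zX a(2)])
  ultimately have "\<alpha> * dl z b + (\<alpha> - 1) * dist x z < dl z a" unfolding d by (simp add: algebra_simps)
  moreover have "0 \<le> (\<alpha> - 1) * dist x z" using a(1) by simp
  ultimately have "\<alpha> * dl z b < dl z a" by linarith
  then show ?thesis using zX by (simp add: Dom_def)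
qed

lemma zero_notin_Dom: "good \<alpha> a b \<Longrightarrow> 0 \<notin> Dom \<alpha> a b"
  by (simp add: good_def Dom_def)

text \<open>A point of the new region visible from b' is joined to b' inside the new region, by
  star-shapedness. A segment leaving the old region would cross \<open>Bd\<close>, where the new
  region has no points. A hidden point of the new region would bring the visible vertex into it, and
  then into the old region, which excludes it.\<close>

lemma nested:
  assumes g: "good \<alpha> a b" and a': "a' \<in> X" and b': "b' \<in> Dom \<alpha> a b"
    and Bd: "\<And>x. x \<in> Bd \<alpha> a b \<Longrightarrow> dl x a' \<le> \<alpha> * dl x b'"
  shows "Dom \<alpha> a' b' \<subseteq> Dom \<alpha> a b"
proof
  note gd = goodD[OF g]
  have b'X: "b' \<in> X" using b' by (simp add: Dom_def)
  have un: "x \<in> Dom \<alpha> a b" if x: "x \<in> Dom \<alpha> a' b'" and nb: "\<not> blocked b' x" for x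
  proof (rule ccontr)
    assume n: "x \<notin> Dom \<alpha> a b"
    have xX: "x \<in> X" using x by (simp add: Dom_def)
    define f where "f t = dl (linepath b' x t) a - \<alpha> * dl (linepath b' x t) b" for t
    have sub: "closed_segment b' x \<subseteq> X" by (rule not_blocked_segment[OF b'X xX nb])
    have "path_image (linepath b' x) \<subseteq> X" using sub by simp
    then have im: "linepath b' x ` {0..1} \<subseteq> X" unfolding path_image_def .
    have "continuous_on {0..1} (\<lambda>t. dl (linepath b' x t) c)" if "c \<in> X" for c
      using continuous_on_compose2[OF continuous_on_dl[OF im that] continuous_on_linepath order_refl] .
    then have "continuous_on {0..1} f" unfolding f_def using gd by (intro continuous_intros) simp_all
    moreover have "f 1 \<le> 0" using n xX by (simp add: f_def linepath_def Dom_def)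
    moreover have "0 \<le> f 0" using b' by (simp add: f_def linepath_def Dom_def)
    ultimately obtain t where t: "0 \<le> t" "t \<le> 1" "f t = 0" using IVT2'[of f 1 0 0] by auto
    let ?z = "linepath b' x t"
    have zs: "?z \<in> closed_segment b' x" using t linepath_in_path[of t b' x] by simp
    then have "?z \<in> Bd \<alpha> a b" using t(3) sub by (auto simp: Bd_def f_def simp del: split_paired_All)
    then have "dl ?z a' \<le> \<alpha> * dl ?z b'" by (rule Bd)
    moreover have "?z \<in> Dom \<alpha> a' b'" by (rule Dom_segment[OF gd(1) a' b'X x nb zs])
    ultimately show False by (simp add: Dom_def)
  qed
  fix x assume x: "x \<in> Dom \<alpha> a' b'"
  show "x \<in> Dom \<alpha> a b"
  proof (cases "blocked b' x")
    case False then show ?thesis using un x by blast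
  next
    case True
    have "\<alpha> * dl x b' < dl x a'" using x by (simp add: Dom_def)
    moreover have "dl x b' = norm x + norm b'" using True blocked_sym[of b' x] by (simp add: dl_def)
    ultimately have "\<alpha> * norm x + \<alpha> * norm b' < norm x + norm a'" using dl_le_norms[of x a'] by (simp add: algebra_simps)
    moreover have "norm x \<le> \<alpha> * norm x" using gd(1) by (simp add: mult_le_cancel_right1)
    ultimately have "0 \<in> Dom \<alpha> a' b'" by (simp add: Dom_def)
    then have "0 \<in> Dom \<alpha> a b" by (rule un) simp
    then show ?thesis using zero_notin_Dom[OF g] by blast
  qed
qed

text \<open>In the borderline case \<open>norm a = \<alpha> * norm b\<close> a small step from the
  vertex towards b lowers the evader's weighted distance \<alpha> times as fast as the pursuer's
  distance can fall, so the region has points arbitrarily close to the vertex.\<close>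

lemma not_good_zero:
  assumes "1 < \<alpha>" "a \<in> X" "b \<in> X" "a \<noteq> b" "\<not> norm a < \<alpha> * norm b"
  shows "0 \<in> closure (Dom \<alpha> a b)"
proof (cases "\<alpha> * norm b < norm a")
  case True
  then have "0 \<in> Dom \<alpha> a b" by (simp add: Dom_def)
  then show ?thesis using closure_subset by blast
next
  case False
  then have eq: "norm a = \<alpha> * norm b" using assms(5) by simp
  have b0: "b \<noteq> 0" using eq assms(4) by force
  show ?thesis
    unfolding closure_approachable
  proof (intro allI impI)
    fix e :: real assume e: "0 < e"
    define k where "k = min (1/2) (e / (2 * norm b))"
    have k: "0 < k" "k < 1" using e b0 by (simp_all add: k_def)
    have "k \<le> e / (2 * norm b)" by (simp add: k_def)
    then have "k * (2 * norm b) \<le> e" using b0 by (simp add: pos_le_divide_eq)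
    moreover have "0 < k * norm b" using k b0 by simp
    ultimately have small: "k * norm b < e" by simp
    have "\<not> blocked (k *\<^sub>R b) b"
    proof -
      have "T (k *\<^sub>R b) * B b = T b * B (k *\<^sub>R b)" by simp
      then show ?thesis unfolding blocked_def by simp
    qed
    moreover have "dist (k *\<^sub>R b) b = (1 - k) * norm b"
    proof -
      have "b - k *\<^sub>R b = (1 - k) *\<^sub>R b" by (simp add: algebra_simps)
      then show ?thesis using k by (simp add: dist_norm norm_minus_commute[of _ b])
    qed
    ultimately have 1: "dl (k *\<^sub>R b) b = (1 - k) * norm b" by (simp add: dl_unblocked)
    have "norm a - k * norm b \<le> dl (k *\<^sub>R b) a"
    proof -
      have "norm a - norm (k *\<^sub>R b) \<le> dist (k *\<^sub>R b) a" using norm_triangle_ineq2[of a "k *\<^sub>R b"] by (simp add: dist_norm norm_minus_commute)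
      then show ?thesis using dl_ge_dist[of "k *\<^sub>R b" a] k by simp
    qed
    moreover have "1 * (k * norm b) < \<alpha> * (k * norm b)"
      using assms(1) \<open>0 < k * norm b\<close> by (rule mult_strict_right_mono)
    ultimately have "\<alpha> * dl (k *\<^sub>R b) b < dl (k *\<^sub>R b) a" unfolding 1 eq by (simp add: algebra_simps)
    then have "k *\<^sub>R b \<in> Dom \<alpha> a b" using scale_X[OF assms(3)] k by (simp add: Dom_def)
    moreover have "dist (k *\<^sub>R b) 0 < e" using small k by simp
    ultimately show "\<exists>y\<in>Dom \<alpha> a b. dist y 0 < e" by blast
  qed
qed

lemma good_zero:
  assumes "good \<alpha> a b" shows "0 \<notin> closure (Dom \<alpha> a b)"
proof
  note gd = goodD[OF assms]
  assume "0 \<in> closure (Dom \<alpha> a b)"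
  moreover have "0 < (\<alpha> * norm b - norm a) / (\<alpha> + 1)" using gd(1,5) by simp
  ultimately obtain z where z: "z \<in> Dom \<alpha> a b" "dist z 0 < (\<alpha> * norm b - norm a) / (\<alpha> + 1)"
    unfolding closure_approachable by blast
  have "norm z * (\<alpha> + 1) < \<alpha> * norm b - norm a" using z(2) gd(1) by (simp add: pos_less_divide_eq)
  moreover have "\<alpha> * dl z b < norm z + norm a" using z(1) dl_le_norms[of z a] by (simp add: Dom_def)
  moreover have "norm b - norm z \<le> dl z b"
    using dl_ge_dist[of z b] norm_triangle_ineq2[of b z] by (simp add: dist_norm norm_minus_commute)
  then have "\<alpha> * (norm b - norm z) \<le> \<alpha> * dl z b" using gd(1) by (intro mult_left_mono) simp_all
  ultimately show False by (simp add: algebra_simps)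
qed

lemma nested_good:
  assumes "good \<alpha> a b" "a' \<in> X" "b' \<in> X" "a' \<noteq> b'" "Dom \<alpha> a' b' \<subseteq> Dom \<alpha> a b"
  shows "good \<alpha> a' b'"
proof -
  have "norm a' < \<alpha> * norm b'"
  proof (rule ccontr)
    assume "\<not> norm a' < \<alpha> * norm b'"
    then have "0 \<in> closure (Dom \<alpha> a' b')" by (rule not_good_zero[OF goodD(1)[OF assms(1)] assms(2-4)])
    then show False using closure_mono[OF assms(5)] good_zero[OF assms(1)] by (metis subsetD)
  qed
  then show ?thesis using assms goodD(1)[OF assms(1)] by (simp add: good_def)
qed

lemma near_Dom:
  assumes "1 < \<alpha>" "a \<in> X" "b \<in> X" "z \<in> X" "dl b z < dl a b / (\<alpha> + 1)" shows "z \<in> Dom \<alpha> a b"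
proof -
  have "dl b z * (\<alpha> + 1) < dl a b" using assms by (simp add: pos_less_divide_eq)
  moreover have "dl a b \<le> dl a z + dl z b" by (rule dl_triangle[OF assms(2,4,3)])
  ultimately have "\<alpha> * dl z b < dl z a" by (simp add: dl_sym[of z b] dl_sym[of a z] algebra_simps)
  then show ?thesis using assms(4) by (simp add: Dom_def)
qed

lemma dl_pos: "a \<noteq> b \<Longrightarrow> 0 < dl a b"
  using dl_nonneg[of a b] by (metis dl_eq_0_iff order_le_less)

lemma local_move:
  assumes g: "good \<alpha> a b" and L: "local_law \<alpha> a b U e" and v: "norm v = 1" and t: "0 \<le> t" "t \<le> e"
  shows "a + \<alpha> *\<^sub>R (t *\<^sub>R U v) \<in> X" "dl a (a + \<alpha> *\<^sub>R (t *\<^sub>R U v)) \<le> \<alpha> * t"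
    "x \<in> Bd \<alpha> a b \<Longrightarrow> dl x (a + \<alpha> *\<^sub>R (t *\<^sub>R U v)) \<le> \<alpha> * norm (x - (b + t *\<^sub>R v))"
    "x \<in> Bd \<alpha> a b \<Longrightarrow> dl x (a + \<alpha> *\<^sub>R (t *\<^sub>R U v)) = \<alpha> * norm (x - (b + t *\<^sub>R v)) \<Longrightarrow> t *\<^sub>R v = t *\<^sub>R sgn (x - b)"
proof -
  note gd = goodD[OF g]
  have l: "a + \<alpha> *\<^sub>R (r *\<^sub>R U v) \<in> X \<and> (\<forall>x\<in>Bd \<alpha> a b. dl x (a + \<alpha> *\<^sub>R (r *\<^sub>R U v)) \<le> \<alpha> * norm (x - (b + r *\<^sub>R v)) \<and>
      (dl x (a + \<alpha> *\<^sub>R (r *\<^sub>R U v)) = \<alpha> * norm (x - (b + r *\<^sub>R v)) \<longrightarrow> r *\<^sub>R v = r *\<^sub>R sgn (x - b)))"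
    if "0 \<le> r" "r \<le> t" for r
  proof -
    have "r \<le> e" using that t by simp
    then show ?thesis using L avg_const[OF v that(1), of U] that(1) unfolding local_law_def by blast
  qed
  let ?a = "a + \<alpha> *\<^sub>R (t *\<^sub>R U v)"
  show aX: "?a \<in> X" using l[OF t(1) order_refl] by blast
  show "x \<in> Bd \<alpha> a b \<Longrightarrow> dl x (a + \<alpha> *\<^sub>R (t *\<^sub>R U v)) \<le> \<alpha> * norm (x - (b + t *\<^sub>R v))"
    "x \<in> Bd \<alpha> a b \<Longrightarrow> dl x (a + \<alpha> *\<^sub>R (t *\<^sub>R U v)) = \<alpha> * norm (x - (b + t *\<^sub>R v)) \<Longrightarrow> t *\<^sub>R v = t *\<^sub>R sgn (x - b)"
    using l[OF t(1) order_refl] by blast+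
  \<comment> \<open>The points in between are ends of shorter moves under the same law, so the
    segment is free and its length is the intrinsic distance.\<close>
  have "closed_segment a ?a \<subseteq> X"
  proof
    fix w assume "w \<in> closed_segment a ?a"
    then obtain u where u: "0 \<le> u" "u \<le> 1" "w = (1 - u) *\<^sub>R a + u *\<^sub>R ?a" unfolding in_segment by blast
    then have "w = a + \<alpha> *\<^sub>R ((u * t) *\<^sub>R U v)" by (simp add: algebra_simps)
    moreover have "0 \<le> u * t" "u * t \<le> t" using u t by (simp_all add: mult_left_le_one_le)
    ultimately show "w \<in> X" using l by simp
  qed
  then have "\<not> blocked a ?a" using segment_iff[OF gd(2) aX] by simp
  moreover have "norm (U v) = 1" using L v unfolding local_law_def by blast
  ultimately show "dl a ?a \<le> \<alpha> * t" using t gd(1) by (simp add: dl_unblocked dist_norm)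
qed

lemma local_step:
  assumes g: "good \<alpha> a b" and v: "norm v = 1"
  shows "\<exists>e>0. \<forall>t. 0 \<le> t \<longrightarrow> t \<le> e \<longrightarrow> b + t *\<^sub>R v \<in> Dom \<alpha> a b \<longrightarrow>
    (\<exists>a'\<in>X. dl a a' \<le> \<alpha> * t \<and> Dom \<alpha> a' (b + t *\<^sub>R v) \<subseteq> Dom \<alpha> a b)"
proof -
  note gd = goodD[OF g]
  obtain U e where L: "local_law \<alpha> a b U e" using local_law_exists[OF g] by blast
  show ?thesis
  proof (intro exI[of _ e] conjI allI impI)
    show "0 < e" using L by (simp add: local_law_def)
    fix t assume t: "0 \<le> t" "t \<le> e" "b + t *\<^sub>R v \<in> Dom \<alpha> a b"
    note lm = local_move[OF g L v t(1,2)]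
    let ?a = "a + \<alpha> *\<^sub>R (t *\<^sub>R U v)"
    have "Dom \<alpha> ?a (b + t *\<^sub>R v) \<subseteq> Dom \<alpha> a b"
    proof (rule nested[OF g lm(1) t(3)])
      fix x assume "x \<in> Bd \<alpha> a b"
      then have "dl x ?a \<le> \<alpha> * norm (x - (b + t *\<^sub>R v))" by (rule lm(3))
      also have "\<dots> \<le> \<alpha> * dl x (b + t *\<^sub>R v)" using gd(1) dl_ge_dist[of x "b + t *\<^sub>R v"] by (intro mult_left_mono) (simp_all add: dist_norm)
      finally show "dl x ?a \<le> \<alpha> * dl x (b + t *\<^sub>R v)" .
    qed
    then show "\<exists>a'\<in>X. dl a a' \<le> \<alpha> * t \<and> Dom \<alpha> a' (b + t *\<^sub>R v) \<subseteq> Dom \<alpha> a b" using lm by blast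
  qed
qed

text \<open>A one-point Kirszbraun extension, by continuous induction along the segment from b to b'.\<close>
lemma pursuit_step:
  assumes g: "good \<alpha> a b" and b': "b' \<in> Dom \<alpha> a b"
  shows "\<exists>a'\<in>X. dl a a' \<le> \<alpha> * dist b b' \<and> Dom \<alpha> a' b' \<subseteq> Dom \<alpha> a b"
proof (cases "b' = b")
  case True
  then show ?thesis using goodD[OF g] by (intro bexI[of _ a]) simp_all
next
  case False
  note gd = goodD[OF g]
  define L where "L = norm (b' - b)"
  define v where "v = sgn (b' - b)"
  define p where "p t = b + t *\<^sub>R v" for t
  have L: "0 < L" using False by (simp add: L_def)
  have v: "norm v = 1" using False by (simp add: v_def norm_sgn)
  have pL: "p L = b'" unfolding p_def v_def L_def using False by (simp add: sgn_div_norm)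
  have p_seg: "p t \<in> closed_segment b b'" if "0 \<le> t" "t \<le> L" for t
  proof -
    have "p t = (1 - t / L) *\<^sub>R b + (t / L) *\<^sub>R p L" using L by (simp add: p_def algebra_simps)
    then have "p t = (1 - t / L) *\<^sub>R b + (t / L) *\<^sub>R b'" by (simp only: pL)
    moreover have "0 \<le> t / L" "t / L \<le> 1" using that L by simp_all
    ultimately show ?thesis unfolding in_segment by blast
  qed
  have pD: "p t \<in> Dom \<alpha> a b" if "0 \<le> t" "t \<le> L" for t
    using Cl_segment(6)[OF g Dom_Cl[OF b'] p_seg[OF that]] b' by (cases "p t = b'") simp_all
  have pX: "p t \<in> X" if "0 \<le> t" "t \<le> L" for t using pD[OF that] by (simp add: Dom_def)
  have pp: "dist (p t) (p t') = \<bar>t - t'\<bar>" for t t'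
  proof -
    have "p t - p t' = (t - t') *\<^sub>R v" by (simp add: p_def algebra_simps)
    then show ?thesis using v by (simp add: dist_norm)
  qed
  \<comment> \<open>Only positions are recorded, not the controls leading to them: this makes the
    condition closed, and compactness of the reachable positions supplies the limit.\<close>
  define S where "S = {t \<in> {0..L}. \<exists>a'\<in>X. dl a a' \<le> \<alpha> * t \<and> Dom \<alpha> a' (p t) \<subseteq> Dom \<alpha> a b}"
  have S0: "0 \<in> S" unfolding S_def using L gd by (auto simp: p_def simp del: split_paired_Ex intro!: bexI[of _ a])
  have "closed S"
    unfolding closed_sequential_limits
  proof (intro allI impI, elim conjE)
    fix q l assume q: "\<forall>n. q n \<in> S" "q \<longlonglongrightarrow> l"
    have q1: "q n \<in> {0..L}" for n using q(1) by (simp add: S_def)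
    then have l: "l \<in> {0..L}" using closed_sequentially[OF closed_atLeastAtMost _ q(2)] by blast
    have "\<forall>n. \<exists>a'. a' \<in> X \<and> dl a a' \<le> \<alpha> * q n \<and> Dom \<alpha> a' (p (q n)) \<subseteq> Dom \<alpha> a b" using q(1) unfolding S_def by blast
    then obtain A where A: "\<And>n. A n \<in> X" "\<And>n. dl a (A n) \<le> \<alpha> * q n" "\<And>n. Dom \<alpha> (A n) (p (q n)) \<subseteq> Dom \<alpha> a b" by metis
    have "compact (cball a (\<alpha> * L) \<inter> X)" by (intro compact_Int_closed compact_cball closed_X)
    moreover have "A n \<in> cball a (\<alpha> * L) \<inter> X" for n
    proof -
      have "\<alpha> * q n \<le> \<alpha> * L" using q1[of n] gd(1) by simp
      then show ?thesis using A(1,2)[of n] dl_ge_dist[of a "A n"] by simp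
    qed
    ultimately obtain a' r where a': "a' \<in> cball a (\<alpha> * L) \<inter> X" and r: "strict_mono r" "(A \<circ> r) \<longlonglongrightarrow> a'"
      unfolding compact_def by blast
    have a'X: "a' \<in> X" using a' by simp
    have Ar: "(\<lambda>n. A (r n)) \<longlonglongrightarrow> a'" using r(2) by (simp add: comp_def)
    have qr: "(\<lambda>n. q (r n)) \<longlonglongrightarrow> l" using LIMSEQ_subseq_LIMSEQ[OF q(2) r(1)] by (simp add: comp_def)
    have pr: "(\<lambda>n. p (q (r n))) \<longlonglongrightarrow> p l" unfolding p_def by (intro tendsto_intros qr)
    have "(\<lambda>n. dl a (A (r n))) \<longlonglongrightarrow> dl a a'" by (intro tendsto_dl tendsto_const Ar gd a'X) (simp_all add: A(1) gd)
    moreover have "(\<lambda>n. \<alpha> * q (r n)) \<longlonglongrightarrow> \<alpha> * l" by (intro tendsto_intros qr)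
    ultimately have 1: "dl a a' \<le> \<alpha> * l" by (rule LIMSEQ_le) (use A(2) in blast)
    have "Dom \<alpha> a' (p l) \<subseteq> Dom \<alpha> a b"
    proof
      fix x assume x: "x \<in> Dom \<alpha> a' (p l)"
      then have xX: "x \<in> X" by (simp add: Dom_def)
      show "x \<in> Dom \<alpha> a b"
      proof (rule ccontr)
        assume n: "x \<notin> Dom \<alpha> a b"
        have pm: "p (q (r n)) \<in> X" for n using pX[of "q (r n)"] q1[of "r n"] by simp
        have plX: "p l \<in> X" using pX[of l] l by simp
        have "(\<lambda>n. dl x (A (r n))) \<longlonglongrightarrow> dl x a'" by (intro tendsto_dl tendsto_const Ar xX a'X) (simp_all add: A(1) xX)
        moreover have "(\<lambda>n. \<alpha> * dl x (p (q (r n)))) \<longlonglongrightarrow> \<alpha> * dl x (p l)"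
          by (intro tendsto_intros tendsto_dl pr xX plX) (simp_all add: pm xX)
        \<comment> \<open>For a fixed point outside the old region the inclusion amounts to a weak
          inequality, which passes to the limit.\<close>
        moreover have "dl x (A (r n)) \<le> \<alpha> * dl x (p (q (r n)))" for n
        proof -
          have "x \<notin> Dom \<alpha> (A (r n)) (p (q (r n)))" using A(3)[of "r n"] n by (rule contra_subsetD)
          then show ?thesis using xX by (simp add: Dom_def)
        qed
        ultimately have "dl x a' \<le> \<alpha> * dl x (p l)" by (intro LIMSEQ_le) blast+
        then show False using x by (simp add: Dom_def)
      qed
    qed
    then show "l \<in> S" unfolding S_def using 1 a'X l by blast
  qed
  moreover have bd: "bdd_above S" unfolding S_def by (intro bdd_aboveI[of _ L]) simp
  ultimately have "Sup S \<in> S" using S0 by (intro closed_contains_Sup) blast+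
  define m where "m = Sup S"
  have mS: "m \<in> S" unfolding m_def by fact
  have m: "0 \<le> m" "m \<le> L" using mS by (simp_all add: S_def)
  obtain a1 where a1: "a1 \<in> X" "dl a a1 \<le> \<alpha> * m" "Dom \<alpha> a1 (p m) \<subseteq> Dom \<alpha> a b" using mS unfolding S_def by blast
  have "m = L"
  proof (rule ccontr)
    assume "m \<noteq> L"
    then have mL: "m < L" using m by simp
    have "\<exists>h>0. m + h \<in> S"
    \<comment> \<open>After a capture the pursuer just accompanies the evader, and the region stays
      empty.\<close>
    proof (cases "a1 = p m")
      case True
      let ?h = "L - m"
      have "p L \<in> X" using pX[of L] L by simp
      have "\<not> blocked (p m) (p L)"
      proof -
        have "closed_segment (p m) (p L) \<subseteq> closed_segment b b'"
          unfolding subset_closed_segment using p_seg[of m] p_seg[of L] m L by simp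
        moreover have "closed_segment b b' \<subseteq> X"
          using not_blocked_segment[OF gd(3), of b'] Cl_unblocked(1)[OF g Dom_Cl[OF b']] b' blocked_sym by (simp add: Dom_def)
        ultimately have "closed_segment (p m) (p L) \<subseteq> X" by (rule subset_trans)
        then show ?thesis using segment_iff pX m L by (metis order_refl less_imp_le)
      qed
      then have "dl (p m) (p L) = L - m" using mL by (simp add: dl_unblocked pp)
      moreover have "dl a (p L) \<le> dl a (p m) + dl (p m) (p L)"
        by (rule dl_triangle[OF gd(2)]) (use pX m L \<open>p L \<in> X\<close> in simp_all)
      ultimately have "dl a (p L) \<le> \<alpha> * m + (L - m)" using a1(2) True by simp
      also have "\<dots> \<le> \<alpha> * m + \<alpha> * (L - m)" using gd(1) mL by simp
      finally have "dl a (p L) \<le> \<alpha> * L" by (simp add: algebra_simps)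
      then have "L \<in> S" unfolding S_def using Dom_zero[OF gd(1), of "p L"] \<open>p L \<in> X\<close> L
        by (intro CollectI conjI bexI[of _ "p L"]) simp_all
      then show ?thesis using mL by (intro exI[of _ ?h]) simp
    next
      case False
      have pmX: "p m \<in> X" using pX m by simp
      have g1: "good \<alpha> a1 (p m)" by (rule nested_good[OF g a1(1) pmX False a1(3)])
      obtain e where e: "0 < e" "\<And>t. 0 \<le> t \<Longrightarrow> t \<le> e \<Longrightarrow> p m + t *\<^sub>R v \<in> Dom \<alpha> a1 (p m) \<Longrightarrow>
          \<exists>a'\<in>X. dl a1 a' \<le> \<alpha> * t \<and> Dom \<alpha> a' (p m + t *\<^sub>R v) \<subseteq> Dom \<alpha> a1 (p m)"
        using local_step[OF g1 v] by blast
      define D where "D = dl a1 (p m) / (\<alpha> + 1)"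
      have D: "0 < D" using dl_pos[OF False] gd(1) by (simp add: D_def)
      define h where "h = min e (min (L - m) (D / 2))"
      have "0 < h" "h \<le> e" "h \<le> L - m" "h < D" using e(1) mL D by (simp_all add: h_def)
      then have h: "0 < h" "h \<le> e" "h \<le> L - m" "h < dl a1 (p m) / (\<alpha> + 1)" by (simp_all only: D_def)
      have pe: "p m + h *\<^sub>R v = p (m + h)" by (simp add: p_def algebra_simps)
      have phX: "p (m + h) \<in> X" using pX[of "m + h"] m h by simp
      have "closed_segment (p m) (p (m + h)) \<subseteq> closed_segment b b'"
        unfolding subset_closed_segment using p_seg[of m] p_seg[of "m + h"] m h by simp
      moreover have "closed_segment b b' \<subseteq> X"
        using not_blocked_segment[OF gd(3), of b'] Cl_unblocked(1)[OF g Dom_Cl[OF b']] b' blocked_sym by (simp add: Dom_def)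
      ultimately have "closed_segment (p m) (p (m + h)) \<subseteq> X" by (rule subset_trans)
      then have "\<not> blocked (p m) (p (m + h))" using segment_iff[OF pmX phX] by simp
      then have "dl (p m) (p (m + h)) < dl a1 (p m) / (\<alpha> + 1)" using h by (simp add: dl_unblocked pp)
      then have "p (m + h) \<in> Dom \<alpha> a1 (p m)" by (rule near_Dom[OF gd(1) a1(1) pmX phX])
      then obtain a2 where a2: "a2 \<in> X" "dl a1 a2 \<le> \<alpha> * h" "Dom \<alpha> a2 (p (m + h)) \<subseteq> Dom \<alpha> a1 (p m)"
        using e(2)[of h] h unfolding pe by (meson less_imp_le)
      have "dl a a2 \<le> dl a a1 + dl a1 a2" by (rule dl_triangle[OF gd(2) a1(1) a2(1)])
      then have "dl a a2 \<le> \<alpha> * (m + h)" using a1(2) a2(2) by (simp add: distrib_left)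
      moreover have "Dom \<alpha> a2 (p (m + h)) \<subseteq> Dom \<alpha> a b" using a2(3) a1(3) by (rule subset_trans)
      ultimately have "m + h \<in> S" unfolding S_def using a2(1) m h by (intro CollectI conjI bexI[of _ a2]) simp_all
      then show ?thesis using h by blast
    qed
    then obtain h where "0 < h" "m + h \<in> S" by blast
    then have "m + h \<le> m" unfolding m_def using bd by (intro cSup_upper)
    then show False using \<open>0 < h\<close> by simp
  qed
  then show ?thesis using a1 pL by (simp add: L_def dist_norm norm_minus_commute[of b b']) blast
qed

subsection \<open>Straight runs\<close>

text \<open>The equality case of the triangle inequality.\<close>

lemma point_on_segment:
  fixes a x y :: plane
  assumes "norm (y - a) \<le> p" "norm (x - y) \<le> q" "norm (x - a) = p + q" "x \<noteq> a"
  shows "y = a + p *\<^sub>R sgn (x - a)"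
proof -
  let ?w = "sgn (x - a)"
  have w: "norm ?w = 1" using assms(4) by (simp add: norm_sgn)
  have "?w \<bullet> (x - a) = norm (x - a)" using assms(4) by (simp add: sgn_div_norm dot_square_norm power2_eq_square)
  moreover have "?w \<bullet> (x - a) = ?w \<bullet> (x - y) + ?w \<bullet> (y - a)" by (simp add: inner_diff_right)
  moreover have "?w \<bullet> (x - y) \<le> q" using norm_cauchy_schwarz[of ?w "x - y"] w assms(2) by simp
  moreover have "?w \<bullet> (y - a) \<le> p" using norm_cauchy_schwarz[of ?w "y - a"] w assms(1) by simp
  ultimately have "?w \<bullet> (y - a) = p" using assms(3) by linarith
  then have "y - a = p *\<^sub>R ?w" by (rule full_speed_straight[OF w assms(1)])
  then show ?thesis by (simp add: algebra_simps)
qed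

lemma straight_points:
  assumes g: "good \<alpha> a b" and x: "x \<in> Bd \<alpha> a b" and t: "0 \<le> t" "t < norm (x - b)"
  shows "b + t *\<^sub>R sgn (x - b) \<in> Dom \<alpha> a b" "dl x (b + t *\<^sub>R sgn (x - b)) = norm (x - b) - t"
    "dist b (b + t *\<^sub>R sgn (x - b)) = t"
proof -
  note bf = Bd_facts[OF g x]
  let ?z = "b + t *\<^sub>R sgn (x - b)"
  have e: "?z = b + (t / norm (x - b)) *\<^sub>R (x - b)" using bf(1) by (simp add: sgn_div_norm divide_inverse)
  then have "?z = (1 - t / norm (x - b)) *\<^sub>R b + (t / norm (x - b)) *\<^sub>R x" by (simp add: algebra_simps)
  moreover have "0 \<le> t / norm (x - b)" "t / norm (x - b) \<le> 1" using t by (simp_all add: divide_le_eq_1)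
  ultimately have z: "?z \<in> closed_segment b x" unfolding in_segment by blast
  note zs = Cl_segment[OF g Bd_Cl[OF x] z]
  show d: "dist b ?z = t" using t bf(5) by (simp add: dist_norm)
  have s: "dist b x = dist b ?z + dist ?z x" by (rule segment_between[OF z])
  have "dl x ?z = dist x ?z" by (rule dl_unblocked[OF zs(3)])
  then show "dl x ?z = norm (x - b) - t" using s d by (simp add: dist_norm norm_minus_commute)
  have "?z \<noteq> x"
  proof
    assume "?z = x"
    then show False using d t(2) by (simp add: dist_norm norm_minus_commute)
  qed
  then show "?z \<in> Dom \<alpha> a b" by (rule zs(6))
qed

text \<open>It suffices that y is within \<open>norm a - p\<close> of the vertex
  (\<open>fin\<close>). This is immediate if y is hidden from a or from x. Otherwise the polygon a,
  y, x meets the ray opposite to a, and being no longer than the way through the vertex it can meet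
  it only at the vertex.\<close>

lemma geodesic_unique:
  assumes X: "a \<in> X" "x \<in> X" "y \<in> X" and bl: "blocked a x" and p: "p \<le> norm a"
    and d: "dl a y \<le> p" "dl y x \<le> norm a + norm x - p"
  shows "y = a + p *\<^sub>R sgn (- a)"
proof -
  have a0: "a \<noteq> 0" using bl by auto
  have fin: ?thesis if "norm y \<le> norm a - p"
  proof -
    have "norm (y - a) \<le> p" using d(1) dl_ge_dist[of a y] by (simp add: dist_norm norm_minus_commute)
    then show ?thesis using point_on_segment[of y a p 0 "norm a - p"] that a0 by simp
  qed
  show ?thesis
  proof (cases "blocked y x")
    case True
    then show ?thesis using d(2) by (intro fin) (simp add: dl_def)
  next
    case nb: False
    show ?thesis
    proof (cases "blocked a y")
      case True
      then show ?thesis using d(1) p by (intro fin) (simp add: dl_def)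
    next
      case False
      let ?g = "linepath a y +++ linepath y x"
      have im: "path_image ?g \<subseteq> X"
        using not_blocked_segment[OF X(1,3) False] not_blocked_segment[OF X(3,2) nb] by (simp add: path_image_join)
      have "path ?g" by simp
      then have c: "continuous_on {0..1} ?g" unfolding path_def .
      have g01: "?g 0 = a" "?g 1 = x" by (simp_all add: joinpaths_def linepath_def)
      obtain t l where t: "t \<in> {0..1}" "l \<le> 0" "?g t = l *\<^sub>R ?g 0"
        using path_crosses_opposite_ray[OF c _ zero_le_one] im bl unfolding g01 path_image_def by blast
      define w where "w = l *\<^sub>R a"
      have "w \<in> path_image ?g" using t unfolding path_image_def w_def g01 by (metis imageI)
      then have wor: "w \<in> closed_segment a y \<or> w \<in> closed_segment y x" by (simp add: path_image_join)
      have aw: "dist a w = norm a + norm w" unfolding w_def by (rule norm_opposite[OF t(2)])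
      have da: "dist a y \<le> p" using d(1) dl_ge_dist[of a y] by simp
      from wor show ?thesis
      proof
        assume "w \<in> closed_segment a y"
        then have "dist a y = dist a w + dist w y" by (rule segment_between)
        then have "norm a + norm w + dist w y \<le> norm a" using aw da p by simp
        then have "norm w + dist w y \<le> 0" by simp
        then have "norm w = 0" "dist w y = 0" using zero_le_dist[of w y] norm_ge_zero[of w] by linarith+
        then show ?thesis using p by (intro fin) simp
      next
        assume w: "w \<in> closed_segment y x"
        have yx: "dist y x = dist y w + dist w x" by (rule segment_between[OF w])
        have "dist y x \<le> norm a + norm x - p" using d(2) dl_ge_dist[of y x] by simp
        then have wx: "norm (x - w) \<le> norm x - norm w"
          using yx aw da dist_triangle[of a w y] by (simp add: dist_norm norm_minus_commute)
        have x0: "x \<noteq> 0" using bl by auto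
        \<comment> \<open>w is on the segment from the vertex to x as well as on the line through a.
          As a and x have a nonzero cross product, only the vertex is on both.\<close>
        have "w = 0 + norm w *\<^sub>R sgn (x - 0)" using wx x0 by (intro point_on_segment[where q = "norm x - norm w"]) simp_all
        then have "w = (norm w / norm x) *\<^sub>R x" by (simp add: sgn_div_norm divide_inverse)
        then have "cross_prod a w = (norm w / norm x) * cross_prod a x" by (metis cross_prod_simps(3))
        moreover have "cross_prod a w = 0" by (simp add: w_def)
        moreover have "cross_prod a x \<noteq> 0" using bl by (auto simp: blocked_def cross_prod_def)
        ultimately have "w = 0" using x0 by simp
        then show ?thesis using yx d(2) dl_ge_dist[of y x] by (intro fin) simp
      qed
    qed
  qed
qed

definition aim :: "plane \<Rightarrow> plane \<Rightarrow> plane" where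
  "aim a x = (if blocked x a then sgn (- a) else sgn (x - a))"

text \<open>The time for the first straight piece of the pursuer's geodesic to a boundary point x:
  up to the vertex if x is hidden, otherwise up to x itself, where both players arrive
  simultaneously.\<close>

definition run_length :: "real \<Rightarrow> plane \<Rightarrow> plane \<Rightarrow> plane \<Rightarrow> real" where
  "run_length \<alpha> a b x = (if blocked x a then norm a / \<alpha> else norm (x - b))"

lemma aim_norm:
  assumes "good \<alpha> a b" "x \<in> Bd \<alpha> a b" shows "norm (aim a x) = 1"
proof -
  have "x \<noteq> a" using Bd_facts(1,4)[OF assms] goodD(1)[OF assms(1)] by force
  moreover have "a \<noteq> 0" if "blocked x a" using that by auto
  ultimately show ?thesis by (simp add: aim_def norm_sgn)
qed

lemma run_length_le:
  assumes g: "good \<alpha> a b" and x: "x \<in> Bd \<alpha> a b"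
  shows "0 < run_length \<alpha> a b x" "run_length \<alpha> a b x \<le> norm (x - b)" "blocked x a \<Longrightarrow> run_length \<alpha> a b x < norm (x - b)"
proof -
  note gd = goodD[OF g] and bf = Bd_facts[OF g x]
  show bl: "run_length \<alpha> a b x < norm (x - b)" if b: "blocked x a"
  proof -
    have "\<alpha> * norm (x - b) = norm x + norm a" using bf(4) b by (simp add: dl_def)
    moreover have "x \<noteq> 0" using b by auto
    ultimately have "norm a < norm (x - b) * \<alpha>" by (simp add: mult.commute)
    then show ?thesis using b gd(1) by (simp add: run_length_def pos_divide_less_eq)
  qed
  then show "run_length \<alpha> a b x \<le> norm (x - b)" by (cases "blocked x a") (simp_all add: run_length_def)
  have "a \<noteq> 0" if "blocked x a" using that by auto
  then show "0 < run_length \<alpha> a b x" using bf(1) gd(1) by (simp add: run_length_def)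
qed

lemma straight_unique:
  assumes g: "good \<alpha> a b" and x: "x \<in> Bd \<alpha> a b" and t: "0 \<le> t" "t \<le> run_length \<alpha> a b x"
    and a': "a' \<in> X" "dl a a' \<le> \<alpha> * t" "dl x a' \<le> \<alpha> * (norm (x - b) - t)"
  shows "a' = a + (\<alpha> * t) *\<^sub>R aim a x"
proof -
  note gd = goodD[OF g] and bf = Bd_facts[OF g x]
  have xX: "x \<in> X" by (rule Cl_X[OF Bd_Cl[OF x]])
  show ?thesis
  proof (cases "blocked x a")
    case False
    have "norm (x - a') \<le> \<alpha> * norm (x - b) - \<alpha> * t"
      using a'(3) dl_ge_dist[of x a'] by (simp add: dist_norm algebra_simps)
    moreover have "norm (a' - a) \<le> \<alpha> * t" using a'(2) dl_ge_dist[of a a'] by (simp add: dist_norm norm_minus_commute)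
    moreover have "norm (x - a) = \<alpha> * t + (\<alpha> * norm (x - b) - \<alpha> * t)"
      using bf(4) dl_unblocked[OF False] by (simp add: dist_norm)
    moreover have "x \<noteq> a" using bf(1,4) gd(1) by force
    ultimately show ?thesis using False unfolding aim_def by (simp only: if_False) (rule point_on_segment)
  next
    case True
    have xa: "\<alpha> * norm (x - b) = norm x + norm a" using bf(4) True by (simp add: dl_def)
    have at: "\<alpha> * t \<le> norm a" using t(2) True gd(1) by (simp add: run_length_def pos_le_divide_eq mult.commute)
    have "dl a' x \<le> norm a + norm x - \<alpha> * t" using a'(3) xa by (simp add: dl_sym[of a'] algebra_simps)
    moreover have "blocked a x" using True blocked_sym by blast
    ultimately have "a' = a + (\<alpha> * t) *\<^sub>R sgn (- a)"
      by (intro geodesic_unique[OF gd(2) xX a'(1) _ at a'(2)])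
    then show ?thesis using True by (simp add: aim_def)
  qed
qed

text \<open>\<open>pursuit_step\<close> supplies some reply with nested regions. Such a reply still
  guards x, and by \<open>straight_unique\<close> this forces it to be the run along the geodesic.
  The explicit run thus inherits the inclusion without any computation.\<close>

lemma straight_run:
  assumes g: "good \<alpha> a b" and x: "x \<in> Bd \<alpha> a b" and t: "0 \<le> t" "t \<le> run_length \<alpha> a b x" "t < norm (x - b)"
  shows "a + (\<alpha> * t) *\<^sub>R aim a x \<in> X"
    "Dom \<alpha> (a + (\<alpha> * t) *\<^sub>R aim a x) (b + t *\<^sub>R sgn (x - b)) \<subseteq> Dom \<alpha> a b"
proof -
  note gd = goodD[OF g] and sp = straight_points[OF g x t(1) t(3)]
  obtain a' where a': "a' \<in> X" "dl a a' \<le> \<alpha> * t" "Dom \<alpha> a' (b + t *\<^sub>R sgn (x - b)) \<subseteq> Dom \<alpha> a b"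
    using pursuit_step[OF g sp(1)] unfolding sp(3) by blast
  have xX: "x \<notin> Dom \<alpha> a b" "x \<in> X" using x by (simp_all add: Dom_def Bd_def)
  then have "x \<notin> Dom \<alpha> a' (b + t *\<^sub>R sgn (x - b))" using a'(3) by (metis subsetD)
  then have "dl x a' \<le> \<alpha> * (norm (x - b) - t)" using xX(2) unfolding sp(2)[symmetric] by (simp add: Dom_def)
  then have "a' = a + (\<alpha> * t) *\<^sub>R aim a x" by (rule straight_unique[OF g x t(1,2) a'(1,2)])
  then show "a + (\<alpha> * t) *\<^sub>R aim a x \<in> X"
    "Dom \<alpha> (a + (\<alpha> * t) *\<^sub>R aim a x) (b + t *\<^sub>R sgn (x - b)) \<subseteq> Dom \<alpha> a b" using a' by simp_all
qed

lemma sgn_scale: "0 < k \<Longrightarrow> sgn (k *\<^sub>R (z::plane)) = sgn z"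
  by (simp add: sgn_div_norm)

lemma sgn_sgn_plane [simp]: "sgn (sgn (z::plane)) = sgn z"
  by (cases "z = 0") (simp_all add: sgn_div_norm)

text \<open>A run can be restarted at any moment with the same target and the remaining duration.
  The end of the run is excluded because there the players meet or x comes into view at the vertex
  and the aim changes.\<close>

lemma straight_state:
  assumes g: "good \<alpha> a b" and x: "x \<in> Bd \<alpha> a b" and t: "0 \<le> t" "t < run_length \<alpha> a b x"
  defines "a' \<equiv> a + (\<alpha> * t) *\<^sub>R aim a x" and "b' \<equiv> b + t *\<^sub>R sgn (x - b)"
  shows "good \<alpha> a' b'" "x \<in> Bd \<alpha> a' b'" "aim a' x = aim a x" "sgn (x - b') = sgn (x - b)"
    "norm (x - b') = norm (x - b) - t" "run_length \<alpha> a' b' x = run_length \<alpha> a b x - t"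
proof -
  note gd = goodD[OF g] and bf = Bd_facts[OF g x] and rl = run_length_le[OF g x]
  have tl: "t < norm (x - b)" using t(2) rl(2) by linarith
  note sp = straight_points[OF g x t(1) tl] and sr = straight_run[OF g x t(1) less_imp_le[OF t(2)] tl]
  have xX: "x \<in> X" by (rule Cl_X[OF Bd_Cl[OF x]])
  have a'X: "a' \<in> X" and b'X: "b' \<in> X" using sr(1) sp(1) by (simp_all add: a'_def b'_def Dom_def)
  have xb': "x - b' = (norm (x - b) - t) *\<^sub>R sgn (x - b)"
    unfolding b'_def using bf(6) by (simp add: algebra_simps)
  then show nb: "norm (x - b') = norm (x - b) - t" using bf(5) tl by simp
  show "sgn (x - b') = sgn (x - b)" unfolding xb' using tl by (simp add: sgn_scale)
  have db: "dl x b' = norm (x - b) - t" unfolding b'_def by (rule sp(2))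
  have "dl x a' = \<alpha> * (norm (x - b) - t) \<and> aim a' x = aim a x \<and> run_length \<alpha> a' b' x = run_length \<alpha> a b x - t"
  proof (cases "blocked x a")
    case False
    have xa: "norm (x - a) = \<alpha> * norm (x - b)" using bf(4) dl_unblocked[OF False] by (simp add: dist_norm)
    have x0: "x \<noteq> a" using bf(1) xa gd(1) by force
    then have "x - a = norm (x - a) *\<^sub>R sgn (x - a)" by (simp add: sgn_div_norm)
    then have e: "x - a' = (\<alpha> * (norm (x - b) - t)) *\<^sub>R sgn (x - a)"
      unfolding a'_def aim_def xa using False by (simp add: algebra_simps)
    have "a' = (1 - t / norm (x - b)) *\<^sub>R a + (t / norm (x - b)) *\<^sub>R x"
    proof -
      have "(\<alpha> * t) *\<^sub>R sgn (x - a) = (t / norm (x - b)) *\<^sub>R (x - a)"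
        using x0 bf(1) gd(1) by (simp add: sgn_div_norm xa divide_inverse)
      then show ?thesis unfolding a'_def aim_def using False by (simp add: algebra_simps)
    qed
    moreover have "0 \<le> t / norm (x - b)" "t / norm (x - b) \<le> 1" using t tl by (simp_all add: divide_le_eq_1)
    ultimately have seg: "a' \<in> closed_segment a x" unfolding in_segment by blast
    have "closed_segment a x \<subseteq> X" using not_blocked_segment[OF xX gd(2) False] by (simp add: closed_segment_commute)
    moreover have "closed_segment x a' \<subseteq> closed_segment a x" using seg by (simp add: subset_closed_segment)
    ultimately have nbl: "\<not> blocked x a'" using segment_iff[OF xX a'X] by (meson subset_trans)
    have pos: "0 < \<alpha> * (norm (x - b) - t)" using gd(1) tl by simp
    have "dl x a' = \<alpha> * (norm (x - b) - t)"
      unfolding dl_unblocked[OF nbl] dist_norm e using x0 pos by (simp add: norm_sgn)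
    moreover have "aim a' x = aim a x" unfolding aim_def e using nbl False pos by (simp add: sgn_scale)
    moreover have "run_length \<alpha> a' b' x = run_length \<alpha> a b x - t" using nbl False nb by (simp add: run_length_def)
    ultimately show ?thesis by blast
  next
    case True
    have a0: "a \<noteq> 0" using True by auto
    have at: "\<alpha> * t < norm a" using t(2) True gd(1) by (simp add: run_length_def pos_less_divide_eq mult.commute)
    define k where "k = 1 - \<alpha> * t / norm a"
    have k: "0 < k" using at a0 by (simp add: k_def)
    have e: "a' = k *\<^sub>R a" unfolding a'_def aim_def k_def using True by (simp add: sgn_div_norm algebra_simps divide_inverse)
    have "norm a' = k * norm a" unfolding e using k by simp
    then have nk: "norm a' = norm a - \<alpha> * t" using a0 by (simp add: k_def left_diff_distrib)
    have "blocked x a' = blocked x a"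
    proof -
      have "(k * p < 0) = (p < 0)" for p using k by (simp add: mult_less_0_iff)
      moreover have "(T x * (k * B a) < k * T a * B x) = (T x * B a < T a * B x)"
        "(k * T a * B x < T x * (k * B a)) = (T a * B x < T x * B a)" using k by (simp_all add: mult.left_commute mult.assoc)
      ultimately show ?thesis unfolding e blocked_def by simp
    qed
    then have bl: "blocked x a'" using True by simp
    have xa: "\<alpha> * norm (x - b) = norm x + norm a" using bf(4) True by (simp add: dl_def)
    have "dl x a' = \<alpha> * (norm (x - b) - t)" using bl nk xa by (simp add: dl_def algebra_simps)
    moreover have "aim a' x = aim a x" using bl True k sgn_scale[OF k, of "- a"] by (simp add: aim_def e)
    moreover have "run_length \<alpha> a' b' x = run_length \<alpha> a b x - t" using bl True nk gd(1) by (simp add: run_length_def diff_divide_distrib)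
    ultimately show ?thesis by blast
  qed
  then have da: "dl x a' = \<alpha> * (norm (x - b) - t)" and "aim a' x = aim a x" "run_length \<alpha> a' b' x = run_length \<alpha> a b x - t" by blast+
  then show "aim a' x = aim a x" "run_length \<alpha> a' b' x = run_length \<alpha> a b x - t" by blast+
  show "x \<in> Bd \<alpha> a' b'" using xX da db by (simp add: Bd_def)
  have "dl x a' \<noteq> dl x b'" using da db gd(1) tl by simp
  then have "a' \<noteq> b'" by blast
  then show "good \<alpha> a' b'" by (rule nested_good[OF g a'X b'X]) (use sr(2) in \<open>simp only: a'_def b'_def\<close>)
qed

lemma Bd_ray_unique:
  assumes g: "good \<alpha> a b" and x: "x \<in> Bd \<alpha> a b" and z: "z \<in> Bd \<alpha> a b" and eq: "sgn (z - b) = sgn (x - b)"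
  shows "z = x"
proof -
  have le: "norm (x - b) \<le> norm (z - b)" if "x \<in> Bd \<alpha> a b" "z \<in> Bd \<alpha> a b" "sgn (z - b) = sgn (x - b)" for x z
  proof (rule ccontr)
    assume n: "\<not> norm (x - b) \<le> norm (z - b)"
    have "b + norm (z - b) *\<^sub>R sgn (x - b) \<in> Dom \<alpha> a b" by (rule straight_points(1)[OF g that(1)]) (use n in simp_all)
    moreover have "b + norm (z - b) *\<^sub>R sgn (x - b) = z" using Bd_facts(6)[OF g that(2)] that(3) by (simp add: algebra_simps)
    ultimately show False using that(2) by (simp add: Dom_def Bd_def)
  qed
  have "norm (x - b) = norm (z - b)" using le[OF x z eq] le[OF z x eq[symmetric]] by simp
  then have "x - b = z - b" using Bd_facts(6)[OF g x] Bd_facts(6)[OF g z] eq by metis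
  then show ?thesis by simp
qed

text \<open>Against an evader running at x a local law is forced, by \<open>straight_unique\<close>,
  to reply with the geodesic run. Its equality clause then leaves every boundary point in another
  direction strictly guarded.\<close>

lemma strict_start:
  assumes g: "good \<alpha> a b" and x: "x \<in> Bd \<alpha> a b"
  shows "\<exists>e>0. \<forall>t. 0 < t \<longrightarrow> t \<le> e \<longrightarrow> (\<forall>z\<in>Bd \<alpha> a b. z \<noteq> x \<longrightarrow>
    dl z (a + (\<alpha> * t) *\<^sub>R aim a x) < \<alpha> * norm (z - (b + t *\<^sub>R sgn (x - b))))"
proof -
  note gd = goodD[OF g] and bf = Bd_facts[OF g x] and rl = run_length_le[OF g x]
  obtain U e where L: "local_law \<alpha> a b U e" using local_law_exists[OF g] by blast
  show ?thesis
  proof (intro exI[of _ "min e (run_length \<alpha> a b x)"] conjI allI impI ballI)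
    show "0 < min e (run_length \<alpha> a b x)" using L rl(1) by (simp add: local_law_def)
    fix t z assume t: "0 < t" "t \<le> min e (run_length \<alpha> a b x)" and z: "z \<in> Bd \<alpha> a b" "z \<noteq> x"
    have t': "0 \<le> t" "t \<le> e" "t \<le> run_length \<alpha> a b x" using t by simp_all
    note lm = local_move[OF g L bf(5) t'(1,2)]
    have "norm (x - (b + t *\<^sub>R sgn (x - b))) = norm (x - b) - t"
    proof -
      have "x - (b + t *\<^sub>R sgn (x - b)) = (norm (x - b) - t) *\<^sub>R sgn (x - b)" using bf(6) by (simp add: algebra_simps)
      then show ?thesis using bf(5) t'(3) rl(2) by simp
    qed
    then have "dl x (a + \<alpha> *\<^sub>R (t *\<^sub>R U (sgn (x - b)))) \<le> \<alpha> * (norm (x - b) - t)" using lm(3)[OF x] by simp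
    then have e: "a + \<alpha> *\<^sub>R (t *\<^sub>R U (sgn (x - b))) = a + (\<alpha> * t) *\<^sub>R aim a x"
      by (rule straight_unique[OF g x t'(1,3) lm(1,2)])
    have "t *\<^sub>R sgn (x - b) \<noteq> t *\<^sub>R sgn (z - b)" using Bd_ray_unique[OF g x z(1)] z(2) t(1) by auto
    then show "dl z (a + (\<alpha> * t) *\<^sub>R aim a x) < \<alpha> * norm (z - (b + t *\<^sub>R sgn (x - b)))"
      using lm(3)[OF z(1)] lm(4)[OF z(1)] unfolding e by (meson order_le_less)
  qed
qed

text \<open>By \<open>Cl_segment\<close> the points of the smaller closed region are limits, along
  segments from b', of points of the smaller open one, and the inequality of the larger region
  passes to the limit.\<close>

lemma Cl_mono:
  assumes g: "good \<alpha> a b" and g': "good \<alpha> a' b'" and sub: "Dom \<alpha> a' b' \<subseteq> Dom \<alpha> a b"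
  shows "Cl \<alpha> a' b' \<subseteq> Cl \<alpha> a b"
proof
  note gd = goodD[OF g] and gd' = goodD[OF g']
  fix z assume z: "z \<in> Cl \<alpha> a' b'"
  have zX: "z \<in> X" by (rule Cl_X[OF z])
  show "z \<in> Cl \<alpha> a b"
  proof (cases "z = b'")
    case True
    have "b' \<in> Dom \<alpha> a' b'" using gd' dl_pos[of b' a'] by (simp add: Dom_def)
    then show ?thesis using sub True Dom_Cl by (metis subsetD)
  next
    case False
    define w where "w n = (1 - (1 - 1 / real (Suc n))) *\<^sub>R b' + (1 - 1 / real (Suc n)) *\<^sub>R z" for n
    have inv: "(\<lambda>n. 1 / real (Suc n)) \<longlonglongrightarrow> 0" using LIMSEQ_inverse_real_of_nat by (simp add: inverse_eq_divide)
    have "w \<longlonglongrightarrow> (1 - (1 - 0)) *\<^sub>R b' + (1 - 0) *\<^sub>R z" unfolding w_def by (intro tendsto_intros inv)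
    then have wz: "w \<longlonglongrightarrow> z" by simp
    have wD: "w n \<in> Dom \<alpha> a b" for n
    proof -
      have "w n \<in> closed_segment b' z" unfolding w_def in_segment by (intro exI[of _ "1 - 1 / real (Suc n)"]) simp
      moreover have "w n \<noteq> z"
      proof
        assume "w n = z"
        then have "(1 / real (Suc n)) *\<^sub>R (b' - z) = 0" by (simp add: w_def algebra_simps)
        then show False using False by simp
      qed
      ultimately have "w n \<in> Dom \<alpha> a' b'" by (rule Cl_segment(6)[OF g' z])
      then show ?thesis using sub by (rule subsetD[rotated])
    qed
    then have wX: "w n \<in> X" for n by (simp add: Dom_def)
    have "(\<lambda>n. \<alpha> * dl (w n) b) \<longlonglongrightarrow> \<alpha> * dl z b" by (intro tendsto_intros tendsto_dl wz zX gd) (simp_all add: wX gd)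
    moreover have "(\<lambda>n. dl (w n) a) \<longlonglongrightarrow> dl z a" by (intro tendsto_dl tendsto_const wz zX gd) (simp_all add: wX gd)
    ultimately have "\<alpha> * dl z b \<le> dl z a" by (rule LIMSEQ_le) (use wD in \<open>auto simp: Dom_def less_imp_le\<close>)
    then show ?thesis using zX by (simp add: Cl_def)
  qed
qed

lemma closed_not_Dom: "a \<in> X \<Longrightarrow> b \<in> X \<Longrightarrow> closed (X - Dom \<alpha> a b)"
proof -
  assume ab: "a \<in> X" "b \<in> X"
  have "continuous_on X (\<lambda>z. dl z a - \<alpha> * dl z b)"
    by (intro continuous_intros continuous_on_dl ab order_refl)
  then have "closed (X \<inter> (\<lambda>z. dl z a - \<alpha> * dl z b) -` {..0})"
    by (intro continuous_closed_preimage closed_X) simp_all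
  moreover have "X \<inter> (\<lambda>z. dl z a - \<alpha> * dl z b) -` {..0} = X - Dom \<alpha> a b" by (auto simp: Dom_def)
  ultimately show ?thesis by simp
qed

text \<open>Without a margin there would be speeds tending to \<alpha>, points of their regions, and
  points outside V closer and closer to these. A common limit would lie in
  \<open>Cl \<alpha> a b\<close> but outside V.\<close>

lemma margin:
  assumes g: "good \<alpha> a b" and V: "closed (X - V)" and sub: "Cl \<alpha> a b \<subseteq> V"
  shows "\<exists>\<beta> e. 1 < \<beta> \<and> \<beta> < \<alpha> \<and> good \<beta> a b \<and> 0 < e \<and> (\<forall>z\<in>Dom \<beta> a b. \<forall>y\<in>X. dist z y \<le> e \<longrightarrow> y \<in> V)"
proof (rule ccontr)
  note gd = goodD[OF g]
  assume neg: "\<not> ?thesis"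
  have b0: "0 < norm b"
  proof -
    have "0 < \<alpha> * norm b" using gd(5) norm_ge_zero[of a] by linarith
    then show ?thesis using gd(1) by (simp add: zero_less_mult_iff)
  qed
  \<comment> \<open>Half of the available room: the first bound keeps the reduced speed above 1, the
    second keeps the vertex outside the enlarged region.\<close>
  define d where "d = min ((\<alpha> - 1) / 2) ((\<alpha> * norm b - norm a) / (2 * norm b))"
  have d: "0 < d" using gd b0 by (simp add: d_def)
  have good_d: "1 < \<beta> \<and> good \<beta> a b" if "\<alpha> - d \<le> \<beta>" for \<beta>
  proof -
    have "d \<le> (\<alpha> - 1) / 2" "d \<le> (\<alpha> * norm b - norm a) / (2 * norm b)"
      unfolding d_def by (rule min.cobounded1, rule min.cobounded2)
    then have 1: "1 < \<beta>" and "d * (2 * norm b) \<le> \<alpha> * norm b - norm a" using that gd(1) b0 by (simp_all add: pos_le_divide_eq)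
    moreover have "(\<alpha> - d) * norm b \<le> \<beta> * norm b" using that by (intro mult_right_mono) simp_all
    moreover have "0 < d * norm b" using d b0 by simp
    ultimately have "norm a < \<beta> * norm b" by (simp add: algebra_simps)
    then show ?thesis using 1 gd by (simp add: good_def)
  qed
  define bt where "bt n = \<alpha> - d / real (Suc n)" for n
  have bt: "\<alpha> - d \<le> bt n" "bt n < \<alpha>" for n
    using d by (simp_all add: bt_def divide_le_eq)
  have "\<exists>z y. z \<in> Dom (bt n) a b \<and> y \<in> X \<and> dist z y \<le> 1 / real (Suc n) \<and> y \<notin> V" for n
    using neg good_d[OF bt(1)] bt(2)[of n] by (metis of_nat_0_less_iff zero_less_Suc zero_less_divide_1_iff)
  then obtain z y where zy: "\<And>n. z n \<in> Dom (bt n) a b" "\<And>n. y n \<in> X" "\<And>n. dist (z n) (y n) \<le> 1 / real (Suc n)" "\<And>n. y n \<notin> V"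
    by metis
  have zX: "z n \<in> X" "bt n * dl (z n) b < dl (z n) a" for n using zy(1)[of n] by (simp_all add: Dom_def)
  have "z n \<in> cball b (dl a b / (\<alpha> - d - 1)) \<inter> X" for n
  proof -
    have "(\<alpha> - d) * dl (z n) b \<le> bt n * dl (z n) b" using bt(1) by (intro mult_right_mono) simp_all
    then have "z n \<in> Cl (\<alpha> - d) a b" using zX[of n] by (simp add: Cl_def)
    then have "dl (z n) b \<le> dl a b / (\<alpha> - d - 1)" by (intro Cl_bound gd) (use good_d[of "\<alpha> - d"] in simp_all)
    then show ?thesis using dl_ge_dist[of "z n" b] zX(1)[of n] by (simp add: dist_commute)
  qed
  moreover have "compact (cball b (dl a b / (\<alpha> - d - 1)) \<inter> X)" by (intro compact_Int_closed compact_cball closed_X)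
  ultimately obtain l r where l: "l \<in> cball b (dl a b / (\<alpha> - d - 1)) \<inter> X" and r: "strict_mono r" "(z \<circ> r) \<longlonglongrightarrow> l"
    unfolding compact_def by blast
  have lX: "l \<in> X" using l by simp
  have zr: "(\<lambda>n. z (r n)) \<longlonglongrightarrow> l" using r(2) by (simp add: comp_def)
  have sr: "(\<lambda>n. f (r n)) \<longlonglongrightarrow> k" if "f \<longlonglongrightarrow> k" for f :: "nat \<Rightarrow> real" and k
    using LIMSEQ_subseq_LIMSEQ[OF that r(1)] by (simp add: comp_def)
  have inv: "(\<lambda>n. 1 / real (Suc n)) \<longlonglongrightarrow> 0" using LIMSEQ_inverse_real_of_nat by (simp add: inverse_eq_divide)
  have "(\<lambda>n. \<alpha> - d * (1 / real (Suc n))) \<longlonglongrightarrow> \<alpha> - d * 0" by (intro tendsto_intros inv)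
  then have "bt \<longlonglongrightarrow> \<alpha>" by (simp add: bt_def[abs_def])
  then have btr: "(\<lambda>n. bt (r n)) \<longlonglongrightarrow> \<alpha>" by (rule sr)
  have "(\<lambda>n. dist (z (r n)) (y (r n))) \<longlonglongrightarrow> 0"
    by (rule tendsto_sandwich[OF _ _ tendsto_const sr[OF inv]]) (use zy(3) in simp_all)
  then have "(\<lambda>n. z (r n) - y (r n)) \<longlonglongrightarrow> 0" unfolding dist_norm by (rule tendsto_norm_zero_cancel)
  from tendsto_diff[OF zr this] have yr: "(\<lambda>n. y (r n)) \<longlonglongrightarrow> l" by simp
  have "l \<in> X - V" by (rule closed_sequentially[OF V _ yr]) (use zy in blast)
  moreover have "l \<in> Cl \<alpha> a b"
  proof -
    have "(\<lambda>n. bt (r n) * dl (z (r n)) b) \<longlonglongrightarrow> \<alpha> * dl l b"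
      by (intro tendsto_mult btr tendsto_dl zr tendsto_const lX gd) (simp_all add: zX gd)
    moreover have "(\<lambda>n. dl (z (r n)) a) \<longlonglongrightarrow> dl l a"
      by (intro tendsto_dl zr tendsto_const lX gd) (simp_all add: zX gd)
    ultimately have "\<alpha> * dl l b \<le> dl l a" by (rule LIMSEQ_le) (use zX(2) in \<open>meson less_imp_le\<close>)
    then show ?thesis using lX by (simp add: Cl_def)
  qed
  ultimately show False using sub by blast
qed

end

subsection \<open>Controls and trajectories\<close>

text \<open>F stands for \<open>at_left t\<close> or \<open>at_right t\<close>. Continuity near t,
  on top of the limit at t, is what prevents discontinuities from accumulating in
  \<open>finite_irregular\<close>.\<close>

definition side_regular :: "real filter \<Rightarrow> (real \<Rightarrow> plane) \<Rightarrow> bool" where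
  "side_regular F u \<longleftrightarrow> (\<exists>l. (u \<longlongrightarrow> l) F) \<and> eventually (isCont u) F"

text \<open>Points of an open one-sided neighbourhood of x are interior to it. Functions that
  eventually agree on one side therefore agree near each such point, and \<open>isCont\<close>
  carries over.\<close>

lemma eventually_nhds_at_within:
  fixes x :: "'a::t1_space"
  assumes "open S" "eventually P (at x within S)"
  shows "eventually (\<lambda>y. eventually P (nhds y)) (at x within S)"
proof -
  have "eventually (\<lambda>y. eventually (\<lambda>z. z \<noteq> x \<longrightarrow> z \<in> S \<longrightarrow> P z) (nhds y)) (nhds x)"
    using assms(2) unfolding eventually_at_filter by (simp add: eventually_eventually)
  then show ?thesis unfolding eventually_at_filter
  proof eventually_elim
    case (elim y)
    show ?case
    proof (intro impI)
      assume "y \<noteq> x" "y \<in> S"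
      then have "eventually (\<lambda>z. z \<in> S - {x}) (nhds y)"
        using assms(1) by (intro eventually_nhds_in_open) (auto intro: open_delete)
      then show "eventually P (nhds y)" using elim by eventually_elim auto
    qed
  qed
qed

lemma side_regular_cong:
  assumes "open S" "F = at t within S" "eventually (\<lambda>r. u r = w r) F" "side_regular F u"
  shows "side_regular F w"
proof -
  obtain l where "(u \<longlongrightarrow> l) F" using assms(4) side_regular_def by blast
  then have l: "(w \<longlongrightarrow> l) F" using tendsto_cong[OF assms(3)] by blast
  have "eventually (\<lambda>r. eventually (\<lambda>q. u q = w q) (nhds r)) F"
    using eventually_nhds_at_within[OF assms(1)] assms(2,3) by blast
  moreover have "eventually (isCont u) F" using assms(4) side_regular_def by blast
  ultimately have "eventually (isCont w) F"
    by eventually_elim (simp add: isCont_cong)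
  with l show ?thesis unfolding side_regular_def by blast
qed

lemmas side_regular_cong_right = side_regular_cong[OF open_greaterThan refl]
lemmas side_regular_cong_left = side_regular_cong[OF open_lessThan refl]

lemma side_regular_affine:
  assumes "open S" "open S'" "\<And>r. r \<in> S \<Longrightarrow> k * r + d \<in> S'" "0 < k" "side_regular (at (k * t + d) within S') u"
  shows "side_regular (at t within S) (\<lambda>r. u (k * r + d))"
proof -
  have "eventually (\<lambda>r. k * r + d \<in> S' \<and> k * r + d \<noteq> k * t + d) (at t within S)"
    unfolding eventually_at_filter using assms(3,4) by (intro always_eventually) simp
  moreover have "((\<lambda>r. k * r + d) \<longlongrightarrow> k * t + d) (at t within S)" by (intro tendsto_intros)
  ultimately have f: "filterlim (\<lambda>r. k * r + d) (at (k * t + d) within S') (at t within S)"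
    unfolding filterlim_at by (rule conjI)
  obtain l where "(u \<longlongrightarrow> l) (at (k * t + d) within S')" using assms(5) side_regular_def by blast
  then have 1: "((\<lambda>r. u (k * r + d)) \<longlongrightarrow> l) (at t within S)" by (rule filterlim_compose[OF _ f])
  have "eventually (isCont u) (at (k * t + d) within S')" using assms(5) side_regular_def by blast
  then have 2: "eventually (\<lambda>r. isCont u (k * r + d)) (at t within S)"
    by (rule eventually_compose_filterlim[OF _ f])
  from 2 have "eventually (isCont (\<lambda>r. u (k * r + d))) (at t within S)"
  proof eventually_elim
    case (elim r)
    have "isCont (\<lambda>r. k * r + d) r" by simp
    then show ?case using elim by (rule isCont_o2)
  qed
  with 1 show ?thesis unfolding side_regular_def by blast
qed

lemma side_regular_compose:
  assumes "open S" "F = at t within S" "F \<noteq> bot" "side_regular F u" "eventually (\<lambda>r. norm (u r) = 1) F"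
    "continuous_on (sphere 0 1) U"
  shows "side_regular F (\<lambda>r. U (u r))"
proof -
  obtain l where l: "(u \<longlongrightarrow> l) F" using assms(4) side_regular_def by blast
  have s: "eventually (\<lambda>r. u r \<in> sphere 0 1) F" using assms(5) by eventually_elim auto
  have "l \<in> sphere 0 1" by (rule Lim_in_closed_set[OF _ s assms(3) l]) simp
  then have 1: "((\<lambda>r. U (u r)) \<longlongrightarrow> U l) F"
    by (rule continuous_on_tendsto_compose[OF assms(6) l _ s])
  have "eventually (\<lambda>r. eventually (\<lambda>q. u q \<in> sphere 0 1) (nhds r)) F"
    using eventually_nhds_at_within[OF assms(1)] assms(2) s by blast
  moreover have "eventually (isCont u) F" using assms(4) side_regular_def by blast
  ultimately have "eventually (isCont (\<lambda>r. U (u r))) F"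
  proof eventually_elim
    case (elim r)
    have "u r \<in> sphere 0 1" using eventually_nhds_x_imp_x[OF elim(1)] .
    then show ?case unfolding isCont_def
      using continuous_on_tendsto_compose[OF assms(6), of u "u r" "at r"] elim
      by (meson eventually_nhds_conv_at isCont_def)
  qed
  with 1 show ?thesis unfolding side_regular_def by blast
qed

lemma side_regular_const: "side_regular F (\<lambda>_. v)"
  unfolding side_regular_def by (rule conjI, rule exI, rule tendsto_const, rule always_eventually, rule allI, rule continuous_const)

lemma finite_irregular:
  assumes "\<And>t. a \<le> t \<Longrightarrow> eventually (isCont u) (at_right t)" "\<And>t. a < t \<Longrightarrow> eventually (isCont u) (at_left t)"
  shows "finite ({t. a < t \<and> \<not> isCont u t} \<inter> {a..b::real})"
proof (rule ccontr)
  let ?S = "{t. a < t \<and> \<not> isCont u t} \<inter> {a..b::real}"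
  assume "infinite ?S"
  then have "\<exists>x\<in>{a..b}. x islimpt ?S"
    by (rule Heine_Borel_imp_Bolzano_Weierstrass[OF compact_Icc _ Int_lower2])
  then obtain x where x: "x \<in> {a..b}" "x islimpt ?S" ..
  have "eventually (\<lambda>t. t \<notin> ?S) (at x)"
  proof -
    have r: "eventually (\<lambda>t. t \<notin> ?S) (at_right x)"
      by (rule eventually_mono[OF assms(1)]) (use x(1) in simp_all)
    have "eventually (\<lambda>t. t \<notin> ?S) (at_left x)"
    proof (cases "a < x")
      case True
      then have "eventually (isCont u) (at_left x)" by (rule assms(2))
      then show ?thesis by (rule eventually_mono) simp
    next
      case False
      then have "x = a" using x(1) by auto
      have "eventually (\<lambda>t. t < x) (at_left x)" by (simp add: eventually_at_left_field lt_ex)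
      then show ?thesis by eventually_elim (auto simp: \<open>x = a\<close>)
    qed
    with r show ?thesis by (simp add: eventually_at_split)
  qed
  with x(2) show False unfolding islimpt_iff_eventually by blast
qed

text \<open>Piecewise continuity as a local one-sided condition, which is stable under splicing.\<close>
lemma piecewise_continuous_iff:
  "piecewise_continuous_from t0 u \<longleftrightarrow>
    (\<forall>t\<ge>t0. side_regular (at_right t) u) \<and> (\<forall>t>t0. side_regular (at_left t) u)"
proof
  assume p: "piecewise_continuous_from t0 u"
  then obtain S where S: "\<And>b. finite (S \<inter> {t0..b})" "continuous_on ({t0..} - S) u"
    unfolding piecewise_continuous_from_def by blast
  have ic: "isCont u t" if t: "t0 < t" "t \<notin> S" for t
  proof -
    have "open ({t0<..<t + 1} - (S \<inter> {t0..t + 1}))"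
      using S(1) by (intro open_Diff finite_imp_closed) auto
    moreover have "continuous_on ({t0<..<t + 1} - (S \<inter> {t0..t + 1})) u"
      by (rule continuous_on_subset[OF S(2)]) auto
    ultimately show ?thesis using t by (auto simp: continuous_on_eq_continuous_at)
  qed
  have fin: "eventually (\<lambda>r. r \<notin> S \<inter> {t0..t + 1}) (at t)" for t
  proof -
    have "\<not> t islimpt (S \<inter> {t0..t + 1})" using S(1) by (simp add: islimpt_finite)
    then show ?thesis by (simp add: islimpt_iff_eventually)
  qed
  have right: "eventually (isCont u) (at_right t)" if t: "t0 \<le> t" for t
  proof -
    have "eventually (\<lambda>r. r \<notin> S \<inter> {t0..t + 1}) (at_right t)"
      using fin[of t] by (simp add: eventually_at_split)
    moreover have "eventually (\<lambda>r. t < r \<and> r < t + 1) (at_right t)"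
      by (simp add: eventually_at_right_field) (metis less_add_one)
    ultimately show ?thesis by eventually_elim (use t ic in auto)
  qed
  have left: "eventually (isCont u) (at_left t)" if t: "t0 < t" for t
  proof -
    have "eventually (\<lambda>r. r \<notin> S \<inter> {t0..t + 1}) (at_left t)"
      using fin[of t] by (simp add: eventually_at_split)
    moreover have "eventually (\<lambda>r. t0 < r \<and> r < t) (at_left t)"
      using t by (auto simp: eventually_at_left_field)
    ultimately show ?thesis by eventually_elim (use t ic in auto)
  qed
  show "(\<forall>t\<ge>t0. side_regular (at_right t) u) \<and> (\<forall>t>t0. side_regular (at_left t) u)"
    using p left right unfolding piecewise_continuous_from_def side_regular_def by blast
next
  assume r: "(\<forall>t\<ge>t0. side_regular (at_right t) u) \<and> (\<forall>t>t0. side_regular (at_left t) u)"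
  \<comment> \<open>The initial time is added because nothing is known about u to the left of it, so
    that it need not be continuous there.\<close>
  let ?S = "insert t0 {t. t0 < t \<and> \<not> isCont u t}"
  have r1: "\<And>t. t0 \<le> t \<Longrightarrow> eventually (isCont u) (at_right t)"
    and r2: "\<And>t. t0 < t \<Longrightarrow> eventually (isCont u) (at_left t)"
    using r unfolding side_regular_def by (meson+)
  have "finite (?S \<inter> {t0..b})" for b
  proof -
    have "finite ({t. t0 < t \<and> \<not> isCont u t} \<inter> {t0..b})"
      by (rule finite_irregular[OF r1 r2])
    then show ?thesis by (rule rev_finite_subset[OF finite.insertI[of _ t0]]) auto
  qed
  moreover have "continuous_on ({t0..} - ?S) u"
    by (rule continuous_at_imp_continuous_on) auto
  ultimately show "piecewise_continuous_from t0 u"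
    using r unfolding piecewise_continuous_from_def side_regular_def by blast
qed

lemma controlsI:
  assumes "\<And>t. t0 \<le> t \<Longrightarrow> side_regular (at_right t) u" "\<And>t. t0 < t \<Longrightarrow> side_regular (at_left t) u"
    "\<And>t. t0 \<le> t \<Longrightarrow> norm (u t) = 1"
  shows "u \<in> controls t0"
  using assms unfolding controls_def piecewise_continuous_iff by blast

lemma controlsD:
  assumes "u \<in> controls t0"
  shows "\<And>t. t0 \<le> t \<Longrightarrow> side_regular (at_right t) u" "\<And>t. t0 < t \<Longrightarrow> side_regular (at_left t) u"
    "\<And>t. t0 \<le> t \<Longrightarrow> norm (u t) = 1"
  using assms unfolding controls_def piecewise_continuous_iff by blast+

lemma controls_mono: "u \<in> controls t0 \<Longrightarrow> t0 \<le> t1 \<Longrightarrow> u \<in> controls t1"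
  by (rule controlsI; rule controlsD[of u t0]; simp)

lemma controls_const: "norm v = 1 \<Longrightarrow> (\<lambda>_. v) \<in> controls t0"
  by (rule controlsI) (simp_all add: side_regular_const)

lemma controls_compose:
  assumes "u \<in> controls t0" "continuous_on (sphere 0 1) U" "\<And>v. norm v = 1 \<Longrightarrow> norm (U v) = 1"
  shows "(\<lambda>r. U (u r)) \<in> controls t0"
proof (rule controlsI)
  note c = controlsD[OF assms(1)]
  show "norm (U (u t)) = 1" if "t0 \<le> t" for t using that c(3) assms(3) by blast
  show "side_regular (at_right t) (\<lambda>r. U (u r))" if "t0 \<le> t" for t
  proof (rule side_regular_compose[OF open_greaterThan refl _ c(1)[OF that] _ assms(2)])
    show "eventually (\<lambda>r. norm (u r) = 1) (at_right t)"
      using that by (auto simp: eventually_at_filter intro!: always_eventually c(3))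
  qed simp
  show "side_regular (at_left t) (\<lambda>r. U (u r))" if h: "t0 < t" for t
  proof (rule side_regular_compose[OF open_lessThan refl _ c(2)[OF that] _ assms(2)])
    have "eventually (\<lambda>r. t0 < r) (at_left t)" using h by (auto simp: eventually_at_left_field)
    then show "eventually (\<lambda>r. norm (u r) = 1) (at_left t)"
      by eventually_elim (auto intro: c(3))
  qed simp
qed

lemma controls_affine:
  assumes "u \<in> controls t0" "0 < k" "t0 \<le> k * t1 + d"
  shows "(\<lambda>r. u (k * r + d)) \<in> controls t1"
proof (rule controlsI)
  note c = controlsD[OF assms(1)]
  have m: "t0 \<le> k * t + d" if "t1 \<le> t" for t
    using mult_left_mono[OF that less_imp_le[OF assms(2)]] assms(3) by linarith
  have m': "t0 < k * t + d" if "t1 < t" for t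
    using mult_strict_left_mono[OF that assms(2)] assms(3) by linarith
  show "norm (u (k * t + d)) = 1" if "t1 \<le> t" for t using m[OF that] c(3) by blast
  show "side_regular (at_right t) (\<lambda>r. u (k * r + d))" if "t1 \<le> t" for t
    by (rule side_regular_affine[OF _ _ _ assms(2) c(1)[OF m[OF that]]]) (use assms(2) in auto)
  show "side_regular (at_left t) (\<lambda>r. u (k * r + d))" if "t1 < t" for t
    by (rule side_regular_affine[OF _ _ _ assms(2) c(2)[OF m'[OF that]]]) (use assms(2) in auto)
qed

definition splice :: "real \<Rightarrow> (real \<Rightarrow> plane) \<Rightarrow> (real \<Rightarrow> plane) \<Rightarrow> real \<Rightarrow> plane" where
  "splice T u w t = (if t < T then u t else w t)"

lemma controls_splice:
  assumes "u \<in> controls t0" "w \<in> controls T" "t0 \<le> T"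
  shows "splice T u w \<in> controls t0"
proof (rule controlsI)
  note c = controlsD[OF assms(1)] and d = controlsD[OF assms(2)]
  show "norm (splice T u w t) = 1" if "t0 \<le> t" for t
    using that c(3) d(3) unfolding splice_def by auto
  show "side_regular (at_right t) (splice T u w)" if "t0 \<le> t" for t
  proof (cases "t < T")
    case True
    then have "eventually (\<lambda>r. r < T) (at_right t)" by (auto simp: eventually_at_right_field)
    then have "eventually (\<lambda>r. u r = splice T u w r) (at_right t)"
      by eventually_elim (auto simp: splice_def)
    then show ?thesis by (rule side_regular_cong_right[OF _ c(1)[OF that]])
  next
    case False
    then have "eventually (\<lambda>r. w r = splice T u w r) (at_right t)"
      by (auto simp: splice_def eventually_at_filter)
    then show ?thesis by (rule side_regular_cong_right[OF _ d(1)]) (use False in simp)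
  qed
  show "side_regular (at_left t) (splice T u w)" if "t0 < t" for t
  proof (cases "t \<le> T")
    case True
    then have "eventually (\<lambda>r. u r = splice T u w r) (at_left t)"
      by (auto simp: splice_def eventually_at_filter)
    then show ?thesis by (rule side_regular_cong_left[OF _ c(2)[OF that]])
  next
    case False
    then have "eventually (\<lambda>r. T < r) (at_left t)"
      by (auto simp: eventually_at_left_field intro!: exI[of _ T])
    then have "eventually (\<lambda>r. w r = splice T u w r) (at_left t)"
      by eventually_elim (auto simp: splice_def)
    then show ?thesis by (rule side_regular_cong_left[OF _ d(2)]) (use False in simp)
  qed
qed

section \<open>Almost everywhere equality of controls\<close>

definition ae_eq :: "real \<Rightarrow> real \<Rightarrow> (real \<Rightarrow> plane) \<Rightarrow> (real \<Rightarrow> plane) \<Rightarrow> bool" where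
  "ae_eq p q u w \<longleftrightarrow> negligible {r \<in> {p..q}. u r \<noteq> w r}"

lemma ae_eq_AE: "(AE r in lebesgue_on {p..q}. u r = w r) \<longleftrightarrow> ae_eq p q u w"
proof -
  let ?N = "{r. \<not> (r \<in> {p..q} \<longrightarrow> u r = w r)}"
  have "(AE r in lebesgue_on {p..q}. u r = w r) \<longleftrightarrow> (AE r in lebesgue. r \<in> {p..q} \<longrightarrow> u r = w r)"
    by (rule AE_restrict_space_iff) simp
  also have "\<dots> \<longleftrightarrow> (\<exists>N. negligible N \<and> ?N \<subseteq> N)"
    unfolding eventually_ae_filter by (simp add: negligible_iff_null_sets Bex_def)
  also have "\<dots> \<longleftrightarrow> negligible ?N" using negligible_subset by blast
  also have "?N = {r \<in> {p..q}. u r \<noteq> w r}" by auto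
  finally show ?thesis unfolding ae_eq_def .
qed

lemma ae_eq_mono: "ae_eq p q u w \<Longrightarrow> p \<le> p' \<Longrightarrow> q' \<le> q \<Longrightarrow> ae_eq p' q' u w"
  unfolding ae_eq_def by (erule negligible_subset) auto

lemma ae_eq_sym: "ae_eq p q u w \<Longrightarrow> ae_eq p q w u"
  unfolding ae_eq_def by (erule negligible_subset) auto

lemma ae_eq_trans: "ae_eq p q u v \<Longrightarrow> ae_eq p q v w \<Longrightarrow> ae_eq p q u w"
  unfolding ae_eq_def by (drule (1) negligible_Un, erule negligible_subset) auto

lemma ae_eq_join: "ae_eq p q u w \<Longrightarrow> ae_eq q r u w \<Longrightarrow> ae_eq p r u w"
  unfolding ae_eq_def by (drule (1) negligible_Un, erule negligible_subset) auto

text \<open>A single end point is negligible, so agreement on half-open intervals, as produced by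
  \<open>splice\<close> and \<open>grid\<close>, suffices.\<close>

lemma ae_eq_eq:
  assumes "\<And>r. p \<le> r \<Longrightarrow> r < q \<Longrightarrow> u r = w r" shows "ae_eq p q u w"
proof -
  have "{r \<in> {p..q}. u r \<noteq> w r} \<subseteq> {q}" using assms by force
  then show ?thesis unfolding ae_eq_def by (rule negligible_subset[OF negligible_sing])
qed

lemma ae_eq_compose: "ae_eq p q u w \<Longrightarrow> ae_eq p q (\<lambda>r. f (u r)) (\<lambda>r. f (w r))"
  unfolding ae_eq_def by (erule negligible_subset) auto

lemma ae_eq_affine:
  assumes "0 < k" "ae_eq (k * p + d) (k * q + d) u w"
  shows "ae_eq p q (\<lambda>r. u (k * r + d)) (\<lambda>r. w (k * r + d))"
proof -
  let ?N = "{x \<in> {k * p + d..k * q + d}. u x \<noteq> w x}"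
  have "negligible ((\<lambda>x. (x - d) / k) ` ?N)"
  proof (rule negligible_differentiable_image_negligible)
    show "negligible ?N" using assms(2) unfolding ae_eq_def .
    show "(\<lambda>x. (x - d) / k) differentiable_on ?N"
      using assms(1) unfolding differentiable_on_def by (auto intro!: derivative_intros)
  qed simp
  moreover have "{r \<in> {p..q}. u (k * r + d) \<noteq> w (k * r + d)} \<subseteq> (\<lambda>x. (x - d) / k) ` ?N"
  proof
    fix r assume "r \<in> {r \<in> {p..q}. u (k * r + d) \<noteq> w (k * r + d)}"
    then have "k * r + d \<in> ?N" using assms(1) by simp
    moreover have "r = (k * r + d - d) / k" using assms(1) by simp
    ultimately show "r \<in> (\<lambda>x. (x - d) / k) ` ?N" by (rule rev_image_eqI)
  qed
  ultimately show ?thesis unfolding ae_eq_def by (rule negligible_subset)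
qed

lemma controls_integrable:
  assumes "u \<in> controls t0" "t0 \<le> p" shows "u integrable_on {p..q}"
proof -
  obtain S where S: "\<And>b. finite (S \<inter> {t0..b})" "continuous_on ({t0..} - S) u"
    using assms(1) unfolding controls_def piecewise_continuous_from_def by blast
  let ?F = "S \<inter> {t0..q}"
  have m: "{p..q} - ?F \<in> sets lebesgue"
    using negligible_finite[OF S(1)[of q]] by (intro sets.Diff) (simp_all add: negligible_imp_sets)
  have 0: "{x \<in> {p..q} - ({p..q} - ?F). f x \<noteq> 0} \<subseteq> ?F" "{x \<in> ({p..q} - ?F) - {p..q}. f x \<noteq> 0} = {}"
    for f :: "real \<Rightarrow> 'a::zero" by auto
  have n: "negligible {x \<in> {p..q} - ({p..q} - ?F). f x \<noteq> 0}" "negligible {x \<in> ({p..q} - ?F) - {p..q}. f x \<noteq> 0}"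
    for f :: "real \<Rightarrow> 'a::zero"
    by (rule negligible_subset[OF negligible_finite[OF S(1)] 0(1)]) (simp only: 0(2) negligible_empty)
  have "u integrable_on ({p..q} - ?F)"
  proof (rule measurable_bounded_by_integrable_imp_integrable[OF _ _ _ m])
    show "u \<in> borel_measurable (lebesgue_on ({p..q} - ?F))"
    proof (rule continuous_imp_measurable_on_sets_lebesgue[OF _ m])
      show "continuous_on ({p..q} - ?F) u"
        by (rule continuous_on_subset[OF S(2)]) (use assms(2) in auto)
    qed
    show "(\<lambda>_. 1::real) integrable_on ({p..q} - ?F)"
      by (rule integrable_spike_set[OF _ n]) (rule integrable_const_ivl)
    show "norm (u x) \<le> 1" if "x \<in> {p..q} - ?F" for x
      using controlsD(3)[OF assms(1), of x] that assms(2) by simp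
  qed
  then show ?thesis by (rule integrable_spike_set[OF _ n(2,1)])
qed

section \<open>Trajectories\<close>

lemma traj_start [simp]: "trajectory k t0 x u t0 = x"
  unfolding trajectory_def by simp

lemma traj_split:
  assumes "u \<in> controls t0" "t0 \<le> p" "p \<le> q"
  shows "trajectory k p (trajectory k t0 x u p) u q = trajectory k t0 x u q"
proof -
  have "integral {t0..p} u + integral {p..q} u = integral {t0..q} u"
    using assms by (intro Henstock_Kurzweil_Integration.integral_combine controls_integrable) auto
  then show ?thesis unfolding trajectory_def by (simp flip: scaleR_add_right)
qed

lemma traj_aeq:
  assumes "ae_eq p t u w" "q \<le> t" shows "trajectory k p x u q = trajectory k p x w q"
proof -
  have "integral {p..q} u = integral {p..q} w"
    using assms(1) unfolding ae_eq_def by (rule integral_spike) (use assms(2) in auto)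
  then show ?thesis unfolding trajectory_def by simp
qed

lemma traj_cong:
  assumes "\<And>r. p \<le> r \<Longrightarrow> r < q \<Longrightarrow> u r = w r"
  shows "trajectory k p x u q = trajectory k p x w q"
proof -
  have "ae_eq p q u w" by (rule ae_eq_eq) (rule assms)
  then show ?thesis by (rule traj_aeq) simp
qed

lemma traj_const: "p \<le> q \<Longrightarrow> trajectory k p x (\<lambda>_. v) q = x + (k * (q - p)) *\<^sub>R v"
  unfolding trajectory_def by simp

lemma norm_control_integral:
  assumes "u \<in> controls t0" "t0 \<le> p" "p \<le> q" shows "norm (integral {p..q} u) \<le> q - p"
proof -
  have "norm (integral {p..q} u) \<le> integral {p..q} (\<lambda>_. 1::real)"
    by (rule Henstock_Kurzweil_Integration.integral_norm_bound_integral)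
      (use controls_integrable[OF assms(1,2)] controlsD(3)[OF assms(1)] assms(2) in auto)
  then show ?thesis using assms(3) by simp
qed

lemma traj_dist_aux:
  assumes "u \<in> controls t0" "t0 \<le> p" "p \<le> q"
  shows "dist (trajectory k t0 x u p) (trajectory k t0 x u q) \<le> \<bar>k\<bar> * (q - p)"
proof -
  have "dist (trajectory k t0 x u p) (trajectory k t0 x u q) = norm (k *\<^sub>R integral {p..q} u)"
    using traj_split[OF assms, of k x] unfolding trajectory_def
    by (metis add_diff_cancel_left' dist_commute dist_norm)
  also have "\<dots> \<le> \<bar>k\<bar> * (q - p)"
    using norm_control_integral[OF assms] by (simp add: mult_left_mono)
  finally show ?thesis .
qed

lemma traj_dist:
  assumes "u \<in> controls t0" "t0 \<le> p" "t0 \<le> q"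
  shows "dist (trajectory k t0 x u p) (trajectory k t0 x u q) \<le> \<bar>k\<bar> * \<bar>p - q\<bar>"
proof (cases "p \<le> q")
  case True
  then show ?thesis using traj_dist_aux[OF assms(1,2)] by simp
next
  case False
  then show ?thesis using traj_dist_aux[OF assms(1,3), of p] by (simp add: dist_commute)
qed

lemma traj_splice_le: "t \<le> T \<Longrightarrow> trajectory k t0 x (splice T u w) t = trajectory k t0 x u t"
  by (rule traj_cong) (simp add: splice_def)

lemma traj_splice_ge:
  assumes "u \<in> controls t0" "w \<in> controls T" "t0 \<le> T" "T \<le> t"
  shows "trajectory k t0 x (splice T u w) t = trajectory k T (trajectory k t0 x u T) w t"
proof -
  have "trajectory k t0 x (splice T u w) t = trajectory k T (trajectory k t0 x u T) (splice T u w) t"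
    using traj_split[OF controls_splice[OF assms(1-3)] assms(3,4), of k x] traj_splice_le[of T T k t0 x u w]
    by simp
  also have "\<dots> = trajectory k T (trajectory k t0 x u T) w t"
    by (rule traj_cong) (simp add: splice_def)
  finally show ?thesis .
qed

text \<open>Replaying a control m times as fast, at speed m, traces the same path. This is the
  motion of a pursuer on the evader's trail.\<close>

lemma traj_affine:
  assumes "u \<in> controls t0" "0 < m" "t0 \<le> m * p + d" "p \<le> q"
  shows "trajectory m p x (\<lambda>r. u (m * r + d)) q = trajectory 1 (m * p + d) x u (m * q + d)"
proof -
  have "(u has_integral integral {m * p + d..m * q + d} u) (cbox (m * p + d) (m * q + d))"
    using controls_integrable[OF assms(1,3), of "m * q + d"] by (simp add: integrable_integral)
  from has_integral_affinity'[OF this assms(2), of d]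
  have "((\<lambda>r. u (m * r + d)) has_integral (integral {m * p + d..m * q + d} u /\<^sub>R m)) {p..q}"
    using assms(2) by (simp flip: mult.assoc)
  then show ?thesis unfolding trajectory_def using assms(2) by (simp add: integral_unique)
qed

lemma traj_continuous:
  assumes "u \<in> controls t0" shows "continuous_on {t0..} (trajectory k t0 x u)"
proof (rule continuous_on_iff[THEN iffD2], intro ballI allI impI)
  fix p e :: real assume h: "p \<in> {t0..}" "0 < e"
  show "\<exists>d>0. \<forall>q\<in>{t0..}. dist q p < d \<longrightarrow> dist (trajectory k t0 x u q) (trajectory k t0 x u p) < e"
  proof (intro exI conjI ballI impI)
    show "0 < e / (\<bar>k\<bar> + 1)" using h by simp
    fix q assume q: "q \<in> {t0..}" "dist q p < e / (\<bar>k\<bar> + 1)"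
    have "dist (trajectory k t0 x u q) (trajectory k t0 x u p) \<le> \<bar>k\<bar> * \<bar>q - p\<bar>"
      using traj_dist[OF assms] q h by simp
    also have "\<dots> \<le> (\<bar>k\<bar> + 1) * \<bar>q - p\<bar>" by (intro mult_right_mono) auto
    also have "\<dots> < e" using q(2) by (simp add: dist_real_def field_simps)
    finally show "dist (trajectory k t0 x u q) (trajectory k t0 x u p) < e" .
  qed
qed

text \<open>The bridge from frozen laws to actual controls: linear inequalities between v and
  \<open>U v\<close> are preserved by integration along u.\<close>

lemma avg_control:
  assumes u: "u \<in> controls t0" "t0 \<le> t" and U: "continuous_on (sphere 0 1) U" "\<And>v. norm v = 1 \<Longrightarrow> norm (U v) = 1"
  shows "avg U (t - t0) (integral {t0..t} u) (integral {t0..t} (\<lambda>r. U (u r)))"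
  unfolding avg_def
proof (intro allI impI)
  fix w p :: plane and k :: real assume h: "\<forall>v. norm v = 1 \<longrightarrow> p \<bullet> v + k \<le> w \<bullet> U v"
  have i: "u integrable_on {t0..t}" "(\<lambda>r. U (u r)) integrable_on {t0..t}"
    using controls_integrable[OF u(1)] controls_integrable[OF controls_compose[OF u(1) U]] by simp_all
  have iu: "(\<lambda>r. p \<bullet> u r) integrable_on {t0..t}" "integral {t0..t} (\<lambda>r. p \<bullet> u r) = p \<bullet> integral {t0..t} u"
    using integrable_linear[OF i(1) bounded_linear_inner_right[of p]]
      integral_linear[OF i(1) bounded_linear_inner_right[of p]] by (simp_all add: o_def)
  have iU: "(\<lambda>r. w \<bullet> U (u r)) integrable_on {t0..t}"
      "integral {t0..t} (\<lambda>r. w \<bullet> U (u r)) = w \<bullet> integral {t0..t} (\<lambda>r. U (u r))"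
    using integrable_linear[OF i(2) bounded_linear_inner_right[of w]]
      integral_linear[OF i(2) bounded_linear_inner_right[of w]] by (simp_all add: o_def)
  have "integral {t0..t} (\<lambda>r. p \<bullet> u r + k) \<le> integral {t0..t} (\<lambda>r. w \<bullet> U (u r))"
  proof (rule integral_le)
    show "p \<bullet> u r + k \<le> w \<bullet> U (u r)" if "r \<in> {t0..t}" for r
      using h that by (simp only: controlsD(3)[OF u(1)] atLeastAtMost_iff)
  qed (use iu iU in \<open>auto intro!: integrable_add\<close>)
  moreover have "integral {t0..t} (\<lambda>r. p \<bullet> u r + k) = p \<bullet> integral {t0..t} u + k * (t - t0)"
    by (subst Henstock_Kurzweil_Integration.integral_add) (use iu u(2) in auto)
  ultimately show "p \<bullet> integral {t0..t} u + k * (t - t0) \<le> w \<bullet> integral {t0..t} (\<lambda>r. U (u r))"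
    using iU by simp
qed

lemma admissible_mono:
  assumes "u \<in> admissible_controls X k t0 x" "t0 \<le> T"
  shows "u \<in> admissible_controls X k T (trajectory k t0 x u T)"
proof -
  have u: "u \<in> controls t0" "\<And>t. t0 \<le> t \<Longrightarrow> trajectory k t0 x u t \<in> X"
    using assms(1) unfolding admissible_controls_def by blast+
  have "trajectory k T (trajectory k t0 x u T) u t \<in> X" if "T \<le> t" for t
    using traj_split[OF u(1) assms(2) that, of k x] u(2)[of t] assms(2) that by simp
  then show ?thesis using controls_mono[OF u(1) assms(2)] unfolding admissible_controls_def by blast
qed

lemma admissibleD:
  assumes "u \<in> admissible_controls X k t0 x"
  shows "u \<in> controls t0" "\<And>t. t0 \<le> t \<Longrightarrow> trajectory k t0 x u t \<in> X"
  using assms unfolding admissible_controls_def by blast+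

lemma strategyI:
  assumes "\<And>u. u \<in> admissible_controls X 1 t0 b \<Longrightarrow> \<delta> u \<in> controls t0"
    "\<And>u t. u \<in> admissible_controls X 1 t0 b \<Longrightarrow> t0 \<le> t \<Longrightarrow> trajectory \<alpha> t0 a (\<delta> u) t \<in> X"
    "\<And>t u u'. t0 < t \<Longrightarrow> u \<in> admissible_controls X 1 t0 b \<Longrightarrow> u' \<in> admissible_controls X 1 t0 b \<Longrightarrow>
      ae_eq t0 t u u' \<Longrightarrow> ae_eq t0 t (\<delta> u) (\<delta> u')"
  shows "\<delta> \<in> nonanticipative_strategies X \<alpha> t0 a b"
  using assms unfolding nonanticipative_strategies_def ae_eq_AE admissible_controls_def Pi_def by simp

lemma strategyD:
  assumes "\<delta> \<in> nonanticipative_strategies X \<alpha> t0 a b" "u \<in> admissible_controls X 1 t0 b"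
  shows "\<delta> u \<in> controls t0" "\<And>t. t0 \<le> t \<Longrightarrow> trajectory \<alpha> t0 a (\<delta> u) t \<in> X"
    "\<And>t u'. t0 < t \<Longrightarrow> u' \<in> admissible_controls X 1 t0 b \<Longrightarrow> ae_eq t0 t u u' \<Longrightarrow> ae_eq t0 t (\<delta> u) (\<delta> u')"
  using assms unfolding nonanticipative_strategies_def ae_eq_AE admissible_controls_def Pi_def by simp_all

context corner begin

subsection \<open>Confinement strategies\<close>

definition confines :: "real \<Rightarrow> real \<Rightarrow> plane \<Rightarrow> plane \<Rightarrow> plane set \<Rightarrow> (real \<Rightarrow> plane) \<Rightarrow> (real \<Rightarrow> plane) \<Rightarrow> bool" where
  "confines \<alpha> t0 a b V w u \<longleftrightarrow>
    (\<forall>t\<ge>t0. (\<forall>r\<in>{t0..t}. trajectory \<alpha> t0 a w r \<noteq> trajectory 1 t0 b u r) \<longrightarrow> trajectory 1 t0 b u t \<in> V)"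

text \<open>P limits the promise, not the strategy: every admissible control must be answered
  legally, while confinement is claimed only for controls satisfying P. This permits strategies for
  different behaviours of the evader to be pieced together.\<close>

definition guard ::
  "real \<Rightarrow> real \<Rightarrow> plane \<Rightarrow> plane \<Rightarrow> plane set \<Rightarrow> ((real \<Rightarrow> plane) \<Rightarrow> bool) \<Rightarrow> bool" where
  "guard \<alpha> t0 a b V P \<longleftrightarrow> (\<exists>\<delta> \<in> nonanticipative_strategies X \<alpha> t0 a b.
     \<forall>u \<in> admissible_controls X 1 t0 b. P u \<longrightarrow> confines \<alpha> t0 a b V (\<delta> u) u)"

lemma guard_mono:
  assumes "guard \<alpha> t0 a b V P" "V \<subseteq> W" "\<And>u. u \<in> admissible_controls X 1 t0 b \<Longrightarrow> Q u \<Longrightarrow> P u"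
  shows "guard \<alpha> t0 a b W Q"
  using assms unfolding guard_def confines_def by (meson subsetD)

text \<open>Controls have unit norm, so the pursuer cannot stand still. Running to the left is
  always legal, as it increases both \<open>T\<close> and \<open>B\<close>.\<close>

lemma left_strategy:
  assumes "a \<in> X" "0 \<le> \<alpha>" shows "(\<lambda>_ _. (-1, 0)) \<in> nonanticipative_strategies X \<alpha> t0 a b"
proof (rule strategyI)
  show "(\<lambda>_. (-1, 0)) \<in> controls t0" by (rule controls_const) (simp add: norm_Pair)
  show "trajectory \<alpha> t0 a (\<lambda>_. (-1, 0)) t \<in> X" if "t0 \<le> t" for t
    using left_X[OF assms(1), of "\<alpha> * (t - t0)"] that assms(2) by (simp only: traj_const) simp
  show "ae_eq t0 t (\<lambda>_. (-1, 0)) (\<lambda>_. (-1, 0))" for t by (rule ae_eq_eq) simp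
qed

lemma guard_vacuous: "a \<in> X \<Longrightarrow> 0 \<le> \<alpha> \<Longrightarrow> guard \<alpha> t0 a b V (\<lambda>_. False)"
  unfolding guard_def using left_strategy by blast

lemma guard_captured:
  assumes "a \<in> X" "0 \<le> \<alpha>" shows "guard \<alpha> t0 a a V P"
proof -
  have "confines \<alpha> t0 a a V w u" for w u
    unfolding confines_def by (metis atLeastAtMost_iff order_refl traj_start)
  then show ?thesis unfolding guard_def using left_strategy[OF assms] by blast
qed

text \<open>The stopping time \<open>\<sigma>\<close> may depend on the immediate future of the control (\<open>q < t\<close> in \<open>nas\<close>): a
  nonanticipative strategy at time t may use the control on the whole of \<open>[t0, t]\<close>.\<close>
lemma guard_concat:
  assumes ctl: "\<And>u. u \<in> admissible_controls X 1 t0 b \<Longrightarrow> \<delta> u \<in> controls t0"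
    and inX: "\<And>u t. u \<in> admissible_controls X 1 t0 b \<Longrightarrow> t0 \<le> t \<Longrightarrow> (\<And>q. \<sigma> u = Some q \<Longrightarrow> t \<le> q) \<Longrightarrow>
      trajectory \<alpha> t0 a (\<delta> u) t \<in> X"
    and stop: "\<And>u q. u \<in> admissible_controls X 1 t0 b \<Longrightarrow> \<sigma> u = Some q \<Longrightarrow> t0 \<le> q"
    and na: "\<And>u u' t. u \<in> admissible_controls X 1 t0 b \<Longrightarrow> u' \<in> admissible_controls X 1 t0 b \<Longrightarrow> t0 \<le> t \<Longrightarrow>
      ae_eq t0 t u u' \<Longrightarrow> (\<And>q. \<sigma> u = Some q \<Longrightarrow> t \<le> q) \<Longrightarrow> ae_eq t0 t (\<delta> u) (\<delta> u')"
    and nas: "\<And>u u' q t. u \<in> admissible_controls X 1 t0 b \<Longrightarrow> u' \<in> admissible_controls X 1 t0 b \<Longrightarrow>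
      \<sigma> u = Some q \<Longrightarrow> q < t \<Longrightarrow> ae_eq t0 t u u' \<Longrightarrow> \<sigma> u' = Some q"
    and inV: "\<And>u t. u \<in> admissible_controls X 1 t0 b \<Longrightarrow> P u \<Longrightarrow> t0 \<le> t \<Longrightarrow> (\<And>q. \<sigma> u = Some q \<Longrightarrow> t < q) \<Longrightarrow>
      \<forall>r\<in>{t0..t}. trajectory \<alpha> t0 a (\<delta> u) r \<noteq> trajectory 1 t0 b u r \<Longrightarrow> trajectory 1 t0 b u t \<in> V"
    and nxt: "\<And>u q. u \<in> admissible_controls X 1 t0 b \<Longrightarrow> \<sigma> u = Some q \<Longrightarrow>
      guard \<alpha> q (trajectory \<alpha> t0 a (\<delta> u) q) (trajectory 1 t0 b u q) V
        (Q q (trajectory \<alpha> t0 a (\<delta> u) q) (trajectory 1 t0 b u q))"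
    and nxtQ: "\<And>u q. u \<in> admissible_controls X 1 t0 b \<Longrightarrow> \<sigma> u = Some q \<Longrightarrow> P u \<Longrightarrow>
      Q q (trajectory \<alpha> t0 a (\<delta> u) q) (trajectory 1 t0 b u q) u"
  shows "guard \<alpha> t0 a b V P"
proof -
  let ?E = "admissible_controls X 1 t0 b"
  \<comment> \<open>The continuation is chosen from the time and the two positions only, not from u.
    Controls that agree up to the switch therefore receive the same continuation, as
    nonanticipativity demands.\<close>
  define D where "D q r y = (SOME \<delta>'. \<delta>' \<in> nonanticipative_strategies X \<alpha> q r y \<and>
    (\<forall>u \<in> admissible_controls X 1 q y. Q q r y u \<longrightarrow> confines \<alpha> q r y V (\<delta>' u) u))" for q r y
  define x where "x u = trajectory \<alpha> t0 a (\<delta> u)" for u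
  define y where "y u = trajectory 1 t0 b u" for u
  define \<epsilon> where "\<epsilon> u = (case \<sigma> u of None \<Rightarrow> \<delta> u | Some q \<Rightarrow> splice q (\<delta> u) (D q (x u q) (y u q) u))" for u
  have D: "D q (x u q) (y u q) \<in> nonanticipative_strategies X \<alpha> q (x u q) (y u q)"
      "\<forall>v \<in> admissible_controls X 1 q (y u q). Q q (x u q) (y u q) v \<longrightarrow>
        confines \<alpha> q (x u q) (y u q) V (D q (x u q) (y u q) v) v"
    if "u \<in> ?E" "\<sigma> u = Some q" for u q
    using someI_ex[OF nxt[OF that, unfolded guard_def Bex_def]] unfolding D_def x_def y_def by blast+
  have E: "u \<in> admissible_controls X 1 q (y u q)" if "u \<in> ?E" "\<sigma> u = Some q" for u q
    unfolding y_def using admissible_mono[OF that(1)] stop[OF that] .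
  note D' = strategyD[OF D(1) E]
  have eps: "\<epsilon> u = splice q (\<delta> u) (D q (x u q) (y u q) u)" if "\<sigma> u = Some q" for u q
    using that unfolding \<epsilon>_def by simp
  have eps_lt: "\<epsilon> u r = \<delta> u r" if "\<And>q. \<sigma> u = Some q \<Longrightarrow> r < q" for u r
    using that unfolding \<epsilon>_def splice_def by (cases "\<sigma> u") auto
  have traj_le: "trajectory \<alpha> t0 a (\<epsilon> u) t = x u t" if "\<And>q. \<sigma> u = Some q \<Longrightarrow> t \<le> q" for u t
    unfolding x_def by (rule traj_cong, rule eps_lt) (use that in fastforce)
  have traj_ge: "trajectory \<alpha> t0 a (\<epsilon> u) t = trajectory \<alpha> q (x u q) (D q (x u q) (y u q) u) t"
    if "u \<in> ?E" "\<sigma> u = Some q" "q \<le> t" for u q t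
    unfolding eps[OF that(2)] unfolding x_def
    by (rule traj_splice_ge[OF ctl[OF that(1)] _ stop[OF that(1,2)] that(3)])
      (use D'(1)[OF that(1,2) that(1,2)] in \<open>simp add: x_def\<close>)
  have "\<epsilon> \<in> nonanticipative_strategies X \<alpha> t0 a b"
  proof (rule strategyI)
    show "\<epsilon> u \<in> controls t0" if u: "u \<in> ?E" for u
    proof (cases "\<sigma> u")
      case None
      then show ?thesis using ctl[OF u] unfolding \<epsilon>_def by simp
    next
      case (Some q)
      show ?thesis unfolding eps[OF Some]
        by (rule controls_splice[OF ctl[OF u] D'(1)[OF u Some u Some] stop[OF u Some]])
    qed
    show "trajectory \<alpha> t0 a (\<epsilon> u) t \<in> X" if u: "u \<in> ?E" "t0 \<le> t" for u t
    proof (cases "\<exists>q. \<sigma> u = Some q \<and> q < t")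
      case True
      then obtain q where q: "\<sigma> u = Some q" "q \<le> t" by fastforce
      show ?thesis using traj_ge[OF u(1) q] D'(2)[OF u(1) q(1) u(1) q] by simp
    next
      case False
      then have le: "\<And>q. \<sigma> u = Some q \<Longrightarrow> t \<le> q" by force
      show ?thesis using traj_le[OF le] inX[OF u le] unfolding x_def by simp
    qed
    show "ae_eq t0 t (\<epsilon> u) (\<epsilon> v)" if h: "t0 < t" "u \<in> ?E" "v \<in> ?E" "ae_eq t0 t u v" for t u v
    \<comment> \<open>Either u has switched strictly before t, and then v switches at the same
      moment, or neither of them has, and only the first phase is compared.\<close>
    proof (cases "\<exists>q. \<sigma> u = Some q \<and> q < t")
      case True
      then obtain q where q: "\<sigma> u = Some q" "q < t" by blast
      then have q': "\<sigma> v = Some q" using nas h by blast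
      have t0T: "t0 \<le> q" by (rule stop[OF h(2) q(1)])
      have uv: "ae_eq t0 q u v" by (rule ae_eq_mono[OF h(4)]) (use q in auto)
      have dd: "ae_eq t0 q (\<delta> u) (\<delta> v)" by (rule na[OF h(2,3) t0T uv]) (use q in simp)
      have xy: "x v q = x u q" "y v q = y u q"
        using traj_aeq[OF dd order_refl] traj_aeq[OF uv order_refl] unfolding x_def y_def by simp_all
      have "ae_eq t0 q (\<epsilon> u) (\<epsilon> v)"
      proof (rule ae_eq_trans[OF ae_eq_trans[OF _ dd]])
        show "ae_eq t0 q (\<epsilon> u) (\<delta> u)" by (rule ae_eq_eq, rule eps_lt) (use q in simp)
        show "ae_eq t0 q (\<delta> v) (\<epsilon> v)" by (rule ae_eq_eq, rule eps_lt[symmetric]) (use q' in simp)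
      qed
      moreover have "ae_eq q t (\<epsilon> u) (\<epsilon> v)"
      proof -
        have "ae_eq q t (D q (x u q) (y u q) u) (D q (x u q) (y u q) v)"
        proof (rule D'(3)[OF h(2) q(1) h(2) q])
          show "v \<in> admissible_controls X 1 q (y u q)" using E[OF h(3) q'] unfolding xy .
          show "ae_eq q t u v" by (rule ae_eq_mono[OF h(4) t0T order_refl])
        qed
        moreover have "\<epsilon> u r = D q (x u q) (y u q) u r" "\<epsilon> v r = D q (x u q) (y u q) v r" if "q \<le> r" for r
          using that unfolding eps[OF q(1)] eps[OF q'] xy splice_def by simp_all
        then have "ae_eq q t (\<epsilon> u) (D q (x u q) (y u q) u)" "ae_eq q t (D q (x u q) (y u q) v) (\<epsilon> v)"
          by (simp_all add: ae_eq_eq)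
        ultimately show ?thesis by (meson ae_eq_trans)
      qed
      ultimately show ?thesis by (rule ae_eq_join)
    next
      case False
      then have le: "\<And>q. \<sigma> u = Some q \<Longrightarrow> t \<le> q" by force
      have le': "t \<le> q" if q: "\<sigma> v = Some q" for q
      proof (rule ccontr)
        assume "\<not> t \<le> q"
        then have "\<sigma> u = Some q" using nas[OF h(3,2) q _ ae_eq_sym[OF h(4)]] by simp
        then show False using le \<open>\<not> t \<le> q\<close> by blast
      qed
      show ?thesis
      proof (rule ae_eq_trans[OF ae_eq_trans[OF _ na[OF h(2,3) less_imp_le[OF h(1)] h(4) le]]])
        show "ae_eq t0 t (\<epsilon> u) (\<delta> u)" by (rule ae_eq_eq, rule eps_lt) (use le in fastforce)
        show "ae_eq t0 t (\<delta> v) (\<epsilon> v)" by (rule ae_eq_eq, rule eps_lt[symmetric]) (use le' in fastforce)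
      qed
    qed
  qed
  moreover have "confines \<alpha> t0 a b V (\<epsilon> u) u" if u: "u \<in> ?E" "P u" for u
    unfolding confines_def
  proof (intro allI impI)
    fix t assume t: "t0 \<le> t" "\<forall>r\<in>{t0..t}. trajectory \<alpha> t0 a (\<epsilon> u) r \<noteq> trajectory 1 t0 b u r"
    show "trajectory 1 t0 b u t \<in> V"
    proof (cases "\<exists>q. \<sigma> u = Some q \<and> q \<le> t")
      case True
      then obtain q where q: "\<sigma> u = Some q" "q \<le> t" by blast
      have t0T: "t0 \<le> q" by (rule stop[OF u(1) q(1)])
      have yy: "trajectory 1 q (y u q) u r = trajectory 1 t0 b u r" if "q \<le> r" for r
        unfolding y_def by (rule traj_split[OF admissibleD(1)[OF u(1)] t0T that])
      have "confines \<alpha> q (x u q) (y u q) V (D q (x u q) (y u q) u) u"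
        using D(2)[OF u(1) q(1)] E[OF u(1) q(1)] nxtQ[OF u(1) q(1) u(2)] unfolding x_def y_def by blast
      moreover have "\<forall>r\<in>{q..t}. trajectory \<alpha> q (x u q) (D q (x u q) (y u q) u) r \<noteq> trajectory 1 q (y u q) u r"
      proof
        fix r assume r: "r \<in> {q..t}"
        then have "q \<le> r" "r \<in> {t0..t}" using t0T by auto
        then show "trajectory \<alpha> q (x u q) (D q (x u q) (y u q) u) r \<noteq> trajectory 1 q (y u q) u r"
          using t(2) traj_ge[OF u(1) q(1)] yy by metis
      qed
      ultimately show ?thesis using q(2) yy[OF q(2)] unfolding confines_def by metis
    next
      case False
      then have lt: "\<And>q. \<sigma> u = Some q \<Longrightarrow> t < q" by force
      have "\<forall>r\<in>{t0..t}. trajectory \<alpha> t0 a (\<delta> u) r \<noteq> trajectory 1 t0 b u r"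
      proof
        fix r assume r: "r \<in> {t0..t}"
        have "trajectory \<alpha> t0 a (\<epsilon> u) r = x u r" by (rule traj_le) (use lt r in fastforce)
        then show "trajectory \<alpha> t0 a (\<delta> u) r \<noteq> trajectory 1 t0 b u r"
          using t(2) r unfolding x_def by metis
      qed
      then show ?thesis using inV[OF u t(1)] lt by blast
    qed
  qed
  ultimately show ?thesis unfolding guard_def by blast
qed

section \<open>Pursuer motions between prescribed positions\<close>

definition reach :: "real \<Rightarrow> real \<Rightarrow> plane \<Rightarrow> real \<Rightarrow> plane \<Rightarrow> (real \<Rightarrow> plane) \<Rightarrow> bool" where
  "reach \<alpha> t0 a t1 a' u \<longleftrightarrow> u \<in> controls t0 \<and> trajectory \<alpha> t0 a u t1 = a' \<and>
     (\<forall>t\<in>{t0..t1}. trajectory \<alpha> t0 a u t \<in> X)"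

lemma reach_join:
  assumes "reach \<alpha> t0 a t1 a' u" "reach \<alpha> t1 a' t2 a'' w" "t0 \<le> t1" "t1 \<le> t2"
  shows "reach \<alpha> t0 a t2 a'' (splice t1 u w)"
proof -
  have u: "u \<in> controls t0" "trajectory \<alpha> t0 a u t1 = a'" "\<And>t. t0 \<le> t \<Longrightarrow> t \<le> t1 \<Longrightarrow> trajectory \<alpha> t0 a u t \<in> X"
    using assms(1) unfolding reach_def by auto
  have w: "w \<in> controls t1" "trajectory \<alpha> t1 a' w t2 = a''" "\<And>t. t1 \<le> t \<Longrightarrow> t \<le> t2 \<Longrightarrow> trajectory \<alpha> t1 a' w t \<in> X"
    using assms(2) unfolding reach_def by auto
  have ge: "trajectory \<alpha> t0 a (splice t1 u w) t = trajectory \<alpha> t1 a' w t" if "t1 \<le> t" for t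
    using traj_splice_ge[OF u(1) w(1) assms(3) that, of \<alpha> a] unfolding u(2) .
  show ?thesis unfolding reach_def
  proof (intro conjI ballI)
    show "splice t1 u w \<in> controls t0" by (rule controls_splice[OF u(1) w(1) assms(3)])
    show "trajectory \<alpha> t0 a (splice t1 u w) t2 = a''" using ge[OF assms(4)] w(2) by simp
    fix t assume t: "t \<in> {t0..t2}"
    show "trajectory \<alpha> t0 a (splice t1 u w) t \<in> X"
    proof (cases "t \<le> t1")
      case True
      then show ?thesis using u(3)[of t] t by (simp add: traj_splice_le)
    next
      case False
      then show ?thesis using w(3)[of t] ge[of t] t by simp
    qed
  qed
qed

lemma reach_straight:
  assumes "0 < \<alpha>" "closed_segment a a' \<subseteq> X" "dist a a' = \<alpha> * (t1 - t0)"
  shows "\<exists>u. reach \<alpha> t0 a t1 a' u"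
proof (cases "a = a'")
  case True
  then have eq: "t1 = t0" and "a \<in> X" using assms by auto
  have "reach \<alpha> t0 a t0 a (\<lambda>_. (-1, 0))"
    unfolding reach_def using \<open>a \<in> X\<close> by (auto intro!: controls_const simp: norm_Pair)
  then show ?thesis using True eq by blast
next
  case False
  then have lt: "t0 < t1" using assms(1,3) by (metis diff_gt_0_iff_gt zero_less_dist_iff zero_less_mult_pos)
  let ?v = "sgn (a' - a)"
  have tr: "trajectory \<alpha> t0 a (\<lambda>_. ?v) t = a + ((t - t0) / (t1 - t0)) *\<^sub>R (a' - a)" if "t0 \<le> t" for t
  proof -
    have "\<alpha> * (t - t0) / norm (a' - a) = (t - t0) / (t1 - t0)"
      using assms(1,3) lt by (simp add: dist_norm norm_minus_commute)
    then show ?thesis using traj_const[OF that] by (simp add: sgn_div_norm divide_inverse)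
  qed
  have "reach \<alpha> t0 a t1 a' (\<lambda>_. ?v)"
    unfolding reach_def
  proof (intro conjI ballI)
    show "(\<lambda>_. ?v) \<in> controls t0" by (rule controls_const) (use False in \<open>simp add: norm_sgn\<close>)
    show "trajectory \<alpha> t0 a (\<lambda>_. ?v) t1 = a'" using tr[of t1] lt by simp
    fix t assume t: "t \<in> {t0..t1}"
    let ?k = "(t - t0) / (t1 - t0)"
    have "a + ?k *\<^sub>R (a' - a) = (1 - ?k) *\<^sub>R a + ?k *\<^sub>R a'" by (simp add: algebra_simps)
    moreover have "0 \<le> ?k" "?k \<le> 1" using t lt by auto
    ultimately have "a + ?k *\<^sub>R (a' - a) \<in> closed_segment a a'" unfolding in_segment by blast
    then show "trajectory \<alpha> t0 a (\<lambda>_. ?v) t \<in> X" using tr[of t] assms(2) t by auto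
  qed
  then show ?thesis by blast
qed

text \<open>With unit controls waiting has to be a detour: to the left for half of the time and back
  again. \<open>reach_exists\<close> spends spare time in this way before setting out.\<close>

lemma reach_wait:
  assumes "0 < \<alpha>" "a \<in> X" "t0 \<le> t1" shows "\<exists>u. reach \<alpha> t0 a t1 a u"
proof -
  let ?m = "(t0 + t1) / 2"
  let ?k = "\<alpha> * (?m - t0)"
  let ?b = "a + ?k *\<^sub>R (-1, 0)"
  have k: "0 \<le> ?k" using assms by simp
  have seg: "closed_segment a ?b \<subseteq> X"
  proof
    fix z assume "z \<in> closed_segment a ?b"
    then obtain u where u: "0 \<le> u" "z = (1 - u) *\<^sub>R a + u *\<^sub>R ?b" unfolding in_segment by blast
    have "z = a + (u * ?k) *\<^sub>R (-1, 0)" unfolding u(2) by (simp add: algebra_simps)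
    then show "z \<in> X" using left_X[OF assms(2) mult_nonneg_nonneg[OF u(1) k]] by simp
  qed
  have d: "dist a ?b = ?k" using k by (simp add: dist_norm norm_Pair)
  obtain u where u: "reach \<alpha> t0 a ?m ?b u" using reach_straight[OF assms(1) seg d] by blast
  have "dist ?b a = \<alpha> * (t1 - ?m)" using d by (simp add: dist_commute field_simps)
  then obtain w where w: "reach \<alpha> ?m ?b t1 a w"
    using reach_straight[OF assms(1)] seg by (metis closed_segment_commute)
  show ?thesis using reach_join[OF u w] assms(3) by fastforce
qed

lemma ray_segment: "a \<in> X \<Longrightarrow> closed_segment a 0 \<subseteq> X"
proof
  fix z assume "a \<in> X" "z \<in> closed_segment a 0"
  then show "z \<in> X" unfolding in_segment using scale_X[of a] by fastforce
qed

lemma reach_exists: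
  assumes "0 < \<alpha>" "a \<in> X" "a' \<in> X" "dl a a' \<le> \<alpha> * (t1 - t0)"
  shows "\<exists>u. reach \<alpha> t0 a t1 a' u"
proof -
  let ?t = "t1 - dl a a' / \<alpha>"
  have t: "t0 \<le> ?t" "?t \<le> t1" using assms dl_nonneg[of a a'] by (auto simp: field_simps)
  obtain u where u: "reach \<alpha> t0 a ?t a u" using reach_wait[OF assms(1,2) t(1)] by blast
  have "\<exists>w. reach \<alpha> ?t a t1 a' w"
  proof (cases "blocked a a'")
    case False
    show ?thesis
      by (rule reach_straight[OF assms(1) not_blocked_segment[OF assms(2,3) False]])
        (use assms(1) in \<open>simp add: dl_unblocked[OF False]\<close>)
  next
    case True
    then have dl: "dl a a' = norm a + norm a'" unfolding dl_def by simp
    let ?m = "?t + norm a / \<alpha>"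
    have m: "?t \<le> ?m" "?m \<le> t1" using assms(1) dl by (auto simp: field_simps)
    have "dist a 0 = \<alpha> * (?m - ?t)" "dist 0 a' = \<alpha> * (t1 - ?m)"
      using assms(1) dl by (auto simp: field_simps)
    then obtain v w where "reach \<alpha> ?t a ?m 0 v" "reach \<alpha> ?m 0 t1 a' w"
      using reach_straight[OF assms(1) ray_segment[OF assms(2)]]
        reach_straight[OF assms(1) ray_segment[OF assms(3), unfolded closed_segment_commute[of a' 0]]] by metis
    then show ?thesis using reach_join m by blast
  qed
  then show ?thesis using reach_join[OF u _ t] by blast
qed

text \<open>A fixed choice that depends only on the end points and times of the piece, so that equal
  data yield equal controls.\<close>

definition leg :: "real \<Rightarrow> real \<Rightarrow> plane \<Rightarrow> real \<Rightarrow> plane \<Rightarrow> real \<Rightarrow> plane" where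
  "leg \<alpha> t0 a t1 a' = (SOME u. reach \<alpha> t0 a t1 a' u)"

lemma reach_leg:
  "0 < \<alpha> \<Longrightarrow> a \<in> X \<Longrightarrow> a' \<in> X \<Longrightarrow> dl a a' \<le> \<alpha> * (t1 - t0) \<Longrightarrow> reach \<alpha> t0 a t1 a' (leg \<alpha> t0 a t1 a')"
  unfolding leg_def by (rule someI_ex[OF reach_exists])

lemma reachD:
  assumes "reach \<alpha> t0 a t1 a' u"
  shows "u \<in> controls t0" "trajectory \<alpha> t0 a u t1 = a'"
    "\<And>t. t0 \<le> t \<Longrightarrow> t \<le> t1 \<Longrightarrow> trajectory \<alpha> t0 a u t \<in> X"
  using assms unfolding reach_def by auto

text \<open>The pursuer walks to the evader's initial position and then follows the evader's own path.\<close>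
lemma guard_trail:
  assumes "1 < \<alpha>" "a \<in> X" "b \<in> X" and V: "\<And>z. z \<in> X \<Longrightarrow> dist b z \<le> dl a b / (\<alpha> - 1) \<Longrightarrow> z \<in> V"
  shows "guard \<alpha> t0 a b V P"
proof -
  define d where "d = dl a b"
  \<comment> \<open>p is the arrival time at b. From then on the pursuer occupies at time r the
    evader's position of time \<open>\<alpha> * r + e\<close>. The two times coincide at q, the time
    of capture, and up to q only past values of the control are read.\<close>
  define p where "p = t0 + d / \<alpha>"
  define q where "q = t0 + d / (\<alpha> - 1)"
  define e where "e = t0 - \<alpha> * p"
  have d: "0 \<le> d" unfolding d_def by (rule dl_nonneg)
  have t: "t0 \<le> p" "p \<le> q" unfolding p_def q_def using assms(1) d by (auto intro: divide_left_mono)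
  have ep: "\<alpha> * p + e = t0" unfolding e_def by simp
  have eq: "\<alpha> * r + e \<le> r \<longleftrightarrow> r \<le> q" "\<alpha> * q + e = q" for r
  proof -
    have k: "\<alpha> * r + e - r = (\<alpha> - 1) * (r - q)" for r
      unfolding e_def p_def q_def using assms(1) by (simp add: field_simps)
    have "\<alpha> * r + e \<le> r \<longleftrightarrow> (\<alpha> - 1) * (r - q) \<le> 0" using k[of r] by linarith
    then show "\<alpha> * r + e \<le> r \<longleftrightarrow> r \<le> q" using assms(1) by (simp add: mult_le_0_iff)
    show "\<alpha> * q + e = q" using k[of q] by simp
  qed
  define l where "l = leg \<alpha> t0 a p b"
  have l: "reach \<alpha> t0 a p b l"
    unfolding l_def by (rule reach_leg) (use assms in \<open>auto simp: p_def d_def\<close>)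
  note l' = reachD[OF l]
  define f where "f u = (\<lambda>r. u (\<alpha> * r + e))" for u :: "real \<Rightarrow> plane"
  have f: "f u \<in> controls p" if "u \<in> controls t0" for u
    unfolding f_def by (rule controls_affine[OF that]) (use assms(1) ep in auto)
  have ff: "trajectory \<alpha> t0 a (splice p l (f u)) r = trajectory 1 t0 b u (\<alpha> * r + e)"
    if "u \<in> controls t0" "p \<le> r" for u r
    using traj_splice_ge[OF l'(1) f[OF that(1)] t(1) that(2), of \<alpha> a]
      traj_affine[OF that(1), of \<alpha> p e r b] ep that(2) assms(1) unfolding l'(2) f_def by simp
  show ?thesis
  proof (rule guard_concat[where \<delta> = "\<lambda>u. splice p l (f u)" and \<sigma> = "\<lambda>_. Some q" and Q = "\<lambda>_ _ _ _. True"])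
    fix u assume u: "u \<in> admissible_controls X 1 t0 b"
    note u' = admissibleD[OF u]
    show "splice p l (f u) \<in> controls t0" by (rule controls_splice[OF l'(1) f[OF u'(1)] t(1)])
    show "trajectory \<alpha> t0 a (splice p l (f u)) r \<in> X" if "t0 \<le> r" for r
    proof (cases "r \<le> p")
      case True
      then show ?thesis using l'(3) that by (simp add: traj_splice_le)
    next
      case False
      then have "\<alpha> * p \<le> \<alpha> * r" using assms(1) by simp
      then have "t0 \<le> \<alpha> * r + e" using ep by linarith
      then show ?thesis using ff[OF u'(1)] False u'(2) by simp
    qed
    show "t0 \<le> r" if "Some q = Some r" for r using that t by simp
    show "ae_eq t0 r (splice p l (f u)) (splice p l (f v))"
      if h: "v \<in> admissible_controls X 1 t0 b" "t0 \<le> r" "ae_eq t0 r u v" "\<And>TT. Some q = Some TT \<Longrightarrow> r \<le> TT" for v r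
    proof -
      have 1: "ae_eq t0 p (splice p l (f u)) (splice p l (f v))" by (rule ae_eq_eq) (simp add: splice_def)
      have "ae_eq p r (f u) (f v)" unfolding f_def
      proof (rule ae_eq_affine)
        show "ae_eq (\<alpha> * p + e) (\<alpha> * r + e) u v"
          by (rule ae_eq_mono[OF h(3)]) (use ep eq(1)[of r] h(4) in auto)
      qed (use assms(1) in simp)
      moreover have "ae_eq p r (splice p l (f u)) (f u)" "ae_eq p r (f v) (splice p l (f v))"
        by (rule ae_eq_eq, simp add: splice_def)+
      ultimately have "ae_eq p r (splice p l (f u)) (splice p l (f v))" by (metis ae_eq_trans)
      with 1 show ?thesis by (rule ae_eq_join)
    qed
    show "Some q = Some TT" if "Some q = Some TT" for TT by (rule that)
    show "trajectory 1 t0 b u r \<in> V" if "t0 \<le> r" "\<And>TT. Some q = Some TT \<Longrightarrow> r < TT" for r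
    proof (rule V)
      show "trajectory 1 t0 b u r \<in> X" using u'(2) that(1) .
      show "dist b (trajectory 1 t0 b u r) \<le> dl a b / (\<alpha> - 1)"
        using traj_dist[OF u'(1) order_refl that(1), of 1 b] that by (simp add: q_def d_def)
    qed
    show "guard \<alpha> TT (trajectory \<alpha> t0 a (splice p l (f u)) TT) (trajectory 1 t0 b u TT) V (\<lambda>_. True)"
      if "Some q = Some TT" for TT
    proof -
      have TT: "TT = q" using that by simp
      have "trajectory \<alpha> t0 a (splice p l (f u)) q = trajectory 1 t0 b u q"
        using ff[OF u'(1) t(2)] eq(2) by simp
      then show ?thesis unfolding TT using guard_captured[of "trajectory 1 t0 b u q" \<alpha>] u'(2)[of q] t assms(1) by simp
    qed
  qed simp
qed

end

section \<open>Replies on a time grid\<close>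

lemma grid_index:
  fixes h t0 t :: real
  assumes "0 < h" "t0 \<le> t"
  shows "\<exists>k::nat. t0 + real k * h \<le> t \<and> t < t0 + real (Suc k) * h"
proof -
  let ?x = "(t - t0) / h"
  have x: "0 \<le> ?x" using assms by simp
  have "real (nat \<lfloor>?x\<rfloor>) \<le> ?x" "?x < real (Suc (nat \<lfloor>?x\<rfloor>))" using x by linarith+
  then have "t0 + real (nat \<lfloor>?x\<rfloor>) * h \<le> t" "t < t0 + real (Suc (nat \<lfloor>?x\<rfloor>)) * h"
    using assms(1) by (simp_all only: le_divide_eq divide_less_eq if_True)
  then show ?thesis by blast
qed

lemma grid_index_unique:
  fixes h t0 t :: real
  assumes "0 < h" "t0 + real k * h \<le> t" "t < t0 + real (Suc k) * h"
  shows "nat \<lfloor>(t - t0) / h\<rfloor> = k"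
proof -
  have "real k \<le> (t - t0) / h" "(t - t0) / h < real k + 1"
    using assms by (auto simp: field_simps)
  then have "\<lfloor>(t - t0) / h\<rfloor> = int k" by linarith
  then show ?thesis by simp
qed

context corner begin

definition grid :: "real \<Rightarrow> real \<Rightarrow> real \<Rightarrow> (nat \<Rightarrow> plane) \<Rightarrow> real \<Rightarrow> plane" where
  "grid \<alpha> t0 h Z t = (let k = nat \<lfloor>(t - t0) / h\<rfloor> in
     leg \<alpha> (t0 + real k * h) (Z k) (t0 + real (Suc k) * h) (Z (Suc k)) t)"

lemma grid_eq:
  assumes "0 < h" "t0 + real k * h \<le> t" "t < t0 + real (Suc k) * h"
  shows "grid \<alpha> t0 h Z t = leg \<alpha> (t0 + real k * h) (Z k) (t0 + real (Suc k) * h) (Z (Suc k)) t"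
  unfolding grid_def Let_def grid_index_unique[OF assms] by (rule refl)

lemma grid_motion:
  assumes "0 < \<alpha>" "0 < h" "\<And>k. Z k \<in> X" "\<And>k. dl (Z k) (Z (Suc k)) \<le> \<alpha> * h"
  shows "grid \<alpha> t0 h Z \<in> controls t0"
    and "trajectory \<alpha> t0 (Z 0) (grid \<alpha> t0 h Z) (t0 + real k * h) = Z k"
    and "t0 \<le> t \<Longrightarrow> trajectory \<alpha> t0 (Z 0) (grid \<alpha> t0 h Z) t \<in> X"
proof -
  let ?t = "\<lambda>k. t0 + real k * h"
  let ?g = "grid \<alpha> t0 h Z"
  define l where "l k = leg \<alpha> (?t k) (Z k) (?t (Suc k)) (Z (Suc k))" for k
  have tk: "t0 \<le> ?t k" "?t k < ?t (Suc k)" for k using assms(2) by (auto simp: algebra_simps)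
  have "reach \<alpha> (?t k) (Z k) (?t (Suc k)) (Z (Suc k)) (l k)" for k
    unfolding l_def by (rule reach_leg) (use assms in \<open>auto simp: algebra_simps\<close>)
  note l = reachD[OF this]
  have g: "?g r = l k r" if "?t k \<le> r" "r < ?t (Suc k)" for k r
    unfolding l_def by (rule grid_eq[OF assms(2) that])
  show ctl: "?g \<in> controls t0"
  proof (rule controlsI)
    fix t assume t: "t0 \<le> t"
    obtain k where k: "?t k \<le> t" "t < ?t (Suc k)" using grid_index[OF assms(2) t] by blast
    show "norm (?g t) = 1" using g[OF k] controlsD(3)[OF l(1) k(1)] by simp
    have "eventually (\<lambda>r. t < r \<and> r < ?t (Suc k)) (at_right t)" using k(2) by (auto simp: eventually_at_right_field)
    then have "eventually (\<lambda>r. l k r = ?g r) (at_right t)"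
      by eventually_elim (rule g[symmetric]; use k in linarith)
    then show "side_regular (at_right t) ?g" by (rule side_regular_cong_right[OF _ controlsD(1)[OF l(1) k(1)]])
  next
    fix t assume t: "t0 < t"
    obtain k where k: "?t k \<le> t" "t < ?t (Suc k)" using grid_index[OF assms(2), of t0 t] t by auto
    have "\<exists>j. ?t j < t \<and> t \<le> ?t (Suc j)"
    proof (cases "?t k < t")
      case True
      then show ?thesis using k(2) less_imp_le by blast
    next
      case False
      then have eq: "t = ?t k" using k(1) by simp
      then have "k \<noteq> 0" using t by (cases k) auto
      then obtain j where "k = Suc j" using not0_implies_Suc by blast
      then show ?thesis using eq tk(2)[of j] by blast
    qed
    then obtain j where j: "?t j < t" "t \<le> ?t (Suc j)" by blast
    have "eventually (\<lambda>r. ?t j < r \<and> r < t) (at_left t)" using j(1) by (auto simp: eventually_at_left_field)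
    then have "eventually (\<lambda>r. l j r = ?g r) (at_left t)"
      by eventually_elim (rule g[symmetric]; use j in linarith)
    then show "side_regular (at_left t) ?g" by (rule side_regular_cong_left[OF _ controlsD(2)[OF l(1) j(1)]])
  qed
  have seg: "trajectory \<alpha> t0 (Z 0) ?g r = trajectory \<alpha> (?t k) (Z k) (l k) r"
    if "trajectory \<alpha> t0 (Z 0) ?g (?t k) = Z k" "?t k \<le> r" "r \<le> ?t (Suc k)" for k r
  proof -
    have "trajectory \<alpha> t0 (Z 0) ?g r = trajectory \<alpha> (?t k) (Z k) ?g r"
      using traj_split[OF ctl tk(1)[of k] that(2), of \<alpha> "Z 0"] that(1) by simp
    also have "\<dots> = trajectory \<alpha> (?t k) (Z k) (l k) r"
      by (rule traj_cong, rule g) (use that in auto)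
    finally show ?thesis .
  qed
  show end_k: "trajectory \<alpha> t0 (Z 0) ?g (?t k) = Z k" for k
  proof (induction k)
    case 0
    show ?case by simp
  next
    case (Suc k)
    show ?case using seg[OF Suc, of "?t (Suc k)"] tk(2)[of k] l(2)[of k] by simp
  qed
  show "trajectory \<alpha> t0 (Z 0) ?g t \<in> X" if t: "t0 \<le> t"
  proof -
    obtain k where k: "?t k \<le> t" "t < ?t (Suc k)" using grid_index[OF assms(2) t] by blast
    then show ?thesis using seg[OF end_k k(1)] l(3)[OF k(1)] by simp
  qed
qed

text \<open>The default p keeps the motion legal where \<open>pursuit_step\<close> does not apply.
  The choice uses only the three positions, which is needed for nonanticipativity.\<close>

definition respond :: "real \<Rightarrow> plane \<Rightarrow> plane \<Rightarrow> plane \<Rightarrow> plane" where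
  "respond \<beta> p y y' = (if \<exists>p'\<in>X. dl p p' \<le> \<beta> * dist y y' \<and> Dom \<beta> p' y' \<subseteq> Dom \<beta> p y
     then SOME p'. p' \<in> X \<and> dl p p' \<le> \<beta> * dist y y' \<and> Dom \<beta> p' y' \<subseteq> Dom \<beta> p y else p)"

lemma respond:
  assumes "p \<in> X" "0 \<le> \<beta>"
  shows "respond \<beta> p y y' \<in> X" "dl p (respond \<beta> p y y') \<le> \<beta> * dist y y'"
    and "good \<beta> p y \<Longrightarrow> y' \<in> Dom \<beta> p y \<Longrightarrow> Dom \<beta> (respond \<beta> p y y') y' \<subseteq> Dom \<beta> p y"
proof -
  let ?Q = "\<lambda>p'. p' \<in> X \<and> dl p p' \<le> \<beta> * dist y y' \<and> Dom \<beta> p' y' \<subseteq> Dom \<beta> p y"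
  have *: "?Q (respond \<beta> p y y')" if "\<exists>p'. ?Q p'"
    using someI_ex[OF that] that unfolding respond_def Bex_def by (simp only: if_True)
  have n: "respond \<beta> p y y' = p" if "\<not> (\<exists>p'. ?Q p')"
    using that unfolding respond_def Bex_def by (simp only: if_False)
  show "respond \<beta> p y y' \<in> X" using * n assms(1) by metis
  show "dl p (respond \<beta> p y y') \<le> \<beta> * dist y y'"
    using * n assms(2) dl_refl[of p] by (metis mult_nonneg_nonneg zero_le_dist)
  show "Dom \<beta> (respond \<beta> p y y') y' \<subseteq> Dom \<beta> p y" if "good \<beta> p y" "y' \<in> Dom \<beta> p y"
    using * pursuit_step[OF that] by blast
qed

primrec shadow :: "real \<Rightarrow> (nat \<Rightarrow> plane) \<Rightarrow> plane \<Rightarrow> nat \<Rightarrow> plane" where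
  "shadow \<beta> y a 0 = a"
| "shadow \<beta> y a (Suc k) = respond \<beta> (shadow \<beta> y a k) (y k) (y (Suc k))"

lemma shadow_X: "a \<in> X \<Longrightarrow> 0 \<le> \<beta> \<Longrightarrow> shadow \<beta> y a k \<in> X"
  by (induction k) (simp_all add: respond)

lemma shadow_cong: "(\<And>j. j \<le> k \<Longrightarrow> y j = z j) \<Longrightarrow> shadow \<beta> y a k = shadow \<beta> z a k"
  by (induction k) simp_all

lemma shadow_near:
  assumes "1 < \<beta>" "a \<in> X" "\<And>k. y k \<in> X" "z \<in> X" "dl (y k) z \<le> h" "(\<beta> + 1) * h < dl (shadow \<beta> y a k) (y k)"
  shows "z \<in> Dom \<beta> (shadow \<beta> y a k) (y k)"
proof (rule near_Dom[OF assms(1) shadow_X[OF assms(2)] assms(3,4)])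
  show "dl (y k) z < dl (shadow \<beta> y a k) (y k) / (\<beta> + 1)"
    using assms(1,5,6) by (simp add: field_simps) (smt (verit) mult_left_mono mult.commute)
qed (use assms(1) in simp)

text \<open>Each step is an application of \<open>pursuit_step\<close>. The distance condition
  ensures, through \<open>near_Dom\<close>, that the evader's next grid position is still inside the
  current region.\<close>

lemma shadow_nested:
  assumes "good \<beta> a (y 0)" "\<And>k. y k \<in> X" "\<And>k. dl (y k) (y (Suc k)) \<le> h" "0 < h"
    "\<And>j. j < k \<Longrightarrow> (\<beta> + 1) * h < dl (shadow \<beta> y a j) (y j)"
  shows "y k \<in> Dom \<beta> a (y 0) \<and> Dom \<beta> (shadow \<beta> y a k) (y k) \<subseteq> Dom \<beta> a (y 0)"
  using assms(5)
proof (induction k)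
  case 0
  note g = goodD[OF assms(1)]
  show ?case using g(2,3) dl_pos[OF g(4)] dl_refl[of "y 0"] dl_sym[of a "y 0"] unfolding Dom_def by simp
next
  case (Suc k)
  note g = goodD[OF assms(1)]
  have b0: "0 \<le> \<beta>" using g(1) by simp
  let ?p = "shadow \<beta> y a k"
  have act: "(\<beta> + 1) * h < dl ?p (y k)" using Suc.prems by blast
  have IH: "Dom \<beta> ?p (y k) \<subseteq> Dom \<beta> a (y 0)" using Suc.IH Suc.prems less_SucI by blast
  have y: "y (Suc k) \<in> Dom \<beta> ?p (y k)"
    by (rule shadow_near[OF g(1,2) assms(2,2,3) act])
  have "?p \<noteq> y k" using act g(1) assms(4) dl_refl[of "y k"] by (metis add_pos_pos less_asym mult_pos_pos zero_less_one less_trans)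
  then have "good \<beta> ?p (y k)" by (rule nested_good[OF assms(1) shadow_X[OF g(2) b0] assms(2) _ IH])
  from respond(3)[OF shadow_X[OF g(2) b0] b0 this y] show ?case using y IH by auto
qed

lemma traj_dl:
  assumes u: "u \<in> admissible_controls X 1 t0 b" "t0 \<le> p" "p \<le> q"
  shows "dl (trajectory 1 t0 b u p) (trajectory 1 t0 b u q) \<le> q - p"
proof -
  have "dl (trajectory 1 t0 b u p) (trajectory 1 t0 b u q) \<le> 1 * (q - p)"
  proof (rule dl_Lipschitz_path[OF _ _ u(3)])
    show "dist (trajectory 1 t0 b u t) (trajectory 1 t0 b u t') \<le> 1 * \<bar>t - t'\<bar>"
      if "t \<in> {p..q}" "t' \<in> {p..q}" for t t'
      using traj_dist[OF admissibleD(1)[OF u(1)], of t t' 1 b] that u(2) by simp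
    show "trajectory 1 t0 b u t \<in> X" if "t \<in> {p..q}" for t
      using admissibleD(2)[OF u(1)] that u(2) by simp
  qed
  then show ?thesis by simp
qed

text \<open>The pursuer lags one grid step behind the shadow pursuer, whose moves depend on the evader's
  position at the end of the step; the slack pays for the lag.\<close>
lemma guard_margin:
  assumes \<beta>: "1 < \<beta>" "\<beta> < \<alpha>" and g: "good \<beta> a b" and e: "0 < e"
    and V: "\<And>z y. z \<in> Dom \<beta> a b \<Longrightarrow> y \<in> X \<Longrightarrow> dist z y \<le> e \<Longrightarrow> y \<in> V"
  shows "guard \<alpha> t0 a b V P"
proof -
  note g' = goodD[OF g]
  have \<alpha>: "1 < \<alpha>" using \<beta> by simp
  \<comment> \<open>When the shadow pursuer first is within \<open>(\<beta> + 1) * h\<close> of the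
    evader, the real one needs one more step to get there, and the evader is then at most
    \<open>(\<beta> + 2) * h\<close> away. \<open>guard_trail\<close> lets it wander by at most
    \<open>c1 * h\<close> after that. The step h makes this, together with the last step, equal to
    e.\<close>
  define c1 where "c1 = (\<beta> + 2) / (\<alpha> - 1)"
  have c1: "0 < c1" unfolding c1_def using \<beta> \<alpha> by simp
  define h where "h = e / (1 + c1)"
  have "h * (1 + c1) = e" unfolding h_def using c1 by simp
  then have h2: "h + c1 * h = e" by (simp add: algebra_simps)
  have "0 < h" unfolding h_def using e c1 by simp
  note h = this h2
  then have he: "h \<le> e" using c1 mult_pos_pos[of c1 h] by linarith
  let ?t = "\<lambda>k. t0 + real k * h"
  let ?E = "admissible_controls X 1 t0 b"
  define y where "y u k = trajectory 1 t0 b u (?t k)" for u k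
  define A where "A u = shadow \<beta> (y u) a" for u
  \<comment> \<open>Above this threshold the evader cannot leave the current region of the shadow
    pursuer within one step.\<close>
  define act where "act u k \<longleftrightarrow> (\<beta> + 1) * h < dl (A u k) (y u k)" for u k
  define \<kappa> where "\<kappa> u = (LEAST k. \<not> act u k)" for u
  \<comment> \<open>By truncated subtraction the positions 0 and 1 are both a: the pursuer spends
    the first step in place and is one step late ever after.\<close>
  define Z where "Z u k = A u (k - 1)" for u and k :: nat
  \<comment> \<open>The successor is due to the lag: \<open>A u (\<kappa> u)\<close> is reached by
    the real pursuer one step after the shadow.\<close>
  define \<sigma> where "\<sigma> u = (if \<exists>k. \<not> act u k then Some (?t (Suc (\<kappa> u))) else None)" for u
  have t0k: "t0 \<le> ?t k" for k using h by simp
  have tmono: "?t j \<le> ?t k" if "j \<le> k" for j k using that h(1) by (simp add: mult_right_mono)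
  have tk: "?t k \<le> ?t j \<longleftrightarrow> k \<le> j" "?t k < ?t j \<longleftrightarrow> k < j" for k j using h(1) by simp_all
  have yX: "y u k \<in> X" if "u \<in> ?E" for u k unfolding y_def by (rule admissibleD(2)[OF that t0k])
  have y0: "y u 0 = b" for u unfolding y_def by simp
  have dlyt: "dl (y u k) (trajectory 1 t0 b u t) \<le> h" if "u \<in> ?E" "?t k \<le> t" "t \<le> ?t (Suc k)" for u k t
    using traj_dl[OF that(1) t0k[of k] that(2)] that(3) unfolding y_def by (simp add: algebra_simps)
  have dlyS: "dl (y u k) (y u (Suc k)) \<le> h" if "u \<in> ?E" for u k
    using dlyt[OF that tmono[of k "Suc k"] order_refl] unfolding y_def by simp
  have AX: "A u k \<in> X" for u k unfolding A_def by (rule shadow_X) (use g' \<beta> in auto)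
  have dlA: "dl (A u k) (A u (Suc k)) \<le> \<alpha> * h" if "u \<in> ?E" for u k
  proof -
    have "dl (A u k) (A u (Suc k)) \<le> \<beta> * dist (y u k) (y u (Suc k))"
      unfolding A_def shadow.simps by (rule respond(2)) (use AX[unfolded A_def] \<beta> in auto)
    also have "\<dots> \<le> \<beta> * h"
      using dl_ge_dist[of "y u k" "y u (Suc k)"] dlyS[OF that, of k] \<beta> by (intro mult_left_mono) auto
    also have "\<dots> \<le> \<alpha> * h" using \<beta> h by simp
    finally show ?thesis .
  qed
  have dlZ: "dl (Z u k) (Z u (Suc k)) \<le> \<alpha> * h" if "u \<in> ?E" for u k
    using dlA[OF that, of "k - 1"] h \<alpha> unfolding Z_def by (cases k) (simp_all add: dl_refl)
  have Z0: "Z u 0 = a" for u unfolding Z_def A_def by simp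
  have ZX: "Z u k \<in> X" for u k unfolding Z_def by (rule AX)
  have G: "grid \<alpha> t0 h (Z u) \<in> controls t0"
      "trajectory \<alpha> t0 a (grid \<alpha> t0 h (Z u)) (?t k) = Z u k"
      "t0 \<le> t \<Longrightarrow> trajectory \<alpha> t0 a (grid \<alpha> t0 h (Z u)) t \<in> X"
    if "u \<in> ?E" for u k t
    using grid_motion[of \<alpha> h "Z u", OF less_trans[OF zero_less_one \<alpha>] h(1) ZX dlZ[OF that]]
    unfolding Z0 by blast+
  have nested: "y u k \<in> Dom \<beta> a b \<and> Dom \<beta> (A u k) (y u k) \<subseteq> Dom \<beta> a b"
    if u: "u \<in> ?E" and ac: "\<And>j. j < k \<Longrightarrow> act u j" for u k
    using shadow_nested[of \<beta> a "y u" h k] g yX[OF u] dlyS[OF u] h(1) ac unfolding y0 act_def A_def by blast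
  have \<kappa>: "\<not> act u (\<kappa> u)" "\<And>j. j < \<kappa> u \<Longrightarrow> act u j" if "\<sigma> u = Some q" for u q
  proof -
    have ex: "\<exists>k. \<not> act u k" using that unfolding \<sigma>_def by (metis option.distinct(1))
    show "\<not> act u (\<kappa> u)" unfolding \<kappa>_def by (rule LeastI_ex[OF ex])
    show "act u j" if "j < \<kappa> u" for j using not_less_Least[OF that[unfolded \<kappa>_def]] by blast
  qed
  have \<sigma>D: "q = ?t (Suc (\<kappa> u))" if "\<sigma> u = Some q" for u q
    using that unfolding \<sigma>_def by (metis option.distinct(1) option.inject)
  have yeq: "y u k = y v k" if "ae_eq t0 t u v" "?t k \<le> t" for u v k t
    unfolding y_def by (rule traj_aeq[OF that])
  have Aeq: "A u k = A v k" if "ae_eq t0 t u v" "?t k \<le> t" for u v k t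
    unfolding A_def by (rule shadow_cong, rule yeq[OF that(1)]) (use tmono that(2) in \<open>meson order_trans\<close>)
  show ?thesis
  proof (rule guard_concat[where \<delta> = "\<lambda>u. grid \<alpha> t0 h (Z u)" and \<sigma> = \<sigma> and Q = "\<lambda>_ _ _ _. True"])
    fix u assume u: "u \<in> ?E"
    show "grid \<alpha> t0 h (Z u) \<in> controls t0" by (rule G(1)[OF u])
    show "trajectory \<alpha> t0 a (grid \<alpha> t0 h (Z u)) t \<in> X" if "t0 \<le> t" for t by (rule G(3)[OF u that])
    show "t0 \<le> q" if "\<sigma> u = Some q" for q using \<sigma>D[OF that] t0k[of "Suc (\<kappa> u)"] by simp
    show "ae_eq t0 t (grid \<alpha> t0 h (Z u)) (grid \<alpha> t0 h (Z v))" if uv: "ae_eq t0 t u v" for v t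
    proof (rule ae_eq_eq)
      fix r assume r: "t0 \<le> r" "r < t"
      obtain k where k: "?t k \<le> r" "r < ?t (Suc k)" using grid_index[OF h(1) r(1)] by blast
      have kt: "?t k \<le> t" using k r by simp
      have "?t (k - 1) \<le> t" using tmono[of "k - 1" k] kt by simp
      then have "Z u k = Z v k" "Z u (Suc k) = Z v (Suc k)"
        unfolding Z_def using Aeq[OF uv] kt by simp_all
      then show "grid \<alpha> t0 h (Z u) r = grid \<alpha> t0 h (Z v) r" by (simp only: grid_eq[OF h(1) k])
    qed
    show "\<sigma> v = Some q" if q: "\<sigma> u = Some q" "q < t" "ae_eq t0 t u v" for v q t
    proof -
      have eqv: "act u k = act v k" if "k \<le> \<kappa> u" for k
      proof -
        have "?t k \<le> ?t (Suc (\<kappa> u))" by (rule tmono) (use that in simp)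
        then have "?t k \<le> t" using \<sigma>D[OF q(1)] q(2) by simp
        then show ?thesis unfolding act_def using yeq[OF q(3)] Aeq[OF q(3)] by simp
      qed
      have "\<not> act v (\<kappa> u)" using eqv \<kappa>(1)[OF q(1)] by blast
      moreover have "\<kappa> u \<le> k" if "\<not> act v k" for k
        using that eqv \<kappa>(2)[OF q(1)] by (meson leI less_imp_le)
      ultimately have "\<kappa> v = \<kappa> u" unfolding \<kappa>_def[of v] by (rule Least_equality)
      then show ?thesis using \<open>\<not> act v (\<kappa> u)\<close> \<sigma>D[OF q(1)] unfolding \<sigma>_def by auto
    qed
    show "trajectory 1 t0 b u t \<in> V" if t: "t0 \<le> t" "\<And>q. \<sigma> u = Some q \<Longrightarrow> t < q" for t
    proof -
      have yt: "trajectory 1 t0 b u t \<in> X" by (rule admissibleD(2)[OF u t(1)])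
      obtain k where k: "?t k \<le> t" "t < ?t (Suc k)" using grid_index[OF h(1) t(1)] by blast
      note dk = dlyt[OF u k(1) less_imp_le[OF k(2)]]
      have ac: "act u j" if "j < k" for j
      proof (rule ccontr)
        assume n: "\<not> act u j"
        then have s: "\<sigma> u = Some (?t (Suc (\<kappa> u)))" unfolding \<sigma>_def by auto
        have "\<kappa> u \<le> j" unfolding \<kappa>_def by (rule Least_le[where P = "\<lambda>k. \<not> act u k", OF n])
        then have "?t (Suc (\<kappa> u)) \<le> ?t k" using that by (intro tmono) simp
        then show False using t(2)[OF s] k(1) by simp
      qed
      show ?thesis
      proof (rule V[OF conjunct1[OF nested[OF u ac]] yt])
        show "dist (y u k) (trajectory 1 t0 b u t) \<le> e"
          using dl_ge_dist[of "y u k" "trajectory 1 t0 b u t"] dk he by simp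
      qed
    qed
    show "guard \<alpha> q (trajectory \<alpha> t0 a (grid \<alpha> t0 h (Z u)) q) (trajectory 1 t0 b u q) V (\<lambda>_. True)"
      if q: "\<sigma> u = Some q" for q
    proof -
      let ?k = "\<kappa> u"
      have r: "trajectory \<alpha> t0 a (grid \<alpha> t0 h (Z u)) q = A u ?k"
        using G(2)[OF u, of "Suc ?k"] \<sigma>D[OF q] unfolding Z_def by simp
      have yq: "trajectory 1 t0 b u q = y u (Suc ?k)" using \<sigma>D[OF q] unfolding y_def by simp
      have "dl (A u ?k) (y u (Suc ?k)) \<le> dl (A u ?k) (y u ?k) + dl (y u ?k) (y u (Suc ?k))"
        by (rule dl_triangle[OF AX yX[OF u] yX[OF u]])
      also have "\<dots> \<le> (\<beta> + 1) * h + h"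
        using \<kappa>(1)[OF q] dlyS[OF u, of ?k] unfolding act_def by simp
      also have "\<dots> = (\<beta> + 2) * h" by (simp add: algebra_simps)
      finally have "dl (A u ?k) (y u (Suc ?k)) / (\<alpha> - 1) \<le> c1 * h"
        unfolding c1_def using \<alpha> by (simp add: divide_right_mono)
      note far = this
      show ?thesis unfolding r yq
      proof (rule guard_trail[OF \<alpha> AX yX[OF u]])
        fix z assume z: "z \<in> X" "dist (y u (Suc ?k)) z \<le> dl (A u ?k) (y u (Suc ?k)) / (\<alpha> - 1)"
        show "z \<in> V"
        proof (rule V[OF conjunct1[OF nested[OF u \<kappa>(2)[OF q]]] z(1)])
          have "dist (y u ?k) z \<le> dist (y u ?k) (y u (Suc ?k)) + dist (y u (Suc ?k)) z" by (rule dist_triangle)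
          also have "\<dots> \<le> h + c1 * h"
            using dl_ge_dist[of "y u ?k" "y u (Suc ?k)"] dlyS[OF u, of ?k] z(2) far by simp
          finally show "dist (y u ?k) z \<le> e" using h(2) by simp
        qed
      qed
    qed
  qed simp
qed

end

section \<open>Evaders that start straight\<close>

definition heads :: "real \<Rightarrow> plane \<Rightarrow> (real \<Rightarrow> plane) \<Rightarrow> plane \<Rightarrow> bool" where
  "heads t0 b u w \<longleftrightarrow> (\<exists>e>0. trajectory 1 t0 b u (t0 + e) = b + e *\<^sub>R w)"

context corner begin

text \<open>At unit speed a distance t is covered in time t only along the segment. One instant thus
  determines the whole initial piece, so \<open>heads\<close> can refer to a single time.\<close>

lemma straight_prefix:
  assumes u: "u \<in> controls t0" and w: "norm w = 1" and r: "0 \<le> r" "r \<le> t"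
    and y: "trajectory 1 t0 b u (t0 + t) = b + t *\<^sub>R w"
  shows "trajectory 1 t0 b u (t0 + r) = b + r *\<^sub>R w"
proof (cases "t = 0")
  case True
  then show ?thesis using r by simp
next
  case False
  then have t: "0 < t" using r by simp
  have "trajectory 1 t0 b u (t0 + r) = b + r *\<^sub>R sgn ((b + t *\<^sub>R w) - b)"
  proof (rule point_on_segment)
    show "norm (trajectory 1 t0 b u (t0 + r) - b) \<le> r"
      using traj_dist[OF u order_refl, of "t0 + r" 1 b] r by (simp add: dist_norm norm_minus_commute)
    show "norm ((b + t *\<^sub>R w) - trajectory 1 t0 b u (t0 + r)) \<le> t - r"
      using traj_dist[OF u, of "t0 + t" "t0 + r" 1 b] r unfolding y by (simp add: dist_norm)
    show "norm ((b + t *\<^sub>R w) - b) = r + (t - r)" using t w by simp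
    have "w \<noteq> 0" using w by force
    then show "b + t *\<^sub>R w \<noteq> b" using t by simp
  qed
  also have "sgn ((b + t *\<^sub>R w) - b) = w" using t w by (simp add: sgn_scaleR sgn_div_norm)
  finally show ?thesis .
qed

lemma heads_unique:
  assumes "u \<in> controls t0" "norm w = 1" "norm w' = 1" "heads t0 b u w" "heads t0 b u w'" shows "w = w'"
proof -
  obtain d e where d: "0 < d" "trajectory 1 t0 b u (t0 + d) = b + d *\<^sub>R w"
    and e: "0 < e" "trajectory 1 t0 b u (t0 + e) = b + e *\<^sub>R w'"
    using assms(4,5) unfolding heads_def by blast
  have "trajectory 1 t0 b u (t0 + min d e) = b + min d e *\<^sub>R w"
    by (rule straight_prefix[OF assms(1,2) _ _ d(2)]) (use d(1) e(1) in auto)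
  moreover have "trajectory 1 t0 b u (t0 + min d e) = b + min d e *\<^sub>R w'"
    by (rule straight_prefix[OF assms(1,3) _ _ e(2)]) (use d(1) e(1) in auto)
  ultimately have "min d e *\<^sub>R w = min d e *\<^sub>R w'" by (metis add_left_cancel)
  moreover have "min d e \<noteq> 0" using d(1) e(1) by simp
  ultimately show ?thesis by (metis scaleR_cancel_left)
qed

lemma heads_aeq:
  assumes "u \<in> controls t0" "norm w = 1" "heads t0 b u w" "t0 < t" "ae_eq t0 t u v" shows "heads t0 b v w"
proof -
  obtain d where d: "0 < d" "trajectory 1 t0 b u (t0 + d) = b + d *\<^sub>R w"
    using assms(3) unfolding heads_def by blast
  let ?e = "min d (t - t0)"
  have "trajectory 1 t0 b u (t0 + ?e) = b + ?e *\<^sub>R w"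
    using d assms(4) by (intro straight_prefix[OF assms(1,2) _ _ d(2)]) auto
  moreover have "trajectory 1 t0 b u (t0 + ?e) = trajectory 1 t0 b v (t0 + ?e)"
    by (rule traj_aeq[OF assms(5)]) simp
  ultimately show ?thesis unfolding heads_def using d(1) assms(4) by (intro exI[of _ ?e]) simp
qed

text \<open>The condition on the state is put into the predicate on controls, so that the statement
  holds for every state. \<open>guard_concat\<close> asks for a continuation after every control,
  including those for which nothing has been achieved.\<close>

lemma guard_inner:
  assumes "1 < \<alpha>" "a \<in> X" "closed (X - V)"
  shows "guard \<alpha> t0 a b V (\<lambda>_. a \<noteq> b \<longrightarrow> good \<alpha> a b \<and> Cl \<alpha> a b \<subseteq> V)"
proof (cases "a = b")
  case True
  then show ?thesis using guard_captured[OF assms(2)] assms(1) by simp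
next
  case False
  show ?thesis
  proof (cases "good \<alpha> a b \<and> Cl \<alpha> a b \<subseteq> V")
    case True
    then obtain \<beta> e where m: "1 < \<beta>" "\<beta> < \<alpha>" "good \<beta> a b" "0 < e"
      "\<forall>z\<in>Dom \<beta> a b. \<forall>y\<in>X. dist z y \<le> e \<longrightarrow> y \<in> V" using margin[OF _ assms(3)] by blast
    show ?thesis by (rule guard_margin[OF m(1-4)]) (use m(5) in blast)
  next
    case n: False
    have "guard \<alpha> t0 a b V (\<lambda>_. False)" using guard_vacuous[OF assms(2)] assms(1) by simp
    then show ?thesis by (rule guard_mono) (use n False in blast)+
  qed
qed

text \<open>After the law has been followed for the time s1 the regions are nested. A point z
  outside V that is still in the new closed region is an equality case of the law, which means that
  the evader has run straight at z for the whole time. For all other evaders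
  \<open>guard_inner\<close> takes over.\<close>

lemma guard_local:
  assumes g: "good \<alpha> a b" and V: "Dom \<alpha> a b \<subseteq> V" "closed (X - V)"
  shows "guard \<alpha> t0 a b V (\<lambda>u. \<forall>z\<in>Bd \<alpha> a b. z \<notin> V \<longrightarrow> \<not> heads t0 b u (sgn (z - b)))"
proof -
  note gd = goodD[OF g]
  let ?E = "admissible_controls X 1 t0 b"
  obtain U s0 where L: "local_law \<alpha> a b U s0" using local_law_exists[OF g] by blast
  have s0: "0 < s0" and U: "continuous_on (sphere 0 1) U" "\<And>v. norm v = 1 \<Longrightarrow> norm (U v) = 1"
    using L unfolding local_law_def by blast+
  have law: "a + \<alpha> *\<^sub>R K \<in> X" "x \<in> Bd \<alpha> a b \<Longrightarrow> dl x (a + \<alpha> *\<^sub>R K) \<le> \<alpha> * norm (x - (b + I))"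
    "x \<in> Bd \<alpha> a b \<Longrightarrow> dl x (a + \<alpha> *\<^sub>R K) = \<alpha> * norm (x - (b + I)) \<Longrightarrow> I = t *\<^sub>R sgn (x - b)"
    if "0 \<le> t" "t \<le> s0" "avg U t I K" for t I K x
    using L that unfolding local_law_def by blast+
  define d where "d = dl a b / (\<alpha> + 1)"
  have d: "0 < d" unfolding d_def using dl_pos[OF gd(4)] gd(1) by simp
  define s1 where "s1 = min s0 (d / 2)"
  have s1: "0 < s1" "s1 \<le> s0" "s1 < d" unfolding s1_def using s0 d by auto
  let ?q = "t0 + s1"
  define D where "D u = (\<lambda>r. U (u r))" for u :: "real \<Rightarrow> plane"
  have Dctl: "D u \<in> controls t0" if "u \<in> ?E" for u
    unfolding D_def by (rule controls_compose[OF admissibleD(1)[OF that] U])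
  have av: "avg U (t - t0) (integral {t0..t} u) (integral {t0..t} (D u))" if "u \<in> ?E" "t0 \<le> t" for u t
    unfolding D_def by (rule avg_control[OF admissibleD(1)[OF that(1)] that(2) U])
  have yD: "trajectory 1 t0 b u t \<in> Dom \<alpha> a b" if u: "u \<in> ?E" "t0 \<le> t" "t \<le> ?q" for u t
  proof (rule near_Dom[OF gd(1-3) admissibleD(2)[OF u(1,2)]])
    show "dl b (trajectory 1 t0 b u t) < dl a b / (\<alpha> + 1)"
      using traj_dl[OF u(1) order_refl u(2)] u(3) s1(3) by (simp add: d_def)
  qed
  have xX: "trajectory \<alpha> t0 a (D u) t \<in> X" if u: "u \<in> ?E" "t0 \<le> t" "t \<le> ?q" for u t
    unfolding trajectory_def by (rule law(1)[OF _ _ av[OF u(1,2)]]) (use u s1(2) in auto)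
  define Q where "Q q r y u \<longleftrightarrow> (r \<noteq> y \<longrightarrow> good \<alpha> r y \<and> Cl \<alpha> r y \<subseteq> V)" for q :: real and r y and u :: "real \<Rightarrow> plane"
  show ?thesis
  proof (rule guard_concat[where \<delta> = D and \<sigma> = "\<lambda>_. Some ?q" and Q = Q])
    fix u assume u: "u \<in> ?E"
    show "D u \<in> controls t0" by (rule Dctl[OF u])
    show "trajectory \<alpha> t0 a (D u) t \<in> X" if "t0 \<le> t" "\<And>q. Some ?q = Some q \<Longrightarrow> t \<le> q" for t
      using xX[OF u that(1)] that(2) by blast
    show "t0 \<le> q" if "Some ?q = Some q" for q using that s1(1) by simp
    show "ae_eq t0 t (D u) (D v)" if "ae_eq t0 t u v" for v t unfolding D_def by (rule ae_eq_compose[OF that])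
    show "Some ?q = Some q" if "Some ?q = Some q" for q by (rule that)
    show "trajectory 1 t0 b u t \<in> V" if "t0 \<le> t" "\<And>q. Some ?q = Some q \<Longrightarrow> t < q" for t
      using yD[OF u that(1) less_imp_le] that(2) V(1) by blast
    show "guard \<alpha> q (trajectory \<alpha> t0 a (D u) q) (trajectory 1 t0 b u q) V
        (Q q (trajectory \<alpha> t0 a (D u) q) (trajectory 1 t0 b u q))" if "Some ?q = Some q" for q
      unfolding Q_def by (rule guard_inner[OF gd(1) xX[OF u] V(2)]) (use that s1(1) in auto)
    show "Q q (trajectory \<alpha> t0 a (D u) q) (trajectory 1 t0 b u q) u"
      if q: "Some ?q = Some q" and P: "\<forall>z\<in>Bd \<alpha> a b. z \<notin> V \<longrightarrow> \<not> heads t0 b u (sgn (z - b))" for q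
      unfolding Q_def
    proof
      have q': "q = ?q" "t0 \<le> q" "q \<le> ?q" using q s1(1) by auto
      let ?r = "trajectory \<alpha> t0 a (D u) q" and ?y = "trajectory 1 t0 b u q"
      let ?I = "integral {t0..q} u" and ?K = "integral {t0..q} (D u)"
      have r: "?r = a + \<alpha> *\<^sub>R ?K" and y: "?y = b + ?I" unfolding trajectory_def by simp_all
      have lw: "dl x ?r \<le> \<alpha> * norm (x - ?y)" "dl x ?r = \<alpha> * norm (x - ?y) \<Longrightarrow> ?I = s1 *\<^sub>R sgn (x - b)"
        if "x \<in> Bd \<alpha> a b" for x
        using law(2,3)[OF _ s1(2) _ that, of ?I ?K] s1(1) av[OF u q'(2)] q'(1) unfolding r y by simp_all
      have sub: "Dom \<alpha> ?r ?y \<subseteq> Dom \<alpha> a b"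
      proof (rule nested[OF g xX[OF u q'(2,3)] yD[OF u q'(2,3)]])
        fix x assume x: "x \<in> Bd \<alpha> a b"
        have "norm (x - ?y) \<le> dl x ?y" using dl_ge_dist[of x ?y] by (simp add: dist_norm)
        then have "\<alpha> * norm (x - ?y) \<le> \<alpha> * dl x ?y" using gd(1) by simp
        then show "dl x ?r \<le> \<alpha> * dl x ?y" using lw(1)[OF x] by linarith
      qed
      assume ne: "?r \<noteq> ?y"
      have g1: "good \<alpha> ?r ?y"
        by (rule nested_good[OF g xX[OF u q'(2,3)] admissibleD(2)[OF u q'(2)] ne sub])
      have "z \<in> V" if z: "z \<in> Cl \<alpha> ?r ?y" for z
      proof (rule ccontr)
        assume nV: "z \<notin> V"
        have zX: "z \<in> X" by (rule Cl_X[OF z])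
        have "z \<in> Cl \<alpha> a b" using Cl_mono[OF g g1 sub] z by (rule subsetD)
        moreover have "z \<notin> Dom \<alpha> a b" using V(1) nV by (rule contra_subsetD)
        ultimately have zB: "z \<in> Bd \<alpha> a b" unfolding Cl_def Dom_def Bd_def using zX by simp
        have "\<alpha> * norm (z - ?y) \<le> \<alpha> * dl z ?y"
          using dl_ge_dist[of z ?y] gd(1) by (simp add: dist_norm)
        also have "\<dots> \<le> dl z ?r" using z unfolding Cl_def by simp
        finally have "?I = s1 *\<^sub>R sgn (z - b)" using lw[OF zB] by simp
        then have "trajectory 1 t0 b u (t0 + s1) = b + s1 *\<^sub>R sgn (z - b)" using y q'(1) by simp
        then have "heads t0 b u (sgn (z - b))" unfolding heads_def using s1(1) by blast
        then show False using P zB nV by blast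
      qed
      then show "good \<alpha> ?r ?y \<and> Cl \<alpha> ?r ?y \<subseteq> V" using g1 by blast
    qed
  qed
qed

end

lemma norm_scaleR_sgn: "norm z *\<^sub>R sgn z = z" for z :: "'a::real_normed_vector"
  by (cases "z = 0") (simp_all add: sgn_div_norm)

context corner begin

text \<open>The evader heads straight for the boundary point x exactly up to time \<open>t0 + \<tau>\<close>, or until the pursuer's
  first geodesic segment is used up.\<close>
definition run :: "real \<Rightarrow> real \<Rightarrow> plane \<Rightarrow> plane \<Rightarrow> (real \<Rightarrow> plane) \<Rightarrow> plane \<Rightarrow> real \<Rightarrow> bool" where
  "run \<alpha> t0 a b u x \<tau> \<longleftrightarrow> x \<in> Bd \<alpha> a b \<and> 0 < \<tau> \<and> \<tau> \<le> run_length \<alpha> a b x \<and>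
     trajectory 1 t0 b u (t0 + \<tau>) = b + \<tau> *\<^sub>R sgn (x - b) \<and>
     (\<forall>r. \<tau> < r \<longrightarrow> r \<le> run_length \<alpha> a b x \<longrightarrow> trajectory 1 t0 b u (t0 + r) \<noteq> b + r *\<^sub>R sgn (x - b))"

lemma runD:
  assumes "run \<alpha> t0 a b u x \<tau>"
  shows "x \<in> Bd \<alpha> a b" "0 < \<tau>" "\<tau> \<le> run_length \<alpha> a b x" "trajectory 1 t0 b u (t0 + \<tau>) = b + \<tau> *\<^sub>R sgn (x - b)"
    "\<And>r. \<tau> < r \<Longrightarrow> r \<le> run_length \<alpha> a b x \<Longrightarrow> trajectory 1 t0 b u (t0 + r) \<noteq> b + r *\<^sub>R sgn (x - b)"
    "heads t0 b u (sgn (x - b))"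
  using assms unfolding run_def heads_def by blast+

text \<open>The durations of straight motion within the run length form a compact set, whose maximum
  is attained.\<close>

lemma run_exists:
  assumes g: "good \<alpha> a b" and u: "u \<in> controls t0" and x: "x \<in> Bd \<alpha> a b" and h: "heads t0 b u (sgn (x - b))"
  shows "\<exists>\<tau>. run \<alpha> t0 a b u x \<tau>"
proof -
  let ?w = "sgn (x - b)"
  have w: "norm ?w = 1" by (rule Bd_facts(5)[OF g x])
  have R: "0 < run_length \<alpha> a b x" by (rule run_length_le(1)[OF g x])
  let ?f = "\<lambda>r. trajectory 1 t0 b u (t0 + r) - (b + r *\<^sub>R ?w)"
  let ?S = "{0..run_length \<alpha> a b x} \<inter> ?f -` {0}"
  obtain e where e: "0 < e" "trajectory 1 t0 b u (t0 + e) = b + e *\<^sub>R ?w" using h unfolding heads_def by blast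
  let ?e = "min e (run_length \<alpha> a b x)"
  have "trajectory 1 t0 b u (t0 + ?e) = b + ?e *\<^sub>R ?w"
    using e R by (intro straight_prefix[OF u w _ _ e(2)]) auto
  then have eS: "?e \<in> ?S" using e R by simp
  have "continuous_on {0..run_length \<alpha> a b x} (\<lambda>r. trajectory 1 t0 b u (t0 + r))"
    by (rule continuous_on_compose2[OF traj_continuous[OF u]]) (auto intro!: continuous_intros)
  then have "continuous_on {0..run_length \<alpha> a b x} ?f" by (intro continuous_intros)
  then have "closed ?S" by (intro continuous_closed_preimage) auto
  moreover have "bounded ?S" by (rule bounded_subset[OF bounded_closed_interval[of 0 "run_length \<alpha> a b x"]]) auto
  ultimately have cp: "compact ?S" by (simp only: compact_eq_bounded_closed simp_thms)
  have "\<exists>r. r \<in> ?S" using eS by (rule exI)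
  then have ne: "?S \<noteq> {}" unfolding ex_in_conv .
  from compact_attains_sup[OF cp ne] obtain \<tau> where \<tau>: "\<tau> \<in> ?S" "\<forall>r\<in>?S. r \<le> \<tau>" by (rule bexE)
  have "run \<alpha> t0 a b u x \<tau>"
    unfolding run_def
  proof (intro conjI allI impI x)
    have "?e \<le> \<tau>" using \<tau>(2) eS by (rule bspec)
    then show "0 < \<tau>" using e(1) R by simp
    then show "\<tau> \<le> run_length \<alpha> a b x" "trajectory 1 t0 b u (t0 + \<tau>) = b + \<tau> *\<^sub>R ?w"
      using \<tau>(1) by (simp_all add: algebra_simps)
    fix r assume r: "\<tau> < r" "r \<le> run_length \<alpha> a b x"
    then have "r \<notin> ?S" using \<tau>(2) by (meson not_less)
    then show "trajectory 1 t0 b u (t0 + r) \<noteq> b + r *\<^sub>R ?w" using r \<open>0 < \<tau>\<close> by auto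
  qed
  then show ?thesis by blast
qed

lemma run_unique:
  assumes g: "good \<alpha> a b" and u: "u \<in> controls t0" and r: "run \<alpha> t0 a b u x \<tau>" "run \<alpha> t0 a b u x' \<tau>'"
  shows "x = x'" "\<tau> = \<tau>'"
proof -
  note d = runD[OF r(1)] and d' = runD[OF r(2)]
  have "sgn (x - b) = sgn (x' - b)"
    by (rule heads_unique[OF u Bd_facts(5)[OF g d(1)] Bd_facts(5)[OF g d'(1)] d(6) d'(6)])
  then show x: "x = x'" by (rule Bd_ray_unique[OF g d'(1) d(1)])
  show "\<tau> = \<tau>'"
    using d(3-5) d'(3-5) unfolding x by (meson linorder_neqE_linordered_idom)
qed

text \<open>A deviation after \<tau> shows at once, since by \<open>straight_prefix\<close> the
  evader cannot be back on schedule later. Any longer initial piece of the control therefore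
  determines the run.\<close>

lemma run_aeq:
  assumes g: "good \<alpha> a b" and u: "u \<in> controls t0" and v: "v \<in> controls t0"
    and r: "run \<alpha> t0 a b u x \<tau>" and t: "t0 + \<tau> < t" and uv: "ae_eq t0 t u v"
  shows "run \<alpha> t0 a b v x \<tau>"
proof -
  note d = runD[OF r]
  let ?w = "sgn (x - b)"
  have eq: "trajectory 1 t0 b u (t0 + q) = trajectory 1 t0 b v (t0 + q)" if "q \<le> t - t0" for q
    by (rule traj_aeq[OF uv]) (use that in simp)
  have "trajectory 1 t0 b v (t0 + q) \<noteq> b + q *\<^sub>R ?w" if q: "\<tau> < q" "q \<le> run_length \<alpha> a b x" for q
  proof
    assume y: "trajectory 1 t0 b v (t0 + q) = b + q *\<^sub>R ?w"
    let ?q = "min q (t - t0)"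
    have "trajectory 1 t0 b v (t0 + ?q) = b + ?q *\<^sub>R ?w"
      using q d(2) t by (intro straight_prefix[OF v Bd_facts(5)[OF g d(1)] _ _ y]) auto
    moreover have "trajectory 1 t0 b u (t0 + ?q) \<noteq> b + ?q *\<^sub>R ?w" by (rule d(5)) (use q t in auto)
    ultimately show False using eq[of ?q] by simp
  qed
  moreover have "trajectory 1 t0 b v (t0 + \<tau>) = b + \<tau> *\<^sub>R ?w" using eq[of \<tau>] t d(4) by simp
  ultimately show ?thesis unfolding run_def using d(1-3) by blast
qed

lemma run_points:
  assumes g: "good \<alpha> a b" and u: "u \<in> controls t0" and r: "run \<alpha> t0 a b u x \<tau>" and t: "t0 \<le> t" "t \<le> t0 + \<tau>"
  shows "trajectory 1 t0 b u t = b + (t - t0) *\<^sub>R sgn (x - b)"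
    "trajectory \<alpha> t0 a (\<lambda>_. aim a x) t = a + (\<alpha> * (t - t0)) *\<^sub>R aim a x"
    "trajectory \<alpha> t0 a (\<lambda>_. aim a x) t \<in> X"
proof -
  note d = runD[OF r] note rl = run_length_le[OF g d(1)] and bf = Bd_facts[OF g d(1)]
  show "trajectory 1 t0 b u t = b + (t - t0) *\<^sub>R sgn (x - b)"
    using straight_prefix[OF u bf(5) _ _ d(4), of "t - t0"] t by simp
  show tr: "trajectory \<alpha> t0 a (\<lambda>_. aim a x) t = a + (\<alpha> * (t - t0)) *\<^sub>R aim a x"
    by (rule traj_const[OF t(1)])
  show "trajectory \<alpha> t0 a (\<lambda>_. aim a x) t \<in> X"
  proof (cases "t - t0 < norm (x - b)")
    case True
    show ?thesis unfolding tr by (rule straight_run(1)[OF g d(1) _ _ True]) (use t d(3) in auto)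
  next
    case False
    then have e: "t - t0 = norm (x - b)" "run_length \<alpha> a b x = norm (x - b)" using t(2) d(3) rl(2) by auto
    then have nb: "\<not> blocked x a" using rl(3) by fastforce
    have "\<alpha> * (t - t0) = norm (x - a)" unfolding e(1) using bf(4) dl_unblocked[OF nb] by (simp add: dist_norm)
    then have "trajectory \<alpha> t0 a (\<lambda>_. aim a x) t = x" unfolding tr unfolding aim_def using nb by (simp add: norm_scaleR_sgn)
    then show ?thesis using Cl_X[OF Bd_Cl[OF d(1)]] by simp
  qed
qed

text \<open>The outcomes are capture at x, arrival of the pursuer at the vertex, or a deviation of
  the evader. In the last case x is the only point of the new boundary that can be outside V,
  because all others were gained strictly at the start and nested regions never give a point back.
  By maximality of \<tau> the evader does not continue towards x.\<close>

lemma run_end: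
  assumes g: "good \<alpha> a b" and u: "u \<in> admissible_controls X 1 t0 b" and V: "Dom \<alpha> a b \<subseteq> V"
    and r: "run \<alpha> t0 a b u x \<tau>"
  defines "p \<equiv> trajectory \<alpha> t0 a (\<lambda>_. aim a x) (t0 + \<tau>)" and "y \<equiv> trajectory 1 t0 b u (t0 + \<tau>)"
  shows "p = y \<or> (p = 0 \<and> blocked x a \<and> good \<alpha> 0 y \<and> Dom \<alpha> 0 y \<subseteq> V) \<or>
    (good \<alpha> p y \<and> Dom \<alpha> p y \<subseteq> V \<and> (\<forall>z\<in>Bd \<alpha> p y. z \<notin> V \<longrightarrow> \<not> heads (t0 + \<tau>) y u (sgn (z - y))))"
proof -
  note u' = admissibleD[OF u]
  note gd = goodD[OF g]
  note d = runD[OF r] note rl = run_length_le[OF g d(1)] and bf = Bd_facts[OF g d(1)]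
  let ?w = "sgn (x - b)"
  have \<tau>0: "0 \<le> \<tau>" using d(2) by simp
  have p: "p = a + (\<alpha> * \<tau>) *\<^sub>R aim a x" and y: "y = b + \<tau> *\<^sub>R ?w"
    using run_points(1,2)[OF g u'(1) r, of "t0 + \<tau>"] \<tau>0 unfolding p_def y_def by simp_all
  show ?thesis
  proof (cases "\<tau> = norm (x - b)")
    case True
    then have "run_length \<alpha> a b x = norm (x - b)" using d(3) rl(2) by simp
    then have nb: "\<not> blocked x a" using rl(3) by fastforce
    have "\<alpha> * \<tau> = norm (x - a)" unfolding True using bf(4) dl_unblocked[OF nb] by (simp add: dist_norm)
    then have "p = x" unfolding p aim_def using nb by (simp add: norm_scaleR_sgn)
    moreover have "y = x" unfolding y True using bf(6) by simp
    ultimately show ?thesis by simp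
  next
    case False
    then have lt: "\<tau> < norm (x - b)" using d(3) rl(2) by simp
    have sub: "Dom \<alpha> p y \<subseteq> Dom \<alpha> a b" unfolding p y by (rule straight_run(2)[OF g d(1) \<tau>0 d(3) lt])
    have yD: "y \<in> Dom \<alpha> a b" unfolding y by (rule straight_points(1)[OF g d(1) \<tau>0 lt])
    then have yX: "y \<in> X" unfolding Dom_def by simp
    show ?thesis
    proof (cases "\<tau> = run_length \<alpha> a b x")
      case True
      then have bl: "blocked x a" using lt unfolding run_length_def by (metis less_irrefl)
      then have "\<alpha> * \<tau> = norm a" unfolding True run_length_def using gd(1) by simp
      then have p0: "p = 0" unfolding p aim_def using bl norm_scaleR_sgn[of "- a"] by simp
      have "0 \<noteq> y" using zero_notin_Dom[OF g] yD by metis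
      moreover have "(0::plane) \<in> X" using scale_X[OF gd(2), of 0] by simp
      ultimately have "good \<alpha> 0 y" using nested_good[OF g _ yX _ sub] unfolding p0 by blast
      then show ?thesis using p0 bl sub V by blast
    next
      case False
      then have ltr: "\<tau> < run_length \<alpha> a b x" using d(3) by simp
      note st = straight_state[OF g d(1) \<tau>0 ltr, folded p y]
      have only: "z = x" if z: "z \<in> Bd \<alpha> p y" "z \<notin> V" for z
      proof (rule ccontr)
        assume ne: "z \<noteq> x"
        obtain e where e: "0 < e" "\<forall>t. 0 < t \<longrightarrow> t \<le> e \<longrightarrow> (\<forall>z\<in>Bd \<alpha> a b. z \<noteq> x \<longrightarrow>
            dl z (a + (\<alpha> * t) *\<^sub>R aim a x) < \<alpha> * norm (z - (b + t *\<^sub>R ?w)))"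
          using strict_start[OF g d(1)] by blast
        \<comment> \<open>An early intermediate state: \<open>strict_start\<close> excludes z from
          its closed region, and the rest of the run only shrinks that region.\<close>
        define q where "q = min e \<tau>"
        have q: "0 < q" "q \<le> e" "q \<le> \<tau>" unfolding q_def using e(1) d(2) by auto
        define a1 where "a1 = a + (\<alpha> * q) *\<^sub>R aim a x"
        define b1 where "b1 = b + q *\<^sub>R ?w"
        have q0: "0 \<le> q" and qr: "q < run_length \<alpha> a b x" using q ltr by auto
        note s1 = straight_state[OF g d(1) q0 qr, folded a1_def b1_def]
        have sub1: "Dom \<alpha> a1 b1 \<subseteq> Dom \<alpha> a b"
          unfolding a1_def b1_def by (rule straight_run(2)[OF g d(1) q0]) (use qr rl(2) in auto)
        have "Dom \<alpha> (a1 + (\<alpha> * (\<tau> - q)) *\<^sub>R aim a1 x) (b1 + (\<tau> - q) *\<^sub>R sgn (x - b1)) \<subseteq> Dom \<alpha> a1 b1"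
          by (rule straight_run(2)[OF s1(1,2)]) (use q ltr lt in \<open>auto simp: s1(5,6)\<close>)
        moreover have "a1 + (\<alpha> * (\<tau> - q)) *\<^sub>R aim a1 x = p"
          unfolding s1(3) unfolding a1_def p by (simp add: algebra_simps)
        moreover have "b1 + (\<tau> - q) *\<^sub>R sgn (x - b1) = y"
          unfolding s1(4) unfolding b1_def y by (simp add: algebra_simps)
        ultimately have sub2: "Dom \<alpha> p y \<subseteq> Dom \<alpha> a1 b1" by simp
        have z1: "z \<in> Cl \<alpha> a1 b1" using Cl_mono[OF s1(1) st(1) sub2] Bd_Cl[OF z(1)] by (rule subsetD)
        then have z0: "z \<in> Cl \<alpha> a b" using Cl_mono[OF g s1(1) sub1] by (metis subsetD)
        have "z \<notin> Dom \<alpha> a b" using V z(2) by (rule contra_subsetD)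
        then have "z \<in> Bd \<alpha> a b" using z0 unfolding Cl_def Dom_def Bd_def by simp
        then have "dl z a1 < \<alpha> * norm (z - b1)" using e(2) q ne unfolding a1_def b1_def by blast
        also have "\<dots> \<le> \<alpha> * dl z b1" using dl_ge_dist[of z b1] gd(1) by (simp add: dist_norm)
        also have "\<dots> \<le> dl z a1" using z1 unfolding Cl_def by simp
        finally show False by simp
      qed
      have "\<not> heads (t0 + \<tau>) y u (sgn (x - y))"
      proof
        assume "heads (t0 + \<tau>) y u (sgn (x - y))"
        then obtain e where e: "0 < e" "trajectory 1 (t0 + \<tau>) y u (t0 + \<tau> + e) = y + e *\<^sub>R ?w"
          unfolding heads_def st(4) by blast
        let ?e = "min e (run_length \<alpha> a b x - \<tau>)"
        have e': "0 < ?e" using e(1) ltr by simp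
        have uc: "u \<in> controls (t0 + \<tau>)" by (rule controls_mono[OF u'(1)]) (use \<tau>0 in simp)
        have "trajectory 1 (t0 + \<tau>) y u (t0 + \<tau> + ?e) = y + ?e *\<^sub>R ?w"
          using e' by (intro straight_prefix[OF uc bf(5) _ _ e(2)]) auto
        moreover have "trajectory 1 (t0 + \<tau>) y u (t0 + \<tau> + ?e) = trajectory 1 t0 b u (t0 + \<tau> + ?e)"
          unfolding y_def by (rule traj_split[OF u'(1)]) (use \<tau>0 e' in auto)
        ultimately have "trajectory 1 t0 b u (t0 + (\<tau> + ?e)) = b + (\<tau> + ?e) *\<^sub>R ?w"
          unfolding y by (simp add: algebra_simps)
        moreover have "trajectory 1 t0 b u (t0 + (\<tau> + ?e)) \<noteq> b + (\<tau> + ?e) *\<^sub>R ?w"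
          by (rule d(5)) (use e' in auto)
        ultimately show False by contradiction
      qed
      then show ?thesis using st(1) sub V only by (metis subset_trans)
    qed
  qed
qed

text \<open>The hypothesis \<open>apex\<close> takes over when the pursuer reaches the vertex; it is void for a pursuer that
  already stands there.\<close>
lemma guard_step:
  assumes g: "good \<alpha> a b" and V: "Dom \<alpha> a b \<subseteq> V" "closed (X - V)"
    and apex: "\<And>x q y. blocked x a \<Longrightarrow> good \<alpha> 0 y \<Longrightarrow> Dom \<alpha> 0 y \<subseteq> V \<Longrightarrow> guard \<alpha> q 0 y V (\<lambda>_. True)"
  shows "guard \<alpha> t0 a b V (\<lambda>_. True)"
proof -
  note gd = goodD[OF g]
  let ?E = "admissible_controls X 1 t0 b"
  define M where "M u = (SOME m. run \<alpha> t0 a b u (fst m) (snd m))" for u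
  define G where "G u \<longleftrightarrow> (\<exists>x \<tau>. run \<alpha> t0 a b u x \<tau>)" for u
  \<comment> \<open>An evader that heads for no boundary point is handed over at time t0, so the
    direction (-1, 0) is never acted upon.\<close>
  define D where "D u = (\<lambda>_::real. if G u then aim a (fst (M u)) else (-1, 0))" for u
  define S where "S u = (if G u then t0 + snd (M u) else t0)" for u
  define Q where "Q q r y u \<longleftrightarrow> guard \<alpha> q r y V (\<lambda>_. True) \<or> r = y \<or>
    (good \<alpha> r y \<and> Dom \<alpha> r y \<subseteq> V \<and> (\<forall>z\<in>Bd \<alpha> r y. z \<notin> V \<longrightarrow> \<not> heads q y u (sgn (z - y))))"
    for q r y u
  have M: "M u = (x, \<tau>)" if u: "u \<in> ?E" and r: "run \<alpha> t0 a b u x \<tau>" for u x \<tau>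
  proof -
    have "run \<alpha> t0 a b u (fst (M u)) (snd (M u))"
      unfolding M_def by (rule someI[of "\<lambda>m. run \<alpha> t0 a b u (fst m) (snd m)" "(x, \<tau>)"]) (simp add: r)
    from run_unique[OF g admissibleD(1)[OF u] r this] show ?thesis by (simp add: prod_eq_iff)
  qed
  have DS: "D u = (\<lambda>_. aim a x)" "S u = t0 + \<tau>" if "u \<in> ?E" "run \<alpha> t0 a b u x \<tau>" for u x \<tau>
  proof -
    have "G u" using that(2) unfolding G_def by blast
    then show "D u = (\<lambda>_. aim a x)" "S u = t0 + \<tau>" unfolding D_def S_def M[OF that] by simp_all
  qed
  have DS0: "D u = (\<lambda>_. (-1, 0))" "S u = t0" if "\<not> G u" for u
    using that unfolding D_def S_def by simp_all
  have headsG: "G u" if "u \<in> ?E" "x \<in> Bd \<alpha> a b" "heads t0 b u (sgn (x - b))" for u x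
    using run_exists[OF g admissibleD(1)[OF that(1)] that(2,3)] unfolding G_def by blast
  have transfer: "\<exists>\<tau>'. run \<alpha> t0 a b v x \<tau>'"
    if "u \<in> ?E" "v \<in> ?E" "run \<alpha> t0 a b u x \<tau>" "t0 < t" "ae_eq t0 t u v" for u v x \<tau> t
    using run_exists[OF g admissibleD(1)[OF that(2)] runD(1)[OF that(3)]]
      heads_aeq[OF admissibleD(1)[OF that(1)] Bd_facts(5)[OF g runD(1)[OF that(3)]] runD(6)[OF that(3)] that(4,5)]
    by blast
  have ctl: "D u \<in> controls t0" if u: "u \<in> ?E" for u
  proof (cases "G u")
    case True
    then obtain x \<tau> where r: "run \<alpha> t0 a b u x \<tau>" unfolding G_def by blast
    show ?thesis unfolding DS(1)[OF u r] by (rule controls_const[OF aim_norm[OF g runD(1)[OF r]]])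
  next
    case False
    show ?thesis unfolding DS0(1)[OF False] by (rule controls_const) (simp add: norm_Pair)
  qed
  have t0S: "t0 \<le> S u" if u: "u \<in> ?E" for u
  proof (cases "G u")
    case True
    then obtain x \<tau> where r: "run \<alpha> t0 a b u x \<tau>" unfolding G_def by blast
    show ?thesis unfolding DS(2)[OF u r] using runD(2)[OF r] by simp
  qed (simp add: DS0(2))
  have inX: "trajectory \<alpha> t0 a (D u) t \<in> X" if u: "u \<in> ?E" and t: "t0 \<le> t" "t \<le> S u" for u t
  proof (cases "G u")
    case True
    then obtain x \<tau> where r: "run \<alpha> t0 a b u x \<tau>" unfolding G_def by blast
    show ?thesis unfolding DS(1)[OF u r]
      by (rule run_points(3)[OF g admissibleD(1)[OF u] r t(1)]) (use t(2) DS(2)[OF u r] in simp)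
  next
    case False
    then have "t = t0" using t DS0(2) by simp
    then show ?thesis using gd(2) by simp
  qed
  \<comment> \<open>A continuation is due at every end state. Where \<open>Q\<close> can hold, some
    earlier strategy applies; elsewhere the predicate is void and any legal motion will do.\<close>
  have fallback: "guard \<alpha> q r y V (Q q r y)" if r: "r \<in> X" for q r y
  proof (cases "guard \<alpha> q r y V (\<lambda>_. True) \<or> r = y")
    case True
    have "guard \<alpha> q r y V (\<lambda>_. True)" using True guard_captured[OF r] gd(1) by force
    then show ?thesis by (rule guard_mono) blast+
  next
    case n: False
    show ?thesis
    proof (cases "good \<alpha> r y \<and> Dom \<alpha> r y \<subseteq> V")
      case True
      show ?thesis
        by (rule guard_mono[OF guard_local[OF conjunct1[OF True] conjunct2[OF True] V(2)] order_refl])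
          (use n in \<open>unfold Q_def, blast\<close>)
    next
      case False
      have "guard \<alpha> q r y V (\<lambda>_. False)" using guard_vacuous[OF r] gd(1) by simp
      then show ?thesis
      proof (rule guard_mono[OF _ order_refl])
        show "False" if "Q q r y u" for u using that n False unfolding Q_def by metis
      qed
    qed
  qed
  show ?thesis
  proof (rule guard_concat[where \<delta> = D and \<sigma> = "\<lambda>u. Some (S u)" and Q = Q])
    fix u assume u: "u \<in> ?E"
    show "D u \<in> controls t0" by (rule ctl[OF u])
    show "trajectory \<alpha> t0 a (D u) t \<in> X" if "t0 \<le> t" "\<And>q. Some (S u) = Some q \<Longrightarrow> t \<le> q" for t
      using inX[OF u that(1)] that(2) by blast
    show "t0 \<le> q" if "Some (S u) = Some q" for q using that t0S[OF u] by simp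
    show "ae_eq t0 t (D u) (D v)"
      if v: "v \<in> ?E" and t: "t0 \<le> t" and uv: "ae_eq t0 t u v" and le: "\<And>q. Some (S u) = Some q \<Longrightarrow> t \<le> q" for v t
    proof (cases "t = t0")
      case True
      then show ?thesis by (intro ae_eq_eq) simp
    next
      case False
      then have lt: "t0 < t" using t by simp
      then have "t0 < S u" using le by fastforce
      then obtain x \<tau> where r: "run \<alpha> t0 a b u x \<tau>" using DS0(2)[of u] unfolding G_def by fastforce
      \<comment> \<open>The durations of the two runs may differ, but the target is the same, and
        before the first switch only the target matters.\<close>
      obtain \<tau>' where r': "run \<alpha> t0 a b v x \<tau>'" using transfer[OF u v r lt uv] by blast
      show ?thesis unfolding DS(1)[OF u r] DS(1)[OF v r'] by (rule ae_eq_eq) simp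
    qed
    show "Some (S v) = Some q"
      if v: "v \<in> ?E" and q: "Some (S u) = Some q" "q < t" and uv: "ae_eq t0 t u v" for v q t
    proof (cases "G u")
      case True
      then obtain x \<tau> where r: "run \<alpha> t0 a b u x \<tau>" unfolding G_def by blast
      have "t0 + \<tau> < t" using DS(2)[OF u r] q by simp
      then have "run \<alpha> t0 a b v x \<tau>" by (rule run_aeq[OF g admissibleD(1)[OF u] admissibleD(1)[OF v] r _ uv])
      then show ?thesis using DS(2)[OF v] DS(2)[OF u r] q(1) by simp
    next
      case False
      have lt: "t0 < t" using DS0(2)[OF False] q by simp
      have "\<not> G v"
      proof
        assume "G v"
        then obtain x \<tau> where "run \<alpha> t0 a b v x \<tau>" unfolding G_def by blast
        from transfer[OF v u this lt ae_eq_sym[OF uv]] show False using False unfolding G_def by blast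
      qed
      then show ?thesis using DS0(2) False q(1) by simp
    qed
    show "trajectory 1 t0 b u t \<in> V" if t: "t0 \<le> t" "\<And>q. Some (S u) = Some q \<Longrightarrow> t < q" for t
    proof -
      have lt: "t < S u" using t(2) by blast
      then obtain x \<tau> where r: "run \<alpha> t0 a b u x \<tau>" using t(1) DS0(2)[of u] unfolding G_def by fastforce
      note d = runD[OF r]
      have lt': "t < t0 + \<tau>" using lt DS(2)[OF u r] by simp
      have "t - t0 < norm (x - b)" using lt' d(3) run_length_le(2)[OF g d(1)] by simp
      then have "b + (t - t0) *\<^sub>R sgn (x - b) \<in> Dom \<alpha> a b" using t(1) by (intro straight_points(1)[OF g d(1)]) simp_all
      then show ?thesis using run_points(1)[OF g admissibleD(1)[OF u] r t(1) less_imp_le[OF lt']] V(1) by auto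
    qed
    show "guard \<alpha> q (trajectory \<alpha> t0 a (D u) q) (trajectory 1 t0 b u q) V
        (Q q (trajectory \<alpha> t0 a (D u) q) (trajectory 1 t0 b u q))" if "Some (S u) = Some q" for q
      by (rule fallback) (use inX[OF u t0S[OF u] order_refl] that in simp)
    show "Q q (trajectory \<alpha> t0 a (D u) q) (trajectory 1 t0 b u q) u" if q: "Some (S u) = Some q" for q
    proof (cases "G u")
      case True
      then obtain x \<tau> where r: "run \<alpha> t0 a b u x \<tau>" unfolding G_def by blast
      have q': "q = t0 + \<tau>" using q DS(2)[OF u r] by simp
      from run_end[OF g u V(1) r] show ?thesis
        unfolding DS(1)[OF u r] q' Q_def using apex by metis
    next
      case False
      have q': "q = t0" using q DS0(2)[OF False] by simp
      have "\<not> heads t0 b u (sgn (z - b))" if "z \<in> Bd \<alpha> a b" for z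
        using headsG[OF u that] False by blast
      then show ?thesis unfolding q' Q_def using g V(1) by (simp only: traj_start) blast
    qed
  qed
qed

text \<open>Two rounds suffice: from the vertex nothing is hidden, so in the second round
  \<open>apex\<close> is vacuous. The set to be guarded remains the initial region while the state
  changes, which is why \<open>guard_step\<close> keeps V apart from the current region.\<close>

lemma guard_Dom:
  assumes g: "good \<alpha> a b"
  shows "guard \<alpha> t0 a b (Dom \<alpha> a b) (\<lambda>_. True)"
proof (rule guard_step[OF g order_refl closed_not_Dom[OF goodD(2,3)[OF g]]])
  fix q :: real and y assume y: "good \<alpha> 0 y" "Dom \<alpha> 0 y \<subseteq> Dom \<alpha> a b"
  show "guard \<alpha> q 0 y (Dom \<alpha> a b) (\<lambda>_. True)"
    by (rule guard_step[OF y closed_not_Dom[OF goodD(2,3)[OF g]]]) (auto simp: blocked_def)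
qed

end

theorem theorem15:
  fixes \<theta>0 \<alpha> t0 :: real and xp0 xe0 :: plane and X :: "plane set"
  assumes "0 < \<theta>0" and "\<theta>0 < pi / 2"
    and X_eq: "X = corner_domain \<theta>0"
    and "1 < \<alpha>"
    and "xp0 \<in> X" and "xe0 \<in> X" and "xp0 \<noteq> xe0"
    and "(0, 0) \<notin> closure (dominance_region X \<alpha> xp0 xe0)"
  shows "\<exists>\<delta> \<in> nonanticipative_strategies X \<alpha> t0 xp0 xe0.
           \<forall>ue \<in> admissible_controls X 1 t0 xe0. \<forall>t\<ge>t0.
             ereal t < terminal_time \<alpha> t0 xp0 xe0 (\<delta> ue) ue \<longrightarrow>
             trajectory 1 t0 xe0 ue t \<in> dominance_region X \<alpha> xp0 xe0"
proof -
  interpret K: corner "cos \<theta>0" "sin \<theta>0"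
    by unfold_locales (use assms(1,2) in \<open>auto intro: cos_gt_zero sin_gt_zero2\<close>)
  have X: "X = K.X" unfolding X_eq by (rule corner_domain_eq[OF assms(1,2)])
  note in_X = assms(5,6)[unfolded X]
  have dom: "dominance_region X \<alpha> xp0 xe0 = K.Dom \<alpha> xp0 xe0"
  proof (rule set_eqI)
    fix z
    show "z \<in> dominance_region X \<alpha> xp0 xe0 \<longleftrightarrow> z \<in> K.Dom \<alpha> xp0 xe0"
      unfolding dominance_region_def K.Dom_def X mem_Collect_eq
      by (intro conj_cong refl) (simp only: K.path_dist_eq in_X diff_gt_0_iff_gt)
  qed
  have "norm xp0 < \<alpha> * norm xe0"
    using K.not_good_zero[OF assms(4) in_X assms(7)] assms(8) unfolding dom zero_prod_def by blast
  then have "K.good \<alpha> xp0 xe0" unfolding K.good_def using assms(4,7) in_X by blast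
  from K.guard_Dom[OF this, of t0] obtain \<delta> where
    \<delta>: "\<delta> \<in> nonanticipative_strategies X \<alpha> t0 xp0 xe0"
      "\<And>u. u \<in> admissible_controls X 1 t0 xe0 \<Longrightarrow> K.confines \<alpha> t0 xp0 xe0 (K.Dom \<alpha> xp0 xe0) (\<delta> u) u"
    unfolding K.guard_def X by blast
  have "\<forall>r\<in>{t0..t}. trajectory \<alpha> t0 xp0 (\<delta> u) r \<noteq> trajectory 1 t0 xe0 u r"
    if h: "ereal t < terminal_time \<alpha> t0 xp0 xe0 (\<delta> u) u" for u t
  proof (intro ballI notI)
    fix r assume "r \<in> {t0..t}" "trajectory \<alpha> t0 xp0 (\<delta> u) r = trajectory 1 t0 xe0 u r"
    then have "terminal_time \<alpha> t0 xp0 xe0 (\<delta> u) u \<le> ereal r" "ereal r \<le> ereal t"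
      unfolding terminal_time_def by (auto intro!: Inf_lower)
    then show False using h by (metis less_le_trans not_less order_trans)
  qed
  then show ?thesis using \<delta> unfolding dom K.confines_def by blast
qed

end
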